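(* Let $p>q\ge 0$ and $d\ge1$ be integers, and let $Y=(Y_t)_{t\in\mathbb{R}}$ be the $d$-dimensional MCARMA process with autoregressive polynomial $P(z)=I_dz^p+A_1z^{p-1}+\dots+A_p$ and moving average polynomial $Q(z)=B_0z^q+B_1z^{q-1}+\dots+B_q$, where all zeros of $\det P(z)$ have negative real part. For $\Delta>0$ let $f_\Delta$ be the spectral density matrix of the sampled process $(Y_{n\Delta})_{n\in\mathbb{Z}}$. Then for $\omega\neq0$, $\omega\in(-\pi,\pi)$, $$f_\Delta(\omega)=-\frac1{2\pi}\sum_{k=2(p-q)-1}^\infty(-\Delta)^k\,\Theta_k\,\widetilde c_k(\omega).$$
   Context: $A_i,B_j$ are real $d\times d$ matrices; $I_d$ is the $d$-dimensional identity matrix; $\mathfrak{i}$ is the imaginary unit. Driving process: $L=(L_t)_{t\in\mathbb{R}}$ is a two-sided $d$-dimensional Lévy process, $L_t=L_1(t)$ for $t\ge0$, $L_t=-L_2(-t-)$ for $t<0$, with $L_1,L_2$ independent identically distributed one-sided Lévy processes, $\mathbf{E}L_1(1)=0$, $\mathbf{E}\|L_1(1)\|^2<\infty$, and $\Sigma_L$ is the covariance matrix of $L_1(1)$. MCARMA process: $Y_t=\int_{-\infty}^t g(t-s)\,\mathrm{d}L_s$ (in the $L^2$ sense), with $g(t)=\frac1{2\pi}\int_{-\infty}^{\infty}e^{\mathfrak{i}tx}P(\mathfrak{i}x)^{-1}Q(\mathfrak{i}x)\,\mathrm{d}x$, which vanishes on the negative half-line. Its spectral density is $f_Y(\lambda)=\frac1{2\pi}P(\mathfrak{i}\lambda)^{-1}Q(\mathfrak{i}\lambda)\Sigma_LQ(\mathfrak{i}\lambda)^*(P(\mathfrak{i}\lambda)^{-1})^*$,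 $\lambda\in\mathbb{R}$, where $*$ is the conjugate transpose, so that $\Gamma(t):=\mathbf{E}[Y_tY_0^\top]=\int_{\mathbb{R}}e^{\mathfrak{i}t\lambda}f_Y(\lambda)\,\mathrm{d}\lambda$. Spectral density of the sampled process: $f_\Delta(\omega)=\frac1{2\pi}\sum_{k\in\mathbb{Z}}e^{-\mathfrak{i}k\omega}\Gamma(k\Delta)$. $R(z)=P(z)^{-1}Q(z)\,\Sigma_L\,Q(-z)^\top(P(-z)^{-1})^\top$, $z\in\mathbb{C}$. For integers $k\ge0$, $\Theta_k=\frac{1}{2\pi\mathfrak{i}}\int_{\rho\cup-\rho}z^kR(z)\,\mathrm{d}z=-\mathrm{Res}(z^kR(z),\infty)$ (componentwise), where $\rho$ is a fixed closed curve in the open left half-plane encircling the zeros of $\det P(z)$ once in the positive direction and $-\rho$ is its reflection $\{-z:z\in\rho\}$, encircling the zeros of $\det P(-z)$ once in the positive direction. The coefficients $\widetilde c_k(\omega)$, $\omega\in(-\pi,\pi)$, $\omega\neq0$, are defined by $\frac{1}{1-e^{z+\mathfrak{i}\omega}}=\sum_{k=0}^\infty\widetilde c_k(\omega)z^k$, $|z|<|\omega|$.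
   Formalization: The series can diverge for large Δ (e.g. d=p=1, q=0, P(z)=z+a, Δa≥|ω|), so the identity is stated for every Δ>0 at which the series converges, and convergence is proved whenever Δ|λ|<|ω| for all zeros λ of det P. *)

theory Defs
  imports "HOL-Probability.Probability" "HOL-Complex_Analysis.Complex_Analysis"
begin

unbundle no fps_syntax

section \<open>Matrix polynomials\<close>

abbreviation cmat :: "real^'n^'m \<Rightarrow> complex^'n^'m"
  where "cmat \<equiv> map_matrix complex_of_real"

definition cscale :: "complex \<Rightarrow> complex^'n^'m \<Rightarrow> complex^'n^'m"
  where "cscale z X = map_matrix (\<lambda>x. z * x) X"

definition ar_poly :: "nat \<Rightarrow> (nat \<Rightarrow> real^'d^'d) \<Rightarrow> complex \<Rightarrow> complex^'d^'d"
  where "ar_poly p A z = cscale (z ^ p) (mat 1) + (\<Sum>i=1..p. cscale (z ^ (p - i)) (cmat (A i)))"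

definition ma_poly :: "nat \<Rightarrow> (nat \<Rightarrow> real^'d^'d) \<Rightarrow> complex \<Rightarrow> complex^'d^'d"
  where "ma_poly q B z = (\<Sum>j=0..q. cscale (z ^ (q - j)) (cmat (B j)))"


section \<open>Levy processes\<close>

definition levy_process :: "'w measure \<Rightarrow> (real \<Rightarrow> 'w \<Rightarrow> real^'d) \<Rightarrow> bool"
  where "levy_process M X \<longleftrightarrow>
     prob_space M \<and>
     (\<forall>t\<ge>0. X t \<in> borel_measurable M) \<and>
     (AE w in M. X 0 w = 0) \<and>
     (\<forall>n \<tau>. 0 \<le> \<tau> 0 \<and> (\<forall>i<n. \<tau> i \<le> \<tau> (Suc i)) \<longrightarrow>
        prob_space.indep_vars M (\<lambda>_. borel) (\<lambda>i w. X (\<tau> (Suc i)) w - X (\<tau> i) w) {..<n::nat}) \<and>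
     (\<forall>s\<ge>0. \<forall>h\<ge>0. distr M borel (\<lambda>w. X (s + h) w - X s w) = distr M borel (X h)) \<and>
     (\<forall>t\<ge>0. \<forall>e>0. ((\<lambda>s. measure M {w \<in> space M. norm (X s w - X t w) > e}) \<longlongrightarrow> 0)
        (at t within {0..})) \<and>
     (AE w in M. (\<forall>t\<ge>0. ((\<lambda>s. X s w) \<longlongrightarrow> X t w) (at_right t)) \<and>
                 (\<forall>t>0. \<exists>l. ((\<lambda>s. X s w) \<longlongrightarrow> l) (at_left t)))"

text \<open>Independence and equality in law of the two one-sided processes are meant at the level of
  whole processes, i.e. as random elements of the product space over the time set \<open>[0, \<infinity>)\<close>.
  Left limits exist only almost surely, so the defining relation of the two-sided process is
  imposed off a null set, and measurability of \<open>L t\<close> is required separately.\<close>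

definition two_sided_levy ::
    "'w measure \<Rightarrow> (real \<Rightarrow> 'w \<Rightarrow> real^'d) \<Rightarrow> (real \<Rightarrow> 'w \<Rightarrow> real^'d)
      \<Rightarrow> (real \<Rightarrow> 'w \<Rightarrow> real^'d) \<Rightarrow> bool"
  where "two_sided_levy M L1 L2 L \<longleftrightarrow>
     levy_process M L1 \<and> levy_process M L2 \<and>
     prob_space.indep_var M
       (PiM {0..} (\<lambda>_. borel)) (\<lambda>w. \<lambda>t\<in>{0..}. L1 t w)
       (PiM {0..} (\<lambda>_. borel)) (\<lambda>w. \<lambda>t\<in>{0..}. L2 t w) \<and>
     distr M (PiM {0..} (\<lambda>_. borel)) (\<lambda>w. \<lambda>t\<in>{0..}. L1 t w) =
     distr M (PiM {0..} (\<lambda>_. borel)) (\<lambda>w. \<lambda>t\<in>{0..}. L2 t w) \<and>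
     (\<forall>t. L t \<in> borel_measurable M) \<and>
     (AE w in M. \<forall>t. L t w = (if t \<ge> 0 then L1 t w else - Lim (at_left (- t)) (\<lambda>s. L2 s w)))"

definition cov_matrix :: "'w measure \<Rightarrow> ('w \<Rightarrow> real^'d) \<Rightarrow> real^'d^'d"
  where "cov_matrix M X =
     (\<chi> i j. \<integral>w. (X w $ i - (\<integral>v. X v $ i \<partial>M)) * (X w $ j - (\<integral>v. X v $ j \<partial>M)) \<partial>M)"


section \<open>\<open>L\<^sup>2\<close> integrals of deterministic matrix functions\<close>

text \<open>A step function is coded by a list of triples \<open>(a, b, C)\<close> with \<open>a \<le> b\<close>, standing for the
  sum of the functions with constant value \<open>C\<close> on \<open>(a, b]\<close>.\<close>

definition step_fun :: "(real \<times> real \<times> (real^'d^'d)) list \<Rightarrow> real \<Rightarrow> real^'d^'d"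
  where "step_fun xs s = (\<Sum>(a, b, C)\<leftarrow>xs. indicator {a<..b} s *\<^sub>R C)"

definition step_integral ::
    "(real \<Rightarrow> 'w \<Rightarrow> real^'d) \<Rightarrow> (real \<times> real \<times> (real^'d^'d)) list \<Rightarrow> 'w \<Rightarrow> real^'d"
  where "step_integral L xs w = (\<Sum>(a, b, C)\<leftarrow>xs. C *v (L b w - L a w))"

text \<open>\<open>X\<close> is a version of \<open>\<integral> h dL\<close>.\<close>

definition is_L2_integral ::
    "'w measure \<Rightarrow> (real \<Rightarrow> 'w \<Rightarrow> real^'d) \<Rightarrow> (real \<Rightarrow> real^'d^'d) \<Rightarrow> ('w \<Rightarrow> real^'d) \<Rightarrow> bool"
  where "is_L2_integral M L h X \<longleftrightarrow>
     h \<in> borel_measurable lborel \<and> X \<in> borel_measurable M \<and>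
     (\<exists>xs :: nat \<Rightarrow> (real \<times> real \<times> (real^'d^'d)) list.
        (\<forall>n. \<forall>(a, b, C) \<in> set (xs n). a \<le> b) \<and>
        (\<lambda>n. \<integral>\<^sup>+s. ennreal ((norm (h s - step_fun (xs n) s))\<^sup>2) \<partial>lborel) \<longlonglongrightarrow> 0 \<and>
        (\<lambda>n. \<integral>\<^sup>+w. ennreal ((norm (X w - step_integral L (xs n) w))\<^sup>2) \<partial>M) \<longlonglongrightarrow> 0)"


section \<open>MCARMA processes and the sampled spectral density\<close>

text \<open>The integrand need not be absolutely integrable if \<open>p = q + 1\<close>, so the integral over the
  line is taken as the limit of the integrals over \<open>[-T, T]\<close>. Its value is real because the
  coefficient matrices are; \<open>Re\<close> only adjusts the type.\<close>

definition mcarma_kernel ::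
    "nat \<Rightarrow> nat \<Rightarrow> (nat \<Rightarrow> real^'d^'d) \<Rightarrow> (nat \<Rightarrow> real^'d^'d) \<Rightarrow> real \<Rightarrow> real^'d^'d"
  where "mcarma_kernel p q A B t =
     (\<chi> i j. Re (1 / (2 * pi) * Lim at_top (\<lambda>T :: real. integral {-T..T}
        (\<lambda>x. exp (\<i> * t * x) *
             (matrix_inv (ar_poly p A (\<i> * x)) ** ma_poly q B (\<i> * x)) $ i $ j))))"

definition mcarma_process ::
    "'w measure \<Rightarrow> (real \<Rightarrow> 'w \<Rightarrow> real^'d) \<Rightarrow> nat \<Rightarrow> nat \<Rightarrow> (nat \<Rightarrow> real^'d^'d)
      \<Rightarrow> (nat \<Rightarrow> real^'d^'d) \<Rightarrow> (real \<Rightarrow> 'w \<Rightarrow> real^'d) \<Rightarrow> bool"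
  where "mcarma_process M L p q A B Y \<longleftrightarrow>
     (\<forall>t. is_L2_integral M L (\<lambda>s. if s \<le> t then mcarma_kernel p q A B (t - s) else 0) (Y t))"

definition autocov :: "'w measure \<Rightarrow> (real \<Rightarrow> 'w \<Rightarrow> real^'d) \<Rightarrow> real \<Rightarrow> real^'d^'d"
  where "autocov M Y t = (\<chi> i j. \<integral>w. Y t w $ i * Y 0 w $ j \<partial>M)"

definition sampled_spectral_density ::
    "'w measure \<Rightarrow> (real \<Rightarrow> 'w \<Rightarrow> real^'d) \<Rightarrow> real \<Rightarrow> real \<Rightarrow> complex^'d^'d"
  where "sampled_spectral_density M Y \<Delta> \<omega> =
     cscale (1 / (2 * pi))
       (\<Sum>\<^sub>\<infinity>k\<in>(UNIV :: int set). cscale (exp (- \<i> * k * \<omega>)) (cmat (autocov M Y (real_of_int k * \<Delta>))))"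


section \<open>The coefficients of the expansion\<close>

definition R_fun ::
    "nat \<Rightarrow> nat \<Rightarrow> (nat \<Rightarrow> real^'d^'d) \<Rightarrow> (nat \<Rightarrow> real^'d^'d) \<Rightarrow> real^'d^'d
      \<Rightarrow> complex \<Rightarrow> complex^'d^'d"
  where "R_fun p q A B S z =
     matrix_inv (ar_poly p A z) ** ma_poly q B z ** cmat S **
     transpose (ma_poly q B (- z)) ** transpose (matrix_inv (ar_poly p A (- z)))"

definition encircles_in_left_half_plane :: "(real \<Rightarrow> complex) \<Rightarrow> complex set \<Rightarrow> bool"
  where "encircles_in_left_half_plane \<rho> Z \<longleftrightarrow>
     valid_path \<rho> \<and> pathfinish \<rho> = pathstart \<rho> \<and>
     path_image \<rho> \<subseteq> {z. Re z < 0} - Z \<and> (\<forall>z\<in>Z. winding_number \<rho> z = 1)"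

text \<open>The path \<open>\<lambda>t. - \<rho> t\<close> is \<open>\<rho>\<close> rotated by \<open>\<pi>\<close> about the origin, so it inherits the
  positive orientation.\<close>

definition Theta ::
    "nat \<Rightarrow> nat \<Rightarrow> (nat \<Rightarrow> real^'d^'d) \<Rightarrow> (nat \<Rightarrow> real^'d^'d) \<Rightarrow> real^'d^'d
      \<Rightarrow> (real \<Rightarrow> complex) \<Rightarrow> nat \<Rightarrow> complex^'d^'d"
  where "Theta p q A B S \<rho> k =
     (\<chi> i j. 1 / (2 * pi * \<i>) *
        (contour_integral \<rho> (\<lambda>z. z ^ k * R_fun p q A B S z $ i $ j) +
         contour_integral (\<lambda>t. - \<rho> t) (\<lambda>z. z ^ k * R_fun p q A B S z $ i $ j)))"

definition c_tilde :: "real \<Rightarrow> nat \<Rightarrow> complex"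
  where "c_tilde \<omega> =
     (THE c. \<forall>z. cmod z < \<bar>\<omega>\<bar> \<longrightarrow> (\<lambda>k. c k * z ^ k) sums (1 / (1 - exp (z + \<i> * \<omega>))))"

definition expansion_term ::
    "nat \<Rightarrow> nat \<Rightarrow> (nat \<Rightarrow> real^'d^'d) \<Rightarrow> (nat \<Rightarrow> real^'d^'d) \<Rightarrow> real^'d^'d
      \<Rightarrow> (real \<Rightarrow> complex) \<Rightarrow> real \<Rightarrow> real \<Rightarrow> nat \<Rightarrow> complex^'d^'d"
  where "expansion_term p q A B S \<rho> \<Delta> \<omega> k =
     cscale ((- of_real \<Delta>) ^ k * c_tilde \<omega> k) (Theta p q A B S \<rho> k)"

end

theory Submission
  imports Defs "HOL-Computational_Algebra.Fundamental_Theorem_Algebra"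
begin

text \<open>Write \<open>F = P^-1 Q\<close>. By the Ito isometry, \<open>\<Gamma>(t)\<close> is the integral of \<open>g(t + u) \<Sigma> g(u)^T\<close> over
  \<open>u > 0\<close>. Partial fractions of \<open>F\<close> turn \<open>g\<close> into a sum of exponential monomials, and the Laplace
  transform of \<open>g\<close> is \<open>F\<close>. Hence, for \<open>t \<ge> 0\<close>, the matrix \<open>\<Gamma>(t)\<close> is the sum of the residues of
  \<open>e^(tz) R(z)\<close> in the left half-plane, and \<open>\<Gamma>(-t)\<close> is minus the sum of those of \<open>e^(-tz) R(z)\<close> in
  the right half-plane. Summing two geometric series, and using \<open>\<Theta>_0 = 0\<close>, shows that
  \<open>- 2 \<pi> f_\<Delta>(\<omega>)\<close> is the sum of all residues of \<open>R(z) / (1 - e^(i\<omega> - \<Delta>z))\<close>. For small \<open>\<Delta>\<close> the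
  Taylor expansion of \<open>1 / (1 - e^(z + i\<omega>))\<close> may be inserted here, and since both sides are
  analytic in \<open>\<Delta>\<close> the identity persists as long as the series converges. The \<open>\<Theta>_k\<close> with
  \<open>k < 2(p - q) - 1\<close> vanish because \<open>z^(2(p - q)) R(z)\<close> is bounded near infinity.\<close>

(* The bundle fps_syntax that Defs switches off is the later one of formal Laurent series;
   the power series notation for $ has to be switched off by its qualified name. *)
unbundle no Formal_Power_Series.fps_syntax

section \<open>Square integrable functions\<close>

lemma additive_bounded_linear:
  fixes f :: "real \<Rightarrow> real"
  assumes add: "\<And>s t. 0 \<le> s \<Longrightarrow> 0 \<le> t \<Longrightarrow> f (s + t) = f s + f t"
    and "d > 0" and bd: "\<And>t. 0 \<le> t \<Longrightarrow> t \<le> d \<Longrightarrow> \<bar>f t\<bar> \<le> C"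
  shows "0 \<le> t \<Longrightarrow> f t = t * f 1"
proof -
  define g where "g t = f t - t * (f d / d)" for t
  have gadd: "g (s + t) = g s + g t" if "0 \<le> s" "0 \<le> t" for s t
    using add[OF that] by (simp add: g_def algebra_simps add_divide_distrib)
  have gd: "g d = 0" using \<open>d > 0\<close> by (simp add: g_def)
  define C' where "C' = C + \<bar>f d\<bar>"
  have gbd: "\<bar>g t\<bar> \<le> C'" if "0 \<le> t" "t \<le> d" for t
  proof -
    have "\<bar>t * (f d / d)\<bar> = (t / d) * \<bar>f d\<bar>" using that by (simp add: abs_mult)
    also have "\<dots> \<le> 1 * \<bar>f d\<bar>" using that \<open>d > 0\<close> by (intro mult_right_mono) auto
    finally show ?thesis using bd[OF that] unfolding g_def C'_def by linarith
  qed
  have gmult: "g (real n * t) = real n * g t" if "0 \<le> t" for n t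
  proof (induction n)
    case 0
    show ?case using gadd[of 0 0] by simp
  next
    case (Suc n)
    then show ?case using gadd[of "real n * t" t] that by (simp add: algebra_simps)
  qed
  have gall: "\<bar>g t\<bar> \<le> C'" if "0 \<le> t" for t
  proof -
    define n where "n = nat \<lfloor>t / d\<rfloor>"
    define r where "r = t - real n * d"
    have "0 \<le> t / d" using that \<open>d > 0\<close> by simp
    then have n: "real n \<le> t / d" "t / d < real n + 1" unfolding n_def by linarith+
    then have r: "0 \<le> r" "r \<le> d" using \<open>d > 0\<close> by (auto simp: r_def field_simps)
    have "g t = g (real n * d) + g r" using gadd[of "real n * d" r] r \<open>d > 0\<close> by (simp add: r_def)
    also have "g (real n * d) = 0" using gmult[of d n] \<open>d > 0\<close> gd by simp
    finally show ?thesis using gbd[OF r] by simp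
  qed
  have g0: "g t = 0" if "0 \<le> t" for t
  proof (rule ccontr)
    assume "g t \<noteq> 0"
    then obtain n where "real n * \<bar>g t\<bar> > C'" using reals_Archimedean3[of "\<bar>g t\<bar>"] by auto
    moreover have "real n * \<bar>g t\<bar> = \<bar>g (real n * t)\<bar>" using gmult[OF that] by (simp add: abs_mult)
    moreover have "\<bar>g (real n * t)\<bar> \<le> C'" using that by (intro gall) auto
    ultimately show False by simp
  qed
  assume "0 \<le> t"
  then show "f t = t * f 1" using g0[of t] g0[of 1] by (simp add: g_def)
qed

lemma square_integrable_diff_cancel:
  fixes f g :: "'a \<Rightarrow> real"
  assumes [measurable]: "f \<in> borel_measurable M" "g \<in> borel_measurable M"
    and "integrable M (\<lambda>x. (g x)\<^sup>2)" "(\<integral>\<^sup>+x. ennreal ((f x - g x)\<^sup>2) \<partial>M) < \<infinity>"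
  shows "integrable M (\<lambda>x. (f x)\<^sup>2)"
proof (rule Bochner_Integration.integrable_bound)
  have "integrable M (\<lambda>x. (f x - g x)\<^sup>2)" using assms(4) by (intro integrableI_bounded) auto
  then show "integrable M (\<lambda>x. 2 * (f x - g x)\<^sup>2 + 2 * (g x)\<^sup>2)" using assms(3) by auto
  have "(f x)\<^sup>2 \<le> 2 * (f x - g x)\<^sup>2 + 2 * (g x)\<^sup>2" for x
    using zero_le_power2[of "f x - 2 * g x"] by (simp add: power2_eq_square algebra_simps)
  then show "AE x in M. norm ((f x)\<^sup>2) \<le> norm (2 * (f x - g x)\<^sup>2 + 2 * (g x)\<^sup>2)" by auto
qed measurable

lemma integrable_mult_L2:
  fixes f g :: "'a \<Rightarrow> real"
  assumes [measurable]: "f \<in> borel_measurable M" "g \<in> borel_measurable M"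
    and "integrable M (\<lambda>x. (f x)\<^sup>2)" "integrable M (\<lambda>x. (g x)\<^sup>2)"
  shows "integrable M (\<lambda>x. f x * g x)"
proof (rule Bochner_Integration.integrable_bound)
  show "integrable M (\<lambda>x. (f x)\<^sup>2 + (g x)\<^sup>2)" using assms by auto
  have "\<bar>f x * g x\<bar> \<le> (f x)\<^sup>2 + (g x)\<^sup>2" for x
    using zero_le_power2[of "f x - g x"] zero_le_power2[of "f x + g x"]
    by (auto simp: power2_eq_square algebra_simps abs_le_iff intro: order.trans)
  then show "AE x in M. norm (f x * g x) \<le> norm ((f x)\<^sup>2 + (g x)\<^sup>2)" by auto
qed measurable

lemma square_integrable_add:
  fixes f g :: "'a \<Rightarrow> real"
  assumes [measurable]: "f \<in> borel_measurable M" "g \<in> borel_measurable M"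
    and "integrable M (\<lambda>x. (f x)\<^sup>2)" "integrable M (\<lambda>x. (g x)\<^sup>2)"
  shows "integrable M (\<lambda>x. (f x + g x)\<^sup>2)"
  using assms integrable_mult_L2[OF assms] by (auto simp: power2_sum mult.assoc)

lemma Cauchy_Schwarz_real:
  fixes f g :: "'a \<Rightarrow> real"
  assumes [measurable]: "f \<in> borel_measurable M" "g \<in> borel_measurable M"
    and f: "integrable M (\<lambda>x. (f x)\<^sup>2)" and g: "integrable M (\<lambda>x. (g x)\<^sup>2)"
  shows "\<bar>\<integral>x. f x * g x \<partial>M\<bar> \<le>
      sqrt (\<integral>x. (f x)\<^sup>2 \<partial>M) * sqrt (\<integral>x. (g x)\<^sup>2 \<partial>M)"
proof -
  define a where "a = (\<integral>x. (f x)\<^sup>2 \<partial>M)"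
  define b where "b = (\<integral>x. f x * g x \<partial>M)"
  define c where "c = (\<integral>x. (g x)\<^sup>2 \<partial>M)"
  have fg: "integrable M (\<lambda>x. f x * g x)" using assms by (rule integrable_mult_L2)
  have ac: "0 \<le> a" "0 \<le> c" by (auto simp: a_def c_def)
  have q: "0 \<le> a * s\<^sup>2 + 2 * b * s + c" for s
  proof -
    have "0 \<le> (\<integral>x. (s * f x + g x)\<^sup>2 \<partial>M)" by simp
    also have "(\<integral>x. (s * f x + g x)\<^sup>2 \<partial>M) =
        (\<integral>x. s\<^sup>2 * (f x)\<^sup>2 + (2 * s) * (f x * g x) + (g x)\<^sup>2 \<partial>M)"
      by (intro Bochner_Integration.integral_cong) (auto simp: power2_eq_square algebra_simps)
    also have "\<dots> = s\<^sup>2 * a + (2 * s) * b + c"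
      using f g fg by (simp add: a_def b_def c_def)
    finally show ?thesis by (simp add: mult_ac)
  qed
  have "b\<^sup>2 \<le> a * c"
  proof (cases "a = 0")
    case True
    have "b = 0"
    proof (rule ccontr)
      assume "b \<noteq> 0"
      then show False using q[of "- (c + 1) / (2 * b)"] True by simp
    qed
    then show ?thesis using ac by simp
  next
    case False
    then have "0 \<le> c - b\<^sup>2 / a" using q[of "- b / a"] by (simp add: power2_eq_square field_simps)
    then show ?thesis using False ac by (simp add: field_simps)
  qed
  then have "\<bar>b\<bar> \<le> sqrt (a * c)" by (simp add: real_le_rsqrt)
  then show ?thesis by (simp add: real_sqrt_mult a_def b_def c_def)
qed

lemma integral_mult_tendsto_L2:
  fixes f g :: "'a \<Rightarrow> real" and F G :: "nat \<Rightarrow> 'a \<Rightarrow> real"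
  assumes m[measurable]: "f \<in> borel_measurable M" "g \<in> borel_measurable M"
      "\<And>n. F n \<in> borel_measurable M" "\<And>n. G n \<in> borel_measurable M"
    and F: "\<And>n. integrable M (\<lambda>x. (F n x)\<^sup>2)" and G: "\<And>n. integrable M (\<lambda>x. (G n x)\<^sup>2)"
    and fF: "(\<lambda>n. \<integral>\<^sup>+x. ennreal ((f x - F n x)\<^sup>2) \<partial>M) \<longlonglongrightarrow> 0"
    and gG: "(\<lambda>n. \<integral>\<^sup>+x. ennreal ((g x - G n x)\<^sup>2) \<partial>M) \<longlonglongrightarrow> 0"
  shows "integrable M (\<lambda>x. (f x)\<^sup>2)" "integrable M (\<lambda>x. (g x)\<^sup>2)"
    "(\<lambda>n. \<integral>x. F n x * G n x \<partial>M) \<longlonglongrightarrow> (\<integral>x. f x * g x \<partial>M)"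
proof -
  have main: "integrable M (\<lambda>x. (h x)\<^sup>2)" "(\<lambda>n. \<integral>x. (h x - H n x)\<^sup>2 \<partial>M) \<longlonglongrightarrow> 0"
    if [measurable]: "h \<in> borel_measurable M" "\<And>n. H n \<in> borel_measurable M"
      and H: "\<And>n. integrable M (\<lambda>x. (H n x)\<^sup>2)"
      and hH: "(\<lambda>n. \<integral>\<^sup>+x. ennreal ((h x - H n x)\<^sup>2) \<partial>M) \<longlonglongrightarrow> 0" for h H
  proof -
    have ev: "eventually (\<lambda>n. (\<integral>\<^sup>+x. ennreal ((h x - H n x)\<^sup>2) \<partial>M) < 1) sequentially"
      by (rule order_tendstoD(2)[OF hH]) simp
    then obtain n where "(\<integral>\<^sup>+x. ennreal ((h x - H n x)\<^sup>2) \<partial>M) < 1"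
      by (auto simp: eventually_sequentially)
    then have "(\<integral>\<^sup>+x. ennreal ((h x - H n x)\<^sup>2) \<partial>M) < \<infinity>" by (rule less_trans) simp
    with square_integrable_diff_cancel[of h M "H n"] H show 1: "integrable M (\<lambda>x. (h x)\<^sup>2)" by simp
    have 2: "integrable M (\<lambda>x. (h x - H n x)\<^sup>2)" for n
      using square_integrable_add[of h M "\<lambda>x. - H n x"] 1 H by simp
    have "ennreal (\<integral>x. (h x - H n x)\<^sup>2 \<partial>M) = (\<integral>\<^sup>+x. ennreal ((h x - H n x)\<^sup>2) \<partial>M)" for n
      by (rule nn_integral_eq_integral[symmetric, OF 2]) simp
    then have "(\<lambda>n. ennreal (\<integral>x. (h x - H n x)\<^sup>2 \<partial>M)) \<longlonglongrightarrow> ennreal 0" using hH by simp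
    then show "(\<lambda>n. \<integral>x. (h x - H n x)\<^sup>2 \<partial>M) \<longlonglongrightarrow> 0"
      by (subst (asm) tendsto_ennreal_iff) auto
  qed
  show f: "integrable M (\<lambda>x. (f x)\<^sup>2)" by (rule main(1)[OF _ _ F fF]) auto
  show g: "integrable M (\<lambda>x. (g x)\<^sup>2)" by (rule main(1)[OF _ _ G gG]) auto
  have df: "integrable M (\<lambda>x. (f x - F n x)\<^sup>2)" for n
    using square_integrable_add[of f M "\<lambda>x. - F n x"] f F by simp
  have dg: "integrable M (\<lambda>x. (g x - G n x)\<^sup>2)" for n
    using square_integrable_add[of g M "\<lambda>x. - G n x"] g G by simp
  define A where "A n = sqrt (\<integral>x. (f x - F n x)\<^sup>2 \<partial>M)" for n
  define B where "B n = sqrt (\<integral>x. (g x - G n x)\<^sup>2 \<partial>M)" for n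
  have A: "A \<longlonglongrightarrow> 0" unfolding A_def using tendsto_real_sqrt[OF main(2)[OF _ _ F fF]] by simp
  have B: "B \<longlonglongrightarrow> 0" unfolding B_def using tendsto_real_sqrt[OF main(2)[OF _ _ G gG]] by simp
  define a where "a = sqrt (\<integral>x. (f x)\<^sup>2 \<partial>M)"
  define b where "b = sqrt (\<integral>x. (g x)\<^sup>2 \<partial>M)"
  have le: "norm ((\<integral>x. F n x * G n x \<partial>M) - (\<integral>x. f x * g x \<partial>M)) \<le> A n * b + a * B n + A n * B n" for n
  proof -
    let ?d = "\<lambda>x. f x - F n x" and ?e = "\<lambda>x. g x - G n x"
    have i: "integrable M (\<lambda>x. ?d x * g x)" "integrable M (\<lambda>x. f x * ?e x)" "integrable M (\<lambda>x. ?d x *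
        ?e x)" "integrable M (\<lambda>x. f x * g x)" "integrable M (\<lambda>x. F n x * G n x)"
      by (intro integrable_mult_L2 df dg f g F G; measurable)+
    have "(\<integral>x. F n x * G n x \<partial>M) - (\<integral>x. f x * g x \<partial>M) = (\<integral>x. F n x * G n x - f x * g x \<partial>M)"
      using i by simp
    also have "\<dots> = (\<integral>x. ?d x * ?e x - ?d x * g x - f x * ?e x \<partial>M)"
      by (intro Bochner_Integration.integral_cong) (auto simp: algebra_simps)
    also have "\<dots> = (\<integral>x. ?d x * ?e x \<partial>M) - (\<integral>x. ?d x * g x \<partial>M) - (\<integral>x. f x * ?e x \<partial>M)"
      using i by simp
    finally have "\<bar>(\<integral>x. F n x * G n x \<partial>M) - (\<integral>x. f x * g x \<partial>M)\<bar> \<le>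
        \<bar>\<integral>x. ?d x * ?e x \<partial>M\<bar> + \<bar>\<integral>x. ?d x * g x \<partial>M\<bar> +
            \<bar>\<integral>x. f x * ?e x \<partial>M\<bar>"
      by linarith
    also have "\<dots> \<le> A n * B n + A n * b + a * B n"
      unfolding A_def B_def a_def b_def by (intro add_mono Cauchy_Schwarz_real df dg f g; measurable)
    finally show ?thesis by simp
  qed
  have lim: "(\<lambda>n. A n * b + a * B n + A n * B n) \<longlonglongrightarrow> 0 * b + a * 0 + 0 * 0"
    by (intro tendsto_intros A B)
  have "(\<lambda>n. (\<integral>x. F n x * G n x \<partial>M) - (\<integral>x. f x * g x \<partial>M)) \<longlonglongrightarrow> 0"
    by (rule Lim_null_comparison[OF always_eventually[OF allI[OF le]]]) (use lim in simp)
  then show "(\<lambda>n. \<integral>x. F n x * G n x \<partial>M) \<longlonglongrightarrow> (\<integral>x. f x * g x \<partial>M)"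
      by (simp add: LIM_zero_iff)
qed

section \<open>Second moments of a Levy process\<close>

lemma borel_measurable_vec_nth [measurable (raw)]:
  fixes f :: "'a \<Rightarrow> ('b::topological_space)^'n"
  assumes "f \<in> borel_measurable M" shows "(\<lambda>w. f w $ i) \<in> borel_measurable M"
  by (rule measurable_compose[OF assms]) (intro borel_measurable_continuous_onI continuous_intros)

lemma (in prob_space) square_integrable_of_indep_sum:
  fixes U V :: "'a \<Rightarrow> real"
  assumes ind: "indep_var borel U borel V" and sq: "integrable M (\<lambda>w. (U w + V w)\<^sup>2)"
  shows "integrable M (\<lambda>w. (U w)\<^sup>2)"
proof -
  have [measurable]: "U \<in> borel_measurable M" "V \<in> borel_measurable M"
    using indep_var_rv1[OF ind] indep_var_rv2[OF ind] by auto
  interpret U: prob_space "distr M borel U" by (rule prob_space_distr, rule indep_var_rv1[OF ind])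
  interpret V: prob_space "distr M borel V" by (rule prob_space_distr, rule indep_var_rv2[OF ind])
  interpret UV: pair_prob_space "distr M borel U" "distr M borel V" ..
  have "\<infinity> > (\<integral>\<^sup>+w. ennreal ((U w + V w)\<^sup>2) \<partial>M)"
    using sq by (simp add: nn_integral_eq_integral)
  also have "(\<integral>\<^sup>+w. ennreal ((U w + V w)\<^sup>2) \<partial>M) =
      (\<integral>\<^sup>+z. ennreal ((fst z + snd z)\<^sup>2) \<partial>distr M (borel \<Otimes>\<^sub>M borel) (\<lambda>w. (U w, V w)))"
    by (subst nn_integral_distr) auto
  also have "\<dots> = (\<integral>\<^sup>+z. ennreal ((fst z + snd z)\<^sup>2) \<partial>(distr M borel U \<Otimes>\<^sub>M distr M borel V))"
    using ind unfolding indep_var_distribution_eq by simp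
  also have "\<dots> = (\<integral>\<^sup>+v. (\<integral>\<^sup>+u. ennreal ((u + v)\<^sup>2) \<partial>distr M borel U) \<partial>distr M borel V)"
    by (subst UV.nn_integral_snd[symmetric]) auto
  finally have "(\<integral>\<^sup>+v. (\<integral>\<^sup>+u. ennreal ((u +
      v)\<^sup>2) \<partial>distr M borel U) \<partial>distr M borel V) \<noteq> \<infinity>" by simp
  then have "AE v in distr M borel V. (\<integral>\<^sup>+u. ennreal ((u + v)\<^sup>2) \<partial>distr M borel U) \<noteq> \<infinity>"
    by (intro nn_integral_PInf_AE) auto
  then have "\<exists>v. (\<integral>\<^sup>+u. ennreal ((u + v)\<^sup>2) \<partial>distr M borel U) \<noteq> \<infinity>"
    using V.AE_contr by (auto intro: eventually_mono)
  then obtain v where "(\<integral>\<^sup>+u. ennreal ((u + v)\<^sup>2) \<partial>distr M borel U) < \<infinity>" by (auto simp: less_top)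
  then have "(\<integral>\<^sup>+w. ennreal ((U w - (- v))\<^sup>2) \<partial>M) < \<infinity>"
    by (subst (asm) nn_integral_distr) auto
  then show ?thesis
    by (rule square_integrable_diff_cancel[where g="\<lambda>_. - v", rotated -1]) auto
qed

lemma (in prob_space) indep_var_of_indep_vars:
  assumes "indep_vars (\<lambda>_. N) Z I" "a \<in> I" "b \<in> I" "a \<noteq> b"
  shows "indep_var N (Z a) N (Z b)"
proof -
  have "indep_var (PiM {a} (\<lambda>_. N)) (\<lambda>w. \<lambda>i\<in>{a}. Z i w) (PiM {b} (\<lambda>_. N)) (\<lambda>w. \<lambda>i\<in>{b}. Z i w)"
    by (rule indep_var_restrict[OF assms(1)]) (use assms in auto)
  then have "indep_var N ((\<lambda>x. x a) \<circ> (\<lambda>w. \<lambda>i\<in>{a}. Z i w)) N ((\<lambda>x. x b)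
      \<circ> (\<lambda>w. \<lambda>i\<in>{b}. Z i w))"
    by (rule indep_var_compose) (auto intro: measurable_component_singleton)
  then show ?thesis by (simp add: o_def)
qed

locale levy =
  fixes M :: "'w measure" and X :: "real \<Rightarrow> 'w \<Rightarrow> real^'d"
  assumes lp: "levy_process M X"
    and sq1: "integrable M (\<lambda>w. (norm (X 1 w))\<^sup>2)"
    and mean1: "(\<integral>w. X 1 w \<partial>M) = 0"
begin

sublocale prob_space M using lp by (simp add: levy_process_def)

lemma X_measurable [measurable]: "0 \<le> t \<Longrightarrow> X t \<in> borel_measurable M"
  using lp by (simp add: levy_process_def)

lemma X_0: "AE w in M. X 0 w = 0"
  using lp by (simp add: levy_process_def)

lemma increment_distr:
  "0 \<le> s \<Longrightarrow> 0 \<le> h \<Longrightarrow> distr M borel (\<lambda>w. X (s + h) w - X s w) = distr M borel (X h)"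
  using lp by (simp add: levy_process_def)

lemma increment_indep:
  assumes "0 \<le> s" "0 \<le> h"
  shows "indep_var borel (\<lambda>w. (X s w - X 0 w) $ i) borel (\<lambda>w. (X (s + h) w - X s w) $ j)"
proof -
  define \<tau> where "\<tau> n = (if n = 0 then 0 else if n = 1 then s else s + h)" for n :: nat
  have "0 \<le> \<tau> 0 \<and> (\<forall>i<2. \<tau> i \<le> \<tau> (Suc i))" using assms by (auto simp: \<tau>_def less_2_cases_iff)
  then have "indep_vars (\<lambda>_. borel) (\<lambda>i w. X (\<tau> (Suc i)) w - X (\<tau> i) w) {..<2}"
    using lp unfolding levy_process_def by blast
  then have "indep_vars (\<lambda>_. borel) (\<lambda>n w. (X (\<tau> (Suc n)) w - X (\<tau> n) w) $ (if n = 0 then i else j)) {..<2}"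
    by (rule indep_vars_compose2[where N="\<lambda>_. borel", where Y="\<lambda>n v. v $ (if n = 0 then i else j)", unfolded comp_def]) auto
  from indep_var_of_indep_vars[OF this, of 0 1]
  have "indep_var borel (\<lambda>w. (X (\<tau> (Suc 0)) w - X (\<tau> 0) w) $ i) borel (\<lambda>w. (X (\<tau> (Suc 1)) w - X (\<tau> 1) w) $ j)"
    by simp
  then show ?thesis by (simp add: \<tau>_def)
qed

lemma comp_sq_integrable_1: "integrable M (\<lambda>w. (X 1 w $ i)\<^sup>2)"
proof (rule Bochner_Integration.integrable_bound[OF sq1])
  have "(X 1 w $ i)\<^sup>2 \<le> (norm (X 1 w))\<^sup>2" for w
    using component_le_norm_cart[of "X 1 w" i] by (simp add: abs_le_square_iff[symmetric])
  then show "AE w in M. norm ((X 1 w $ i)\<^sup>2) \<le> norm ((norm (X 1 w))\<^sup>2)" by simp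
qed simp

lemma AE_diff_0: "AE w in M. X t w - X 0 w = X t w"
  using X_0 by eventually_elim simp

lemma comp_sq_integrable_le_1:
  assumes "0 \<le> t" "t \<le> 1" shows "integrable M (\<lambda>w. (X t w $ i)\<^sup>2)"
proof -
  have ind: "indep_var borel (\<lambda>w. (X t w - X 0 w) $ i) borel (\<lambda>w. (X (t + (1 - t)) w - X t w) $ i)"
    using assms by (intro increment_indep) auto
  have "integrable M (\<lambda>w. ((X t w - X 0 w) $ i + (X (t + (1 - t)) w - X t w) $ i)\<^sup>2)"
  proof (rule integrable_cong_AE[THEN iffD1, OF _ _ _ comp_sq_integrable_1[of i]])
    show "AE w in M. (X 1 w $ i)\<^sup>2 = ((X t w - X 0 w) $ i + (X (t + (1 - t)) w - X t w) $ i)\<^sup>2"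
      using X_0 by eventually_elim simp
  qed (use assms in simp_all)
  from square_integrable_of_indep_sum[OF ind this]
  show ?thesis
    by (rule integrable_cong_AE[THEN iffD1, rotated -1]) (use assms AE_diff_0[of t] in \<open>auto elim: eventually_mono\<close>)
qed

lemma increment_sq:
  assumes "0 \<le> s" "0 \<le> h" "integrable M (\<lambda>w. (X h w $ i)\<^sup>2)"
  shows "integrable M (\<lambda>w. ((X (s + h) w - X s w) $ i)\<^sup>2)"
proof -
  have "integrable (distr M borel (X h)) (\<lambda>v. (v $ i)\<^sup>2)"
    using assms by (subst integrable_distr_eq) auto
  then have "integrable (distr M borel (\<lambda>w. X (s + h) w - X s w)) (\<lambda>v. (v $ i)\<^sup>2)"
    using increment_distr[OF assms(1,2)] by simp
  then show ?thesis using assms by (subst (asm) integrable_distr_eq) auto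
qed

lemma comp_sq_integrable: "0 \<le> t \<Longrightarrow> integrable M (\<lambda>w. (X t w $ i)\<^sup>2)"
proof -
  have "0 \<le> t \<Longrightarrow> t \<le> real n + 1 \<Longrightarrow> integrable M (\<lambda>w. (X t w $ i)\<^sup>2)" for n t
  proof (induction n arbitrary: t)
    case 0
    then show ?case by (intro comp_sq_integrable_le_1) auto
  next
    case (Suc n)
    show ?case
    proof (cases "t \<le> 1")
      case False
      define s where "s = t - 1"
      have s: "0 \<le> s" "s \<le> real n + 1" "t = s + 1" using False Suc.prems by (auto simp: s_def)
      have "integrable M (\<lambda>w. (X s w $ i + (X (s + 1) w - X s w) $ i)\<^sup>2)"
        using s by (intro square_integrable_add Suc.IH increment_sq comp_sq_integrable_1) auto
      then show ?thesis using s by simp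
    qed (use Suc.prems in \<open>auto intro: comp_sq_integrable_le_1\<close>)
  qed
  moreover have "t \<le> real (nat \<lceil>t\<rceil>) + 1" by linarith
  ultimately show "0 \<le> t \<Longrightarrow> integrable M (\<lambda>w. (X t w $ i)\<^sup>2)" by blast
qed

lemma comp_integrable: "0 \<le> t \<Longrightarrow> integrable M (\<lambda>w. X t w $ i)"
  by (rule square_integrable_imp_integrable) (auto intro: comp_sq_integrable)

lemma comp_mult_integrable: "0 \<le> s \<Longrightarrow> 0 \<le> t \<Longrightarrow> integrable M (\<lambda>w. X s w $ i * X t w $ j)"
  by (intro integrable_mult_L2 comp_sq_integrable) auto

definition mean where "mean i t = (\<integral>w. X t w $ i \<partial>M)"
definition second_moment where "second_moment i j t = (\<integral>w. X t w $ i * X t w $ j \<partial>M)"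

lemma increment_expectation:
  assumes "0 \<le> s" "0 \<le> h" and [measurable]: "f \<in> borel_measurable borel"
  shows "(\<integral>w. f (X (s + h) w - X s w) \<partial>M) = (\<integral>w. f (X h w) \<partial>M :: real)"
proof -
  have "(\<integral>w. f (X (s + h) w - X s w) \<partial>M) = (\<integral>v. f v \<partial>distr M borel (\<lambda>w. X (s + h) w - X s w))"
    using assms by (subst integral_distr) auto
  also have "\<dots> = (\<integral>w. f (X h w) \<partial>M)" unfolding increment_distr[OF assms(1,2)] using assms by (subst integral_distr) auto
  finally show ?thesis .
qed

lemma increment_mean: "0 \<le> s \<Longrightarrow> 0 \<le> h \<Longrightarrow> (\<integral>w. (X (s + h) w - X s w) $ i \<partial>M) = mean i h"
  unfolding mean_def by (rule increment_expectation) measurable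

lemma increment_cov:
  "0 \<le> s \<Longrightarrow> 0 \<le> h \<Longrightarrow>
    (\<integral>w. (X (s + h) w - X s w) $ i * (X (s + h) w - X s w) $ j \<partial>M) = second_moment i j h"
  unfolding second_moment_def by (rule increment_expectation) measurable

lemma mean_add: "0 \<le> s \<Longrightarrow> 0 \<le> t \<Longrightarrow> mean i (s + t) = mean i s + mean i t"
  using increment_mean[of s t i] comp_integrable[of s i] comp_integrable[of "s + t" i] by (simp add: mean_def)

lemma increment_int: "0 \<le> s \<Longrightarrow> 0 \<le> h \<Longrightarrow> integrable M (\<lambda>w. (X (s + h) w - X s w) $ i)"
  using comp_integrable[of s i] comp_integrable[of "s + h" i] by simp

lemma past_increment:
  assumes "0 \<le> s" "0 \<le> h"
  shows "(\<integral>w. X s w $ i * (X (s + h) w - X s w) $ j \<partial>M) = mean i s * mean j h"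
proof -
  have e1: "AE w in M. X s w $ i = (X s w - X 0 w) $ i" using X_0 by eventually_elim simp
  have e2: "AE w in M. X s w $ i * (X (s + h) w - X s w) $ j = (X s w - X 0 w) $ i * (X (s + h) w - X s w) $ j"
    using X_0 by eventually_elim simp
  have "(\<integral>w. X s w $ i * (X (s + h) w - X s w) $ j \<partial>M) =
      (\<integral>w. (X s w - X 0 w) $ i * (X (s + h) w - X s w) $ j \<partial>M)"
    using assms by (intro integral_cong_AE e2) auto
  also have "\<dots> = (\<integral>w. (X s w - X 0 w) $ i \<partial>M) * (\<integral>w. (X (s + h) w - X s w) $ j \<partial>M)"
    using increment_int[of 0 s i] increment_int[of s h j] assms by (intro indep_var_lebesgue_integral increment_indep) auto
  also have "(\<integral>w. (X s w - X 0 w) $ i \<partial>M) = mean i s"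
    unfolding mean_def using assms e1 by (intro integral_cong_AE) (auto elim: eventually_mono)
  also have "(\<integral>w. (X (s + h) w - X s w) $ j \<partial>M) = mean j h" by (rule increment_mean[OF assms])
  finally show ?thesis .
qed

lemma mean_1: "mean i 1 = 0"
proof -
  have "integrable M (\<lambda>w. norm (X 1 w))"
    by (rule square_integrable_imp_integrable[OF _ sq1]) simp
  then have "integrable M (X 1)"
    by (subst (asm) integrable_norm_iff) auto
  then have "(\<integral>w. X 1 w $ i \<partial>M) = (\<integral>w. X 1 w \<partial>M) $ i"
    by (intro integral_bounded_linear bounded_linear_vec_nth)
  then show ?thesis using mean1 by (simp add: mean_def)
qed

lemma second_moment_add:
  assumes "0 \<le> s" "0 \<le> t"
  shows "second_moment i j (s + t) = second_moment i j s + mean i s * mean j t + mean j s * mean i t + second_moment i j t"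
proof -
  let ?D = "\<lambda>w. X (s + t) w - X s w"
  have sqD: "integrable M (\<lambda>w. (?D w $ i)\<^sup>2)" for i
    using assms by (intro increment_sq comp_sq_integrable)
  have i: "integrable M (\<lambda>w. X s w $ i * ?D w $ j)" "integrable M (\<lambda>w. X s w $ j * ?D w $ i)"
     "integrable M (\<lambda>w. ?D w $ i * ?D w $ j)" "integrable M (\<lambda>w. X s w $ i * X s w $ j)"
    using assms by (intro integrable_mult_L2 sqD comp_sq_integrable; simp)+
  have "second_moment i j (s + t) = (\<integral>w. X s w $ i * X s w $ j + X s w $ i * ?D w $ j + X s w $ j * ?D w $ i +
      ?D w $ i * ?D w $ j \<partial>M)"
    unfolding second_moment_def by (intro Bochner_Integration.integral_cong) (auto simp: algebra_simps)
  also have "\<dots> = second_moment i j s + (\<integral>w. X s w $ i * ?D w $ j \<partial>M) + (\<integral>w. X s w $ j * ?D w $ i \<partial>M) +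
      (\<integral>w. ?D w $ i * ?D w $ j \<partial>M)"
    unfolding second_moment_def using i by (subst Bochner_Integration.integral_add; (intro Bochner_Integration.integrable_add)?; simp only:)+
  also have "\<dots> = second_moment i j s + mean i s * mean j t + mean j s * mean i t + second_moment i j t"
    using past_increment[OF assms] increment_cov[OF assms] by simp
  finally show ?thesis .
qed

lemma variance_eq: "0 \<le> t \<Longrightarrow> variance (\<lambda>w. X t w $ i) = second_moment i i t - mean i t * mean i t"
  using comp_integrable[of t i] comp_sq_integrable[of t i] unfolding second_moment_def mean_def
  by (subst variance_eq) (auto simp: power2_eq_square)

lemma variance_bounded:
  assumes "0 \<le> t" "t \<le> 1"
  shows "variance (\<lambda>w. X t w $ i) \<le> variance (\<lambda>w. X 1 w $ i)"
proof -
  have "variance (\<lambda>w. X 1 w $ i) = variance (\<lambda>w. X t w $ i) + variance (\<lambda>w. X (1 - t) w $ i)"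
    using assms second_moment_add[of t "1 - t" i i] mean_add[of t "1 - t" i] by (simp add: variance_eq algebra_simps)
  then show ?thesis using variance_positive[of "\<lambda>w. X (1 - t) w $ i"] by simp
qed

text \<open>\<open>mean i\<close> is additive, and it is bounded near \<open>0\<close> because Chebyshev's inequality and
  stochastic continuity would otherwise contradict each other; hence it is linear.\<close>

lemma mean_eq_0: "0 \<le> t \<Longrightarrow> mean i t = 0"
proof -
  have "((\<lambda>s. prob {w \<in> space M. norm (X s w - X 0 w) > 1}) \<longlongrightarrow> 0) (at 0 within {0..})"
    using lp unfolding levy_process_def by force
  then have "\<forall>\<^sub>F s in at 0 within {0..}. prob {w \<in> space M. norm (X s w - X 0 w) > 1} < 1 / 4"
    by (rule order_tendstoD(2)) simp
  then obtain d where d: "d > 0" "\<And>s. 0 < s \<Longrightarrow> s < d \<Longrightarrow> prob {w \<in> space M. norm (X s w - X 0 w) > 1} < 1 / 4"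
    unfolding eventually_at by (auto simp: dist_real_def)
  define K where "K = sqrt (4 * variance (\<lambda>w. X 1 w $ i) + 4)"
  have K: "K\<^sup>2 = 4 * variance (\<lambda>w. X 1 w $ i) + 4" "K > 0"
    using variance_positive[of "\<lambda>w. X 1 w $ i"] by (auto simp: K_def add_nonneg_pos)
  have aux: "v / (4 * v + 4) \<le> 1 / 4" if "0 \<le> v" for v :: real
    using that by (simp add: field_simps)
  have m0: "mean i 0 = 0" using mean_add[of 0 0 i] by simp
  have bd: "\<bar>mean i t\<bar> \<le> 1 + K" if t: "0 \<le> t" "t \<le> min (d/2) 1" for t
  proof (cases "t = 0")
    case True then show ?thesis using m0 K by simp
  next
    case False
    show ?thesis
    proof (rule ccontr)
      assume "\<not> ?thesis"
      then have big: "\<bar>mean i t\<bar> > 1 + K" by simp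
      let ?A = "{w \<in> space M. norm (X t w - X 0 w) > 1}" and ?B = "{w \<in> space M. K \<le> \<bar>X t w $ i - mean i t\<bar>}"
      have [measurable]: "X t \<in> borel_measurable M" "X 0 \<in> borel_measurable M" using t by auto
      have "prob ?B \<le> variance (\<lambda>w. X t w $ i) / K\<^sup>2"
        unfolding mean_def using t K by (intro Chebyshev_inequality comp_sq_integrable) auto
      also have "\<dots> \<le> variance (\<lambda>w. X 1 w $ i) / K\<^sup>2"
        using t by (intro divide_right_mono variance_bounded) auto
      also have "\<dots> \<le> 1 / 4" unfolding K(1) by (rule aux[OF variance_positive])
      finally have B: "prob ?B \<le> 1 / 4" .
      have A: "prob ?A < 1 / 4" using d(2)[of t] t False d(1) by auto
      have "AE w in M. w \<in> ?A \<union> ?B"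
        using X_0 AE_space
      proof eventually_elim
        case (elim w)
        show ?case
        proof (rule ccontr)
          assume "w \<notin> ?A \<union> ?B"
          then have "norm (X t w) \<le> 1" "\<bar>X t w $ i - mean i t\<bar> < K" using elim by auto
          then show False using component_le_norm_cart[of "X t w" i] big by linarith
        qed
      qed
      then have P: "prob (?A \<union> ?B) = 1" by (subst prob_eq_1) auto
      have "prob (?A \<union> ?B) \<le> prob ?A + prob ?B" by (intro measure_Un_le) auto
      then show False using A B unfolding P by simp
    qed
  qed
  have lin: "0 \<le> t \<Longrightarrow> mean i t = t * mean i 1" for t
    by (rule additive_bounded_linear[where d="min (d/2) 1" and C="1 + K"]) (use mean_add bd d in auto)
  show "0 \<le> t \<Longrightarrow> mean i t = 0" using lin mean_1 by simp
qed

lemma second_moment_linear: "0 \<le> t \<Longrightarrow> second_moment i j t = t * second_moment i j 1"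
proof (rule additive_bounded_linear[where d=1 and C="second_moment i i 1 + second_moment j j 1" and f="second_moment i j"])
  show "second_moment i j (s + t) = second_moment i j s + second_moment i j t" if "0 \<le> s" "0 \<le> t" for s t
    using second_moment_add[OF that] mean_eq_0 that by simp
  fix t :: real assume t: "0 \<le> t" "t \<le> 1"
  have le: "second_moment k k t \<le> second_moment k k 1" for k
    using variance_bounded[OF t, of k] t by (simp add: variance_eq mean_eq_0)
  have "\<bar>X t w $ i * X t w $ j\<bar> \<le> X t w $ i * X t w $ i + X t w $ j * X t w $ j" for w
    using zero_le_power2[of "X t w $ i - X t w $ j"] zero_le_power2[of "X t w $ i + X t w $ j"]
    by (auto simp: power2_eq_square algebra_simps abs_le_iff intro: order.trans)
  then have "(\<integral>w. \<bar>X t w $ i * X t w $ j\<bar> \<partial>M) \<le>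
      (\<integral>w. X t w $ i * X t w $ i + X t w $ j * X t w $ j \<partial>M)"
    using t by (intro Bochner_Integration.integral_mono integrable_abs Bochner_Integration.integrable_add comp_mult_integrable)
  then have "\<bar>second_moment i j t\<bar> \<le> (\<integral>w. X t w $ i * X t w $ i + X t w $ j * X t w $ j \<partial>M)"
    unfolding second_moment_def using integral_abs_bound[of M "\<lambda>w. X t w $ i * X t w $ j"] by linarith
  also have "\<dots> = second_moment i i t + second_moment j j t" unfolding second_moment_def using t
      by (intro Bochner_Integration.integral_add comp_mult_integrable)
  finally show "\<bar>second_moment i j t\<bar> \<le> second_moment i i 1 + second_moment j j 1" using le[of i] le[of j] by simp
qed auto

lemma second_moment_1: "second_moment i j 1 = cov_matrix M (X 1) $ i $ j"
  using mean_1 unfolding mean_def by (simp add: second_moment_def cov_matrix_def)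

lemma comp_covariance:
  assumes "0 \<le> s" "0 \<le> t"
  shows "(\<integral>w. X s w $ i * X t w $ j \<partial>M) = min s t * cov_matrix M (X 1) $ i $ j"
proof -
  have le: "(\<integral>w. X s w $ i * X t w $ j \<partial>M) = s * second_moment i j 1" if st: "0 \<le> s" "s \<le> t" for s t i j
  proof -
    have "0 \<le> t - s" using st by simp
    then have z: "(\<integral>w. X s w $ i * (X (s + (t - s)) w - X s w) $ j \<partial>M) = 0"
      unfolding past_increment[OF st(1) \<open>0 \<le> t - s\<close>] mean_eq_0[OF st(1)] by simp
    have "(\<integral>w. X s w $ i * X t w $ j \<partial>M) =
        (\<integral>w. X s w $ i * X s w $ j + X s w $ i * (X (s + (t - s)) w - X s w) $ j \<partial>M)"
      by (intro Bochner_Integration.integral_cong) (auto simp: algebra_simps)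
    also have "\<dots> = second_moment i j s + (\<integral>w. X s w $ i * (X (s + (t - s)) w - X s w) $ j \<partial>M)"
      unfolding second_moment_def using st by (intro Bochner_Integration.integral_add comp_mult_integrable integrable_mult_L2 increment_sq
          comp_sq_integrable) auto
    also have "\<dots> = s * second_moment i j 1" unfolding z second_moment_linear[OF st(1), of i j] by (rule add_0_right)
    finally show ?thesis .
  qed
  show ?thesis
  proof (cases "s \<le> t")
    case True then show ?thesis using le[OF assms(1) True, of i j] unfolding second_moment_1 by (simp only: min_absorb1)
  next
    case False
    have "(\<integral>w. X s w $ i * X t w $ j \<partial>M) = (\<integral>w. X t w $ j * X s w $ i \<partial>M)" by (simp only: mult.commute)
    also have "\<dots> = t * second_moment j i 1" by (rule le) (use assms False in auto)
    also have "second_moment j i 1 = second_moment i j 1" by (simp only: second_moment_def mult.commute)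
    finally show ?thesis using False unfolding second_moment_1 by (simp only: min_absorb2[OF less_imp_le] not_le)
  qed
qed

text \<open>Along \<open>s n \<rightarrow> t\<close> from the left the second moments of \<open>X (s n) - X t\<close> tend to \<open>0\<close>, so by
  Fatou's lemma the almost sure left limit is \<open>X t\<close>.\<close>

lemma left_limit:
  assumes "0 < t" shows "AE w in M. Lim (at_left t) (\<lambda>s. X s w) = X t w"
proof -
  define s where "s n = t - t * (1 / real (Suc n))" for n
  have s: "0 \<le> s n" "s n < t" for n using assms by (auto simp: s_def field_simps)
  have s_lim: "s \<longlonglongrightarrow> t"
  proof -
    have "(\<lambda>n. t - t * (1 / real (Suc n))) \<longlonglongrightarrow> t - t * 0"
      by (intro tendsto_intros LIMSEQ_inverse_real_of_nat[unfolded inverse_eq_divide])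
    then show ?thesis by (simp add: s_def[abs_def])
  qed
  have s_left: "filterlim s (at_left t) sequentially"
    unfolding at_within_def filterlim_inf filterlim_principal using s s_lim by (auto simp: less_imp_neq)
  have "AE w in M. liminf (\<lambda>n. ennreal (((X (s n) w - X t w) $ i)\<^sup>2)) = 0" for i
  proof -
    have [measurable]: "X (s n) \<in> borel_measurable M" "X t \<in> borel_measurable M" for n using s assms by auto
    have sqd: "integrable M (\<lambda>w. ((X (s n) w - X t w) $ i)\<^sup>2)"
       "(\<integral>w. ((X (s n) w - X t w) $ i)\<^sup>2 \<partial>M) = (t - s n) * second_moment i i 1" for n
    proof -
      have eq: "((X (s n) w - X t w) $ i)\<^sup>2 = X (s n) w $ i * X (s n) w $ i - 2 * (X (s n) w $ i * X t w $ i) + X t w $ i * X t w $ i" for w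
        by (simp add: power2_eq_square algebra_simps)
      show "integrable M (\<lambda>w. ((X (s n) w - X t w) $ i)\<^sup>2)"
        unfolding eq using s[of n] assms comp_mult_integrable by auto
      show "(\<integral>w. ((X (s n) w - X t w) $ i)\<^sup>2 \<partial>M) = (t - s n) * second_moment i i 1"
        unfolding eq using s[of n] assms comp_mult_integrable[of "s n" "s n" i i] comp_mult_integrable[of "s n" t i i] comp_mult_integrable[of t t i
            i]
        by (simp add: comp_covariance second_moment_1 algebra_simps)
    qed
    have "(\<integral>\<^sup>+w. liminf (\<lambda>n. ennreal (((X (s n) w - X t w) $ i)\<^sup>2)) \<partial>M) \<le>
        liminf (\<lambda>n. \<integral>\<^sup>+w. ennreal (((X (s n) w - X t w) $ i)\<^sup>2) \<partial>M)"
      by (rule nn_integral_liminf) measurable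
    also have "(\<lambda>n. \<integral>\<^sup>+w. ennreal (((X (s n) w - X t w) $ i)\<^sup>2) \<partial>M) =
        (\<lambda>n. ennreal ((t - s n) * second_moment i i 1))"
      using sqd by (simp add: nn_integral_eq_integral)
    also have "liminf \<dots> = 0"
    proof (rule lim_imp_Liminf)
      have "(\<lambda>n. (t - s n) * second_moment i i 1) \<longlonglongrightarrow> (t - t) * second_moment i i 1" by (intro tendsto_intros s_lim)
      then show "(\<lambda>n. ennreal ((t - s n) * second_moment i i 1)) \<longlonglongrightarrow> 0"
        using tendsto_ennrealI by (simp only: diff_self mult_zero_left ennreal_0[symmetric])
    qed simp
    finally have "(\<integral>\<^sup>+w. liminf (\<lambda>n. ennreal (((X (s n) w - X t w) $ i)\<^sup>2)) \<partial>M) = 0" by simp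
    then show ?thesis by (subst (asm) nn_integral_0_iff_AE) auto
  qed
  then have "AE w in M. \<forall>i\<in>UNIV. liminf (\<lambda>n. ennreal (((X (s n) w - X t w) $ i)\<^sup>2)) = 0"
    by (intro AE_finite_allI) auto
  moreover have "AE w in M. \<exists>l. ((\<lambda>s. X s w) \<longlongrightarrow> l) (at_left t)"
  proof -
    have "AE w in M. (\<forall>t\<ge>0. ((\<lambda>s. X s w)
        \<longlongrightarrow> X t w) (at_right t)) \<and> (\<forall>t>0. \<exists>l. ((\<lambda>s. X s w) \<longlongrightarrow> l) (at_left t))"
      using lp unfolding levy_process_def by blast
    then show ?thesis by eventually_elim (use assms in blast)
  qed
  ultimately show ?thesis
  proof eventually_elim
    case (elim w)
    then obtain l where l: "((\<lambda>s. X s w) \<longlongrightarrow> l) (at_left t)" by blast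
    have "l $ i = X t w $ i" for i
    proof -
      have "(\<lambda>n. X (s n) w) \<longlonglongrightarrow> l" by (rule filterlim_compose[OF l s_left])
      then have "(\<lambda>n. ((X (s n) w - X t w) $ i)\<^sup>2) \<longlonglongrightarrow> ((l - X t w) $ i)\<^sup>2" by (intro tendsto_intros)
      then have "(\<lambda>n. ennreal (((X (s n) w - X t w) $ i)\<^sup>2)) \<longlonglongrightarrow> ennreal (((l - X t w) $ i)\<^sup>2)"
          by (rule tendsto_ennrealI)
      then have "liminf (\<lambda>n. ennreal (((X (s n) w - X t w) $ i)\<^sup>2)) = ennreal (((l - X t w) $ i)\<^sup>2)"
        by (intro lim_imp_Liminf) auto
      then show ?thesis using elim by auto
    qed
    then have "l = X t w" by (simp add: vec_eq_iff)
    then show ?case using l by (intro tendsto_Lim) auto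
  qed
qed

end

section \<open>The two-sided process\<close>

text \<open>The function whose \<open>dL\<close>-integral is \<open>L t\<close> for either sign of \<open>t\<close>; products of these functions
  turn the covariance of \<open>L\<close> into a Lebesgue integral.\<close>

definition signed_indicator :: "real \<Rightarrow> real \<Rightarrow> real"
  where "signed_indicator t u = indicator {0<..t} u - indicator {t<..0} u"

lemma signed_indicator_diff: "a \<le> b \<Longrightarrow> signed_indicator b u - signed_indicator a u = indicator {a<..b} u"
  by (auto simp: signed_indicator_def indicator_def)

lemma signed_indicator_measurable [measurable]: "signed_indicator t \<in> borel_measurable borel"
  unfolding signed_indicator_def[abs_def] by measurable

lemma signed_indicator_mult:
  "signed_indicator s u * signed_indicator t u =
     (if 0 \<le> s \<and> 0 \<le> t then indicator {0<..min s t} u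
      else if s < 0 \<and> t < 0 then indicator {max s t<..0} u else 0)"
  by (auto simp: signed_indicator_def indicator_def)

lemma signed_indicator_integrable: "integrable lborel (\<lambda>u. signed_indicator s u * signed_indicator t u)"
  unfolding signed_indicator_mult
  by (cases "0 \<le> s \<and> 0 \<le> t"; cases "s < 0 \<and> t < 0") (auto intro!: integrable_real_indicator)

lemma signed_indicator_integral:
  "(\<integral>u. signed_indicator s u * signed_indicator t u \<partial>lborel) =
     (if 0 \<le> s \<and> 0 \<le> t then min s t else if s < 0 \<and> t < 0 then min (- s) (- t) else 0)"
  unfolding signed_indicator_mult by (auto simp: max_def min_def)

locale levy_two_sided =
  fixes M :: "'w measure" and L1 L2 L :: "real \<Rightarrow> 'w \<Rightarrow> real^'d"
  assumes ts: "two_sided_levy M L1 L2 L"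
    and sq1: "integrable M (\<lambda>w. (norm (L1 1 w))\<^sup>2)"
    and mean1: "(\<integral>w. L1 1 w \<partial>M) = 0"
begin

abbreviation "S \<equiv> cov_matrix M (L1 1)"

sublocale L1: levy M L1
  using ts sq1 mean1 by unfold_locales (auto simp: two_sided_levy_def)

lemma L_measurable [measurable]: "L t \<in> borel_measurable M"
  using ts by (simp add: two_sided_levy_def)

lemma distr_L2_1: "distr M borel (L1 1) = distr M borel (L2 1)"
proof -
  let ?P = "PiM {0..} (\<lambda>_. borel) :: (real \<Rightarrow> real^'d) measure"
  have eq: "distr M ?P (\<lambda>w. \<lambda>t\<in>{0..}. L1 t w) = distr M ?P (\<lambda>w. \<lambda>t\<in>{0..}. L2 t w)"
    using ts by (simp add: two_sided_levy_def)
  have m: "(\<lambda>w. \<lambda>t\<in>{0..}. L1 t w) \<in> measurable M ?P" "(\<lambda>w. \<lambda>t\<in>{0..}. L2 t w) \<in> measurable M ?P"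
    using ts by (auto simp: two_sided_levy_def levy_process_def intro!: measurable_restrict)
  have c: "(\<lambda>x. x 1) \<in> measurable ?P borel" by (intro measurable_component_singleton) auto
  have "distr M borel (L1 1) = distr (distr M ?P (\<lambda>w. \<lambda>t\<in>{0..}. L1 t w)) borel (\<lambda>x. x 1)"
    by (subst distr_distr[OF c m(1)]) (simp add: o_def)
  also have "\<dots> = distr M borel (L2 1)"
    unfolding eq by (subst distr_distr[OF c m(2)]) (simp add: o_def)
  finally show ?thesis .
qed

lemma L2_measurable: "0 \<le> t \<Longrightarrow> L2 t \<in> borel_measurable M"
  using ts by (simp add: two_sided_levy_def levy_process_def)

sublocale L2: levy M L2
proof
  show "levy_process M L2" using ts by (simp add: two_sided_levy_def)
  have [measurable]: "L1 1 \<in> borel_measurable M" "L2 1 \<in> borel_measurable M" using L2_measurable by auto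
  have "integrable (distr M borel (L1 1)) (\<lambda>v. (norm v)\<^sup>2)" using sq1 by (subst integrable_distr_eq) auto
  then show "integrable M (\<lambda>w. (norm (L2 1 w))\<^sup>2)" unfolding distr_L2_1 by (subst (asm) integrable_distr_eq) auto
  have "(\<integral>w. L2 1 w \<partial>M) = (\<integral>v. v \<partial>distr M borel (L2 1))" by (subst integral_distr) auto
  also have "\<dots> = (\<integral>w. L1 1 w \<partial>M)" unfolding distr_L2_1[symmetric] by (subst integral_distr) auto
  finally show "(\<integral>w. L2 1 w \<partial>M) = 0" using mean1 by simp
qed

lemma cov_L2: "cov_matrix M (L2 1) = S"
proof -
  have [measurable]: "L1 1 \<in> borel_measurable M" "L2 1 \<in> borel_measurable M" using L2_measurable by auto
  have "(\<integral>w. f (L2 1 w) \<partial>M) = (\<integral>w. f (L1 1 w) \<partial>M)" if [measurable]: "f \<in> borel_measurable borel"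
      for f :: "real^'d \<Rightarrow> real"
  proof -
    have "(\<integral>w. f (L2 1 w) \<partial>M) = (\<integral>v. f v \<partial>distr M borel (L2 1))" by (subst integral_distr) auto
    also have "\<dots> = (\<integral>w. f (L1 1 w) \<partial>M)" unfolding distr_L2_1[symmetric] by (subst integral_distr) auto
    finally show ?thesis .
  qed
  note eq = this[of "\<lambda>v::real^'d. v $ i" for i] this[of "\<lambda>v::real^'d. (v $ i - c) * (v $ j - d)" for i j c d]
  show ?thesis unfolding cov_matrix_def by (simp add: eq)
qed

lemma L_pos: "0 \<le> t \<Longrightarrow> AE w in M. L t w = L1 t w"
proof -
  assume t: "0 \<le> t"
  have "AE w in M. \<forall>t. L t w = (if t \<ge> 0 then L1 t w else - Lim (at_left (- t)) (\<lambda>s. L2 s w))"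
    using ts by (simp add: two_sided_levy_def)
  then show ?thesis by eventually_elim (use t in simp)
qed

lemma L_neg: "t < 0 \<Longrightarrow> AE w in M. L t w = - L2 (- t) w"
proof -
  assume t: "t < 0"
  have "AE w in M. \<forall>t. L t w = (if t \<ge> 0 then L1 t w else - Lim (at_left (- t)) (\<lambda>s. L2 s w))"
    using ts by (simp add: two_sided_levy_def)
  moreover have "AE w in M. Lim (at_left (- t)) (\<lambda>s. L2 s w) = L2 (- t) w"
    using t by (intro L2.left_limit) auto
  ultimately show ?thesis by eventually_elim (use t in simp)
qed

lemma L_sq: "integrable M (\<lambda>w. (L t w $ i)\<^sup>2)"
proof (cases "0 \<le> t")
  case True
  then show ?thesis
    by (intro integrable_cong_AE[THEN iffD2, OF _ _ _ L1.comp_sq_integrable[of t i]])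
        (use L_pos[OF True] in \<open>auto elim: eventually_mono\<close>)
next
  case False
  then have "AE w in M. (L t w $ i)\<^sup>2 = (L2 (- t) w $ i)\<^sup>2"
    using L_neg[of t] by (auto elim: eventually_mono)
  moreover have "L2 (- t) \<in> borel_measurable M" using False by (intro L2_measurable) auto
  ultimately show ?thesis
    using False by (intro integrable_cong_AE[THEN iffD2, OF _ _ _ L2.comp_sq_integrable[of "- t" i]]) auto
qed

lemma cross_cov:
  assumes "0 \<le> s" "0 \<le> t" shows "(\<integral>w. L1 s w $ i * L2 t w $ j \<partial>M) = 0"
proof -
  have "L1.indep_var (PiM {0..} (\<lambda>_. borel)) (\<lambda>w. \<lambda>t\<in>{0..}. L1 t w) (PiM {0..} (\<lambda>_. borel))
      (\<lambda>w. \<lambda>t\<in>{0..}. L2 t w)"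
    using ts by (simp add: two_sided_levy_def)
  then have "L1.indep_var borel ((\<lambda>x. x s $ i) \<circ> (\<lambda>w. \<lambda>t\<in>{0..}. L1 t w)) borel ((\<lambda>x. x t $ j)
      \<circ> (\<lambda>w. \<lambda>t\<in>{0..}. L2 t w))"
    by (rule L1.indep_var_compose) (use assms in \<open>auto intro!: borel_measurable_vec_nth measurable_component_singleton\<close>)
  then have "L1.indep_var borel (\<lambda>w. L1 s w $ i) borel (\<lambda>w. L2 t w $ j)" using assms by (simp add: o_def)
  then have "(\<integral>w. L1 s w $ i * L2 t w $ j \<partial>M) = (\<integral>w. L1 s w $ i \<partial>M) * (\<integral>w. L2 t w $ j \<partial>M)"
    using assms by (intro L1.indep_var_lebesgue_integral L1.comp_integrable L2.comp_integrable)
  then show ?thesis using L1.mean_eq_0[OF assms(1), of i] by (simp add: L1.mean_def)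
qed

lemma L_cov:
  "(\<integral>w. L s w $ i * L t w $ j \<partial>M) = (\<integral>u. signed_indicator s u * signed_indicator t u \<partial>lborel) * S $ i $ j"
proof -
  define W where "W t w = (if t \<ge> 0 then L1 t w else - L2 (- t) w)" for t w
  have W: "AE w in M. L t w = W t w" for t
    using L_pos[of t] L_neg[of t] by (cases "t \<ge> 0") (simp_all add: W_def)
  have [measurable]: "W t \<in> borel_measurable M" for t
    using L2_measurable[of "- t"] by (cases "t \<ge> 0") (simp_all add: W_def[abs_def])
  have "(\<integral>w. L s w $ i * L t w $ j \<partial>M) = (\<integral>w. W s w $ i * W t w $ j \<partial>M)"
  proof (rule integral_cong_AE)
    show "AE w in M. L s w $ i * L t w $ j = W s w $ i * W t w $ j"
      using W[of s] W[of t] by eventually_elim simp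
  qed measurable
  also have "\<dots> = (\<integral>u. signed_indicator s u * signed_indicator t u \<partial>lborel) * S $ i $ j"
    using L1.comp_covariance[of s t i j] L2.comp_covariance[of "- s" "- t" i j]
      cross_cov[of s "- t" i j] cross_cov[of t "- s" j i]
    by (cases "s \<ge> 0"; cases "t \<ge> 0") (simp_all add: W_def signed_indicator_integral cov_L2 mult.commute)
  finally show ?thesis .
qed

lemma L_mult_integrable: "integrable M (\<lambda>w. L s w $ i * L t w $ j)"
  by (intro integrable_mult_L2 L_sq) measurable

lemma increment_cov:
  assumes "a \<le> b" "c \<le> d"
  shows "(\<integral>w. (L b w - L a w) $ i * (L d w - L c w) $ j \<partial>M) =
      (\<integral>u. indicator {a<..b} u * indicator {c<..d} u \<partial>lborel) * S $ i $ j"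
proof -
  have "(\<integral>w. (L b w - L a w) $ i * (L d w - L c w) $ j \<partial>M) =
    (\<integral>w. L b w $ i * L d w $ j - L a w $ i * L d w $ j - L b w $ i * L c w $ j + L a w $ i * L c w $ j \<partial>M)"
    by (intro Bochner_Integration.integral_cong) (auto simp: algebra_simps)
  also have "\<dots> = (\<integral>u. signed_indicator b u * signed_indicator d u - signed_indicator a u * signed_indicator d u
      - signed_indicator b u * signed_indicator c u + signed_indicator a u * signed_indicator c u \<partial>lborel) * S $ i $ j"
    using L_mult_integrable signed_indicator_integrable by (simp add: L_cov algebra_simps)
  also have "(\<integral>u. signed_indicator b u * signed_indicator d u - signed_indicator a u * signed_indicator d u
      - signed_indicator b u * signed_indicator c u + signed_indicator a u * signed_indicator c u \<partial>lborel)
     = (\<integral>u. (signed_indicator b u - signed_indicator a u) * (signed_indicator d u - signed_indicator c u) \<partial>lborel)"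
    by (intro Bochner_Integration.integral_cong) (auto simp: algebra_simps)
  finally show ?thesis unfolding signed_indicator_diff[OF assms(1)] signed_indicator_diff[OF assms(2)] .
qed

end

section \<open>The isometry\<close>

lemma square_integrable_sum:
  fixes f :: "'i \<Rightarrow> 'a \<Rightarrow> real"
  assumes "\<And>i. i \<in> I \<Longrightarrow> f i \<in> borel_measurable M" "\<And>i. i \<in> I \<Longrightarrow> integrable M (\<lambda>x. (f i
      x)\<^sup>2)"
  shows "integrable M (\<lambda>x. (\<Sum>i\<in>I. f i x)\<^sup>2)"
  using assms
proof (induction I rule: infinite_finite_induct)
  case (insert i I)
  then have "integrable M (\<lambda>x. (f i x + (\<Sum>i\<in>I. f i x))\<^sup>2)"
    by (intro square_integrable_add borel_measurable_sum) auto
  then show ?case using insert by simp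
qed auto

lemma square_integrable_cmult:
  fixes f :: "'a \<Rightarrow> real"
  shows "integrable M (\<lambda>x. (f x)\<^sup>2) \<Longrightarrow> integrable M (\<lambda>x. (c * f x)\<^sup>2)"
  by (simp add: power_mult_distrib)

lemma interval_indicator_sq_integrable: "integrable lborel (\<lambda>u. (indicator {a<..b} u :: real)\<^sup>2)"
  for a b :: real
proof -
  have "integrable lborel (indicator {a<..b} :: real \<Rightarrow> real)"
    by (cases "a \<le> b") (auto intro!: integrable_real_indicator)
  moreover have "(indicator {a<..b} u :: real)\<^sup>2 = indicator {a<..b} u" for u :: real by (simp add: indicator_def)
  ultimately show ?thesis by simp
qed

lemma step_fun_nth:
  "step_fun xs u $ i $ k =
    (\<Sum>n<length xs. case xs ! n of (a, b, C) \<Rightarrow> C $ i $ k * indicator {a<..b} u)"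
  by (simp add: step_fun_def sum_list_sum_nth atLeast0LessThan sum_component case_prod_unfold mult.commute)

lemma step_integral_nth:
  "step_integral L xs w $ i =
    (\<Sum>n<length xs. \<Sum>k\<in>UNIV. case xs ! n of (a, b, C) \<Rightarrow> C $ i $ k * (L b w - L a w) $ k)"
  by (simp add: step_integral_def sum_list_sum_nth atLeast0LessThan sum_component case_prod_unfold
      matrix_vector_mult_def)

lemma step_fun_measurable [measurable]: "(\<lambda>u. step_fun xs u $ i $ k) \<in> borel_measurable borel"
  unfolding step_fun_nth case_prod_unfold by measurable

lemma step_fun_sq: "integrable lborel (\<lambda>u. (step_fun xs u $ i $ k)\<^sup>2)"
  unfolding step_fun_nth case_prod_unfold
  by (intro square_integrable_sum square_integrable_cmult interval_indicator_sq_integrable) measurable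

context levy_two_sided begin

lemma step_integral_measurable [measurable]: "(\<lambda>w. step_integral L xs w $ i) \<in> borel_measurable M"
  unfolding step_integral_nth case_prod_unfold by measurable

lemma L_increment_sq: "integrable M (\<lambda>w. ((L b w - L a w) $ k)\<^sup>2)"
  using square_integrable_add[of "\<lambda>w. L b w $ k" M "\<lambda>w. - L a w $ k"] L_sq by simp

lemma step_integral_sq: "integrable M (\<lambda>w. (step_integral L xs w $ i)\<^sup>2)"
  unfolding step_integral_nth case_prod_unfold
  by (intro square_integrable_sum square_integrable_cmult L_increment_sq borel_measurable_sum) measurable

lemma step_integral_cov:
  assumes "\<forall>(a, b, C) \<in> set xs. a \<le> b" "\<forall>(a, b, C) \<in> set ys. a \<le> b"
  shows "(\<integral>w. step_integral L xs w $ i * step_integral L ys w $ j \<partial>M) =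
     (\<Sum>k\<in>UNIV. \<Sum>l\<in>UNIV. S $ k $ l * (\<integral>u. step_fun xs u $ i $ k * step_fun ys u $ j $ l \<partial>lborel))"
proof -
  define a b C where "a zs n = fst (zs ! n)" and "b zs n = fst (snd (zs ! n))" and "C zs n = snd (snd (zs ! n))"
    for zs :: "(real \<times> real \<times> (real^'d^'d)) list" and n
  let ?I = "\<lambda>zs n u. indicator {a zs n<..b zs n} u :: real"
  let ?D = "\<lambda>zs n w. L (b zs n) w - L (a zs n) w"
  let ?c = "\<lambda>n n' k l. C xs n $ i $ k * C ys n' $ j $ l"
  let ?\<Sigma> = "\<lambda>f. \<Sum>k\<in>UNIV. \<Sum>l\<in>UNIV. \<Sum>n<length xs. \<Sum>n'<length ys. f n n' k l"
  have ab: "a xs n \<le> b xs n" if "n < length xs" for n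
    using assms(1) nth_mem[OF that] by (fastforce simp: a_def b_def)
  have ab': "a ys n \<le> b ys n" if "n < length ys" for n
    using assms(2) nth_mem[OF that] by (fastforce simp: a_def b_def)
  have int_D: "integrable M (\<lambda>w. ?D xs n w $ k * ?D ys n' w $ l)" for n n' k l
    by (rule integrable_mult_L2[OF _ _ L_increment_sq L_increment_sq]) measurable
  have int_I: "integrable lborel (\<lambda>u. ?I xs n u * ?I ys n' u)" for n n'
    by (rule integrable_mult_L2[OF _ _ interval_indicator_sq_integrable interval_indicator_sq_integrable]) measurable
  have "step_integral L xs w $ i * step_integral L ys w $ j =
      ?\<Sigma> (\<lambda>n n' k l. ?c n n' k l * (?D xs n w $ k * ?D ys n' w $ l))" for w
  proof -
    have "step_integral L zs w $ i = (\<Sum>k\<in>UNIV. \<Sum>n<length zs. C zs n $ i $ k * ?D zs n w $ k)" for zs i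
      unfolding step_integral_nth case_prod_unfold a_def b_def C_def by (rule sum.swap)
    then show ?thesis by (simp only: sum_product mult_ac)
  qed
  then have "(\<integral>w. step_integral L xs w $ i * step_integral L ys w $ j \<partial>M) =
      ?\<Sigma> (\<lambda>n n' k l. ?c n n' k l * (\<integral>w. ?D xs n w $ k * ?D ys n' w $ l \<partial>M))"
    using int_D by (simp del: vector_minus_component)
  also have "\<dots> = ?\<Sigma> (\<lambda>n n' k l. S $ k $ l * (?c n n' k l * (\<integral>u. ?I xs n u * ?I ys n' u \<partial>lborel)))"
    by (intro sum.cong refl) (simp add: increment_cov ab ab' mult_ac del: vector_minus_component)
  also have "\<dots> = (\<Sum>k\<in>UNIV. \<Sum>l\<in>UNIV. S $ k $ l * (\<integral>u. step_fun xs u $ i $ k *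
      step_fun ys u $ j $ l \<partial>lborel))"
  proof (intro sum.cong refl)
    fix k l
    have "step_fun xs u $ i $ k * step_fun ys u $ j $ l =
        (\<Sum>n<length xs. \<Sum>n'<length ys. ?c n n' k l * (?I xs n u * ?I ys n' u))" for u
      unfolding step_fun_nth case_prod_unfold a_def[symmetric] b_def[symmetric] C_def[symmetric]
      by (simp only: sum_product mult_ac)
    then have "(\<integral>u. step_fun xs u $ i $ k * step_fun ys u $ j $ l \<partial>lborel) =
        (\<Sum>n<length xs. \<Sum>n'<length ys. ?c n n' k l * (\<integral>u. ?I xs n u * ?I ys n' u \<partial>lborel))"
      using int_I by simp
    then show "(\<Sum>n<length xs. \<Sum>n'<length ys. S $ k $ l * (?c n n' k l * (\<integral>u. ?I xs n u * ?I ys n' u \<partial>lborel))) =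
        S $ k $ l * (\<integral>u. step_fun xs u $ i $ k * step_fun ys u $ j $ l \<partial>lborel)"
      by (simp only: sum_distrib_left)
  qed
  finally show ?thesis .
qed

lemma L2_integral_cov:
  assumes X: "is_L2_integral M L h X" and Y: "is_L2_integral M L h' Y"
  shows "(\<integral>w. X w $ i * Y w $ j \<partial>M) =
     (\<Sum>k\<in>UNIV. \<Sum>l\<in>UNIV. S $ k $ l * (\<integral>u. h u $ i $ k * h' u $ j $ l \<partial>lborel))"
proof -
  obtain xs where xs: "\<And>n. \<forall>(a, b, C) \<in> set (xs n). a \<le> b"
      "(\<lambda>n. \<integral>\<^sup>+s. ennreal ((norm (h s - step_fun (xs n) s))\<^sup>2) \<partial>lborel) \<longlonglongrightarrow> 0"
      "(\<lambda>n. \<integral>\<^sup>+w. ennreal ((norm (X w - step_integral L (xs n) w))\<^sup>2) \<partial>M) \<longlonglongrightarrow> 0"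
    using X unfolding is_L2_integral_def by blast
  obtain ys where ys: "\<And>n. \<forall>(a, b, C) \<in> set (ys n). a \<le> b"
      "(\<lambda>n. \<integral>\<^sup>+s. ennreal ((norm (h' s - step_fun (ys n) s))\<^sup>2) \<partial>lborel) \<longlonglongrightarrow> 0"
      "(\<lambda>n. \<integral>\<^sup>+w. ennreal ((norm (Y w - step_integral L (ys n) w))\<^sup>2) \<partial>M) \<longlonglongrightarrow> 0"
    using Y unfolding is_L2_integral_def by blast
  have [measurable]: "h \<in> borel_measurable lborel" "h' \<in> borel_measurable lborel" "X \<in> borel_measurable M" "Y \<in> borel_measurable M"
    using X Y by (auto simp: is_L2_integral_def)
  have [measurable]: "(\<lambda>u. h u $ i $ k) \<in> borel_measurable borel" "(\<lambda>u. h' u $ i $ k) \<in> borel_measurable borel" for i k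
    using X Y by (auto simp: is_L2_integral_def intro!: borel_measurable_vec_nth)
  have proj: "(\<lambda>n. \<integral>\<^sup>+s. ennreal ((\<pi> (f s) - \<pi> (F n s))\<^sup>2) \<partial>N) \<longlonglongrightarrow> 0"
    if \<pi>: "\<And>x y. \<bar>\<pi> x - \<pi> y\<bar> \<le> norm (x - y)"
      and lim: "(\<lambda>n. \<integral>\<^sup>+s. ennreal ((norm (f s - F n s))\<^sup>2) \<partial>N) \<longlonglongrightarrow> 0"
    for \<pi> :: "'b::real_normed_vector \<Rightarrow> real" and f :: "'z \<Rightarrow> 'b" and F N
  proof (rule tendsto_sandwich[OF _ _ tendsto_const lim])
    show "\<forall>\<^sub>F n in sequentially. (\<integral>\<^sup>+s. ennreal ((\<pi> (f s) - \<pi> (F n s))\<^sup>2) \<partial>N) \<le>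
        (\<integral>\<^sup>+s. ennreal ((norm (f s - F n s))\<^sup>2) \<partial>N)"
      using \<pi> by (intro always_eventually allI nn_integral_mono ennreal_leI) (simp add: abs_le_square_iff[symmetric])
  qed auto
  have comp: "\<bar>x $ i - y $ i\<bar> \<le> norm (x - y)" for x y :: "real^'d" and i
    using component_le_norm_cart[of "x - y" i] by simp
  have comp2: "\<bar>x $ i $ k - y $ i $ k\<bar> \<le> norm (x - y)" for x y :: "real^'d^'d" and i k
    using comp[of "x $ i" k "y $ i"] Finite_Cartesian_Product.norm_nth_le[of "x - y" i] by simp
  have "(\<lambda>n. \<integral>w. step_integral L (xs n) w $ i *
      step_integral L (ys n) w $ j \<partial>M) \<longlonglongrightarrow> (\<integral>w. X w $ i * Y w $ j \<partial>M)"
    by (rule integral_mult_tendsto_L2) (use proj[OF comp xs(3)] proj[OF comp ys(3)] step_integral_sq in auto)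
  moreover have "(\<lambda>n. \<Sum>k\<in>UNIV. \<Sum>l\<in>UNIV. S $ k $ l * (\<integral>u. step_fun (xs n) u $ i $ k *
      step_fun (ys n) u $ j $ l \<partial>lborel))
      \<longlonglongrightarrow> (\<Sum>k\<in>UNIV. \<Sum>l\<in>UNIV. S $ k $ l * (\<integral>u. h u $ i $ k * h' u $ j $ l \<partial>lborel))"
  proof (intro tendsto_sum tendsto_mult tendsto_const)
    fix k l
    show "(\<lambda>n. \<integral>u. step_fun (xs n) u $ i $ k *
        step_fun (ys n) u $ j $ l \<partial>lborel) \<longlonglongrightarrow> (\<integral>u. h u $ i $ k * h' u $ j $ l \<partial>lborel)"
      by (rule integral_mult_tendsto_L2) (use proj[OF comp2 xs(2)] proj[OF comp2 ys(2)] step_fun_sq in auto)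
  qed
  ultimately show ?thesis
    unfolding step_integral_cov[OF xs(1) ys(1)] by (rule LIMSEQ_unique)
qed

end

section \<open>Contour integrals and Abel summation\<close>

lemma holomorphic_pole_contour_integral:
  assumes "convex S" "open S" "f holomorphic_on S" "a \<in> S" "valid_path g"
    "path_image g \<subseteq> S - {a}" "pathfinish g = pathstart g"
  shows "((\<lambda>z. f z / (z - a) ^ Suc m) has_contour_integral
     2 * pi * \<i> * winding_number g a * ((deriv ^^ m) f a / fact m)) g"
  using assms(3)
proof (induction m arbitrary: f)
  case 0
  show ?case
    using Cauchy_integral_formula_convex_simple[OF assms(1) 0, of a g] assms by (simp add: interior_open)
next
  case (Suc m)
  have f': "deriv f holomorphic_on S" using Suc.prems assms by (intro holomorphic_deriv) auto
  have 1: "((\<lambda>z. deriv f z / (z - a) ^ Suc m) has_contour_integral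
     2 * pi * \<i> * winding_number g a * ((deriv ^^ Suc m) f a / fact m)) g"
    using Suc.IH[OF f'] by (simp add: funpow_Suc_right del: funpow.simps)
  have "((\<lambda>z. deriv f z / (z - a) ^ Suc m - of_nat (Suc m) * (f z / (z - a) ^ Suc (Suc m))) has_contour_integral
          (f (pathfinish g) / (pathfinish g - a) ^ Suc m - f (pathstart g) / (pathstart g - a) ^ Suc m)) g"
  proof (rule contour_integral_primitive[where S="S - {a}" and f = "\<lambda>z. f z / (z - a) ^ Suc m", rotated])
    show "valid_path g" "path_image g \<subseteq> S - {a}" by fact+
    fix z assume z: "z \<in> S - {a}"
    have "(f has_field_derivative deriv f z) (at z within S - {a})"
      using holomorphic_derivI[OF Suc.prems assms(2), of z] z by (blast intro: has_field_derivative_at_within)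
    moreover have "((\<lambda>z. (z - a) ^ Suc m) has_field_derivative of_nat (Suc m) * (z - a) ^ m) (at z within S - {a})"
      by (rule derivative_eq_intros refl | simp)+
    ultimately have "((\<lambda>z. f z / (z - a) ^ Suc m) has_field_derivative
        (deriv f z * (z - a) ^ Suc m - f z * (of_nat (Suc m) * (z - a) ^ m)) / ((z - a) ^ Suc m * (z - a) ^ Suc m)) (at z within S - {a})"
      using z by (intro DERIV_divide) auto
    also have "(deriv f z * (z - a) ^ Suc m - f z * (of_nat (Suc m) * (z - a) ^ m)) / ((z - a) ^ Suc m * (z - a) ^ Suc m) =
       deriv f z / (z - a) ^ Suc m - of_nat (Suc m) * (f z / (z - a) ^ Suc (Suc m))"
      using z by (simp add: divide_simps) (simp add: algebra_simps)?
    finally show "((\<lambda>z. f z / (z - a) ^ Suc m) has_field_derivative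
       deriv f z / (z - a) ^ Suc m - of_nat (Suc m) * (f z / (z - a) ^ Suc (Suc m))) (at z within S - {a})" .
  qed
  from has_contour_integral_diff[OF 1 this]
  have "((\<lambda>z. of_nat (Suc m) * (f z / (z - a) ^ Suc (Suc m))) has_contour_integral
     2 * pi * \<i> * winding_number g a * ((deriv ^^ Suc m) f a / fact m)) g"
    using assms by simp
  from has_contour_integral_lmul[OF this, of "1 / of_nat (Suc m)"]
  show ?case by (simp add: divide_simps del: of_nat_Suc funpow.simps power_Suc)
qed

lemma Abel_limit:
  fixes a :: "nat \<Rightarrow> complex"
  assumes "summable a"
  shows "((\<lambda>x. \<Sum>n. a n * of_real x ^ n) \<longlongrightarrow> suminf a) (at_left 1)"
proof -
  define s where "s = suminf a"
  define S where "S n = (\<Sum>k\<le>n. a k) - s" for n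
  have S0: "S \<longlonglongrightarrow> 0"
    unfolding S_def s_def by (rule LIM_zero[OF summable_LIMSEQ'[OF assms]])
  then obtain B where B: "\<And>n. norm (S n) \<le> B" "B > 0"
    using convergent_imp_Bseq[of S] by (auto simp: convergent_def Bseq_def)
  have sumS: "summable (\<lambda>n. norm (S n * of_real x ^ n))" if "0 \<le> x" "x < 1" for x :: real
    by (rule summable_comparison_test'[where g="\<lambda>n. B * x ^ n"])
       (use that B in \<open>auto simp: norm_mult norm_power intro!: summable_mult summable_geometric mult_right_mono\<close>)
  have eq: "(\<Sum>n. a n * of_real x ^ n) - s = (1 - of_real x) * (\<Sum>n. S n * of_real x ^ n)"
    if x: "0 \<le> x" "x < 1" for x :: real
  proof -
    have 1: "(\<lambda>n. S n * of_real x ^ n) sums (\<Sum>n. S n * of_real x ^ n)"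
      by (rule summable_sums[OF summable_norm_cancel[OF sumS[OF x]]])
    have "(\<lambda>n. of_real x * (S n * of_real x ^ n)) sums (of_real x * (\<Sum>n. S n * of_real x ^ n))"
      by (intro sums_mult 1)
    then have 2: "(\<lambda>n. case n of 0 \<Rightarrow> 0 | Suc n \<Rightarrow> of_real x * (S n * of_real x ^ n))
        sums (of_real x * (\<Sum>n. S n * of_real x ^ n))"
      using sums_Suc[of "\<lambda>n. case n of 0 \<Rightarrow> 0 | Suc n \<Rightarrow> of_real x * (S n * of_real x ^ n)"] by simp
    have 3: "(\<lambda>n. if n = 0 then s else 0) sums s" using sums_single[of 0 "\<lambda>_. s"] by simp
    have "(\<lambda>n. S n * of_real x ^ n - (case n of 0 \<Rightarrow> 0 | Suc n \<Rightarrow> of_real x * (S n * of_real x ^ n)) + (if n =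
        0 then s else 0)) sums
       ((\<Sum>n. S n * of_real x ^ n) - of_real x * (\<Sum>n. S n * of_real x ^ n) + s)"
      by (intro sums_add sums_diff 1 2 3)
    also have "(\<lambda>n. S n * of_real x ^ n - (case n of 0 \<Rightarrow> 0 | Suc n \<Rightarrow> of_real x * (S n * of_real x ^ n)) + (if n =
        0 then s else 0))
        = (\<lambda>n. a n * of_real x ^ n)"
    proof
      fix n show "S n * of_real x ^ n - (case n of 0 \<Rightarrow> 0 | Suc n \<Rightarrow> of_real x * (S n * of_real x ^ n)) + (if n =
          0 then s else 0)
          = a n * of_real x ^ n"
        by (cases n) (auto simp: S_def algebra_simps)
    qed
    finally show ?thesis by (simp add: sums_iff algebra_simps)
  qed
  have "((\<lambda>x. (\<Sum>n. a n * of_real x ^ n) - s) \<longlongrightarrow> 0) (at_left 1)"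
  proof (rule tendstoI)
    fix e :: real assume e: "e > 0"
    obtain N where N: "\<And>n. n \<ge> N \<Longrightarrow> norm (S n) < e / 2"
      using LIMSEQ_D[OF S0, of "e/2"] e by auto
    define C where "C = B * N"
    have bound: "norm ((\<Sum>n. a n * of_real x ^ n) - s) \<le> (1 - x) * C + e / 2" if x: "0 \<le> x" "x < 1" for x :: real
    proof -
      have mono1: "norm (S n * of_real x ^ n) \<le> B * 1" for n
        unfolding norm_mult using x B by (intro mult_mono B) (auto simp: norm_power intro!: power_le_one)
      have "norm (\<Sum>n. S n * of_real x ^ n) \<le> (\<Sum>n. norm (S n * of_real x ^ n))"
        by (rule summable_norm[OF sumS[OF x]])
      also have "\<dots> = (\<Sum>n. norm (S (n + N) * of_real x ^ (n + N))) + (\<Sum>n<N. norm (S n * of_real x ^ n))"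
        by (rule suminf_split_initial_segment[OF sumS[OF x]])
      also have "(\<Sum>n<N. norm (S n * of_real x ^ n)) \<le> (\<Sum>n<N. B * 1)"
        by (intro sum_mono mono1)
      also have "(\<Sum>n. norm (S (n + N) * of_real x ^ (n + N))) \<le> (\<Sum>n. e / 2 * x ^ n)"
      proof (rule suminf_le)
        show "summable (\<lambda>n. norm (S (n + N) * of_real x ^ (n + N)))"
          using sumS[OF x] by (rule summable_ignore_initial_segment)
        show "summable (\<lambda>n. e / 2 * x ^ n)" using x by (intro summable_mult summable_geometric) auto
        fix n
        have "x ^ (n + N) \<le> x ^ n" using x by (intro power_decreasing) auto
        then show "norm (S (n + N) * of_real x ^ (n + N)) \<le> e / 2 * x ^ n"
          unfolding norm_mult norm_power using N[of "n + N"] x e by (intro mult_mono) auto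
      qed
      also have "(\<Sum>n. e / 2 * x ^ n) = e / 2 * (1 / (1 - x))"
        using x by (subst suminf_mult) (auto simp: suminf_geometric)
      finally have *: "norm (\<Sum>n. S n * of_real x ^ n) \<le> e / 2 * (1 / (1 - x)) + C" by (simp add: C_def mult.commute)
      have "norm ((\<Sum>n. a n * of_real x ^ n) - s) = (1 - x) * norm (\<Sum>n. S n * of_real x ^ n)"
        using norm_of_real[of "1 - x", where 'a=complex] x unfolding eq[OF x] norm_mult by simp
      also have "\<dots> \<le> (1 - x) * (e / 2 * (1 / (1 - x)) + C)" using * x by (intro mult_left_mono) auto
      also have "\<dots> = (1 - x) * C + e / 2" using x by (simp add: field_simps)
      finally show ?thesis .
    qed
    have "((\<lambda>x. (1 - x) * C + e / 2) \<longlongrightarrow> (1 - 1) * C + e / 2) (at_left 1)"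
      by (intro tendsto_intros)
    then have "\<forall>\<^sub>F x in at_left 1. (1 - x) * C + e / 2 < e"
      by (rule order_tendstoD(2)) (use e in simp)
    moreover have "\<forall>\<^sub>F x in at_left 1. x \<in> {0<..<1::real}"
      by (rule eventually_at_left_field[THEN iffD2]) (auto intro!: exI[of _ 0])
    ultimately show "\<forall>\<^sub>F x in at_left 1. dist ((\<Sum>n. a n * of_real x ^ n) - s) 0 < e"
      proof eventually_elim
      case (elim x)
      then show ?case using bound[of x] by (simp add: dist_norm)
    qed
  qed
  then show ?thesis by (simp add: s_def LIM_zero_iff)
qed

section \<open>Taylor coefficients and exponential monomials\<close>

definition taylor_coeff :: "(complex \<Rightarrow> complex) \<Rightarrow> complex \<Rightarrow> nat \<Rightarrow> complex"
  where "taylor_coeff f a m = (deriv ^^ m) f a / fact m"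

lemma taylor_coeff_mult:
  assumes "f holomorphic_on S" "g holomorphic_on S" "open S" "a \<in> S"
  shows "taylor_coeff (\<lambda>z. f z * g z) a m = (\<Sum>j\<le>m. taylor_coeff f a (m - j) * taylor_coeff g a j)"
proof -
  have "taylor_coeff (\<lambda>z. f z * g z) a m = taylor_coeff (\<lambda>z. g z * f z) a m" by (simp add: mult.commute)
  also have "\<dots> = (\<Sum>j\<le>m. taylor_coeff f a (m - j) * taylor_coeff g a j)"
    unfolding taylor_coeff_def higher_deriv_mult[OF assms(2,1,3,4)] sum_divide_distrib atLeast0AtMost
  proof (intro sum.cong refl)
    fix j assume "j \<in> {..m}"
    then have "of_nat (m choose j) / fact m = (1 / (fact j * fact (m - j)) :: complex)"
      by (simp add: binomial_fact)
    moreover have "of_nat (m choose j) * (deriv ^^ j) g a * (deriv ^^ (m - j)) f a / fact m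
       = of_nat (m choose j) / fact m * ((deriv ^^ j) g a * (deriv ^^ (m - j)) f a)" by simp
    ultimately show "of_nat (m choose j) * (deriv ^^ j) g a * (deriv ^^ (m - j)) f a / fact m =
      (deriv ^^ (m - j)) f a / fact (m - j) * ((deriv ^^ j) g a / fact j)"
      by (simp only: mult_ac) (simp add: mult_ac)
  qed
  finally show ?thesis .
qed

lemma taylor_coeff_cmult:
  "f holomorphic_on S \<Longrightarrow> open S \<Longrightarrow> a \<in> S \<Longrightarrow> taylor_coeff (\<lambda>z. c * f z) a m =
      c * taylor_coeff f a m"
  by (simp add: taylor_coeff_def higher_deriv_cmult)

lemma taylor_coeff_add:
  "f holomorphic_on S \<Longrightarrow> g holomorphic_on S \<Longrightarrow> open S \<Longrightarrow> a \<in> S \<Longrightarrow>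
    taylor_coeff (\<lambda>z. f z + g z) a m = taylor_coeff f a m + taylor_coeff g a m"
  by (simp add: taylor_coeff_def higher_deriv_add add_divide_distrib)

lemma taylor_coeff_sum:
  assumes "\<And>k. k \<in> K \<Longrightarrow> f k holomorphic_on S" "open S" "a \<in> S"
  shows "taylor_coeff (\<lambda>z. \<Sum>k\<in>K. f k z) a m = (\<Sum>k\<in>K. taylor_coeff (f k) a m)"
  using assms(1)
proof (induction K rule: infinite_finite_induct)
  case (insert x F)
  then show ?case
    using assms taylor_coeff_add[of "f x" S "\<lambda>z. \<Sum>k\<in>F. f k z" a m]
    by (auto intro!: holomorphic_intros)
qed (auto simp: taylor_coeff_def)

lemma taylor_coeff_transform:
  assumes "f holomorphic_on S" "open S" "a \<in> S" "\<And>z. z \<in> S \<Longrightarrow> f z = g z"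
  shows "taylor_coeff f a m = taylor_coeff g a m"
  unfolding taylor_coeff_def
  using higher_deriv_transform_within_open[of f S g a m] assms holomorphic_transform[of f S g] by auto

lemma taylor_coeff_scale:
  assumes "f holomorphic_on T" "open T" "u * a \<in> T"
  shows "taylor_coeff (\<lambda>z. f (u * z)) a m = u ^ m * taylor_coeff f (u * a) m"
proof -
  have "open ((\<lambda>z. u * z) -` T)" by (intro open_vimage assms continuous_intros)
  then show ?thesis unfolding taylor_coeff_def
    using higher_deriv_compose_linear[of f T "(\<lambda>z. u * z) -` T" a u m] assms by auto
qed

lemma taylor_coeff_sums:
  assumes "uniform_limit A (\<lambda>n z. \<Sum>k<n. f k z) g sequentially"
    "\<And>k. f k holomorphic_on A" "open A" "a \<in> A"
  shows "(\<lambda>k. taylor_coeff (f k) a m) sums taylor_coeff g a m"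
proof -
  have "(\<lambda>n. (deriv ^^ m) (\<lambda>z. \<Sum>k<n. f k z) a) \<longlonglongrightarrow> (deriv ^^ m) g a"
    by (rule higher_deriv_complex_uniform_limit[OF assms(1)]) (use assms in \<open>auto intro!: holomorphic_intros always_eventually\<close>)
  then have "(\<lambda>n. taylor_coeff (\<lambda>z. \<Sum>k<n. f k z) a m) \<longlonglongrightarrow> taylor_coeff g a m"
    unfolding taylor_coeff_def by (intro tendsto_intros) auto
  then show ?thesis
    unfolding sums_def by (subst (asm) taylor_coeff_sum) (use assms in auto)
qed

definition exp_monom :: "complex \<Rightarrow> nat \<Rightarrow> real \<Rightarrow> complex"
  where "exp_monom a m t = of_real t ^ m / fact m * exp (a * of_real t)"

lemma taylor_coeff_exp: "taylor_coeff (\<lambda>z. exp (of_real t * z)) a m = exp_monom a m t"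
proof -
  have "(deriv ^^ m) (\<lambda>z. exp (of_real t * z)) = (\<lambda>z. of_real t ^ m * exp (of_real t * z :: complex))"
    by (induction m) (auto intro!: ext DERIV_imp_deriv derivative_eq_intros)
  then show ?thesis by (simp add: taylor_coeff_def exp_monom_def mult.commute[of a])
qed

lemma taylor_coeff_inverse_power:
  assumes "- a - b \<noteq> 0"
  shows "taylor_coeff (\<lambda>z. 1 / (- z - b) ^ Suc n) a m = of_nat (n + m choose m) / (- a - b) ^ Suc (n + m)"
proof -
  have field: "fact k / c * - (inverse (w ^ Suc k) * (of_nat (Suc k) * w ^ k * (-1)) * inverse (w ^ Suc k))
      = fact (Suc k) / c / w ^ Suc (Suc k)" if "w \<noteq> 0" for w c :: complex and k
    using that by (simp add: divide_simps)
  have "(deriv ^^ m) (\<lambda>z. 1 / (- z - b) ^ Suc n) z = fact (n + m) / fact n / (- z - b) ^ Suc (n + m)"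
    if "- z - b \<noteq> 0" for z
    using that
  proof (induction m arbitrary: z)
    case (Suc m)
    have "open {z. - z - b \<noteq> 0}" by (intro open_Collect_neq continuous_intros)
    then have "eventually (\<lambda>z. - z - b \<noteq> 0) (nhds z)" using Suc.prems eventually_nhds_in_open[of "{z. - z - b \<noteq> 0}" z] by simp
    then have "eventually (\<lambda>z. (deriv ^^ m) (\<lambda>z. 1 / (- z - b) ^ Suc n) z = fact (n + m) / fact n / (- z - b) ^ Suc (n + m)) (nhds z)"
      by eventually_elim (rule Suc.IH)
    then have "deriv ((deriv ^^ m) (\<lambda>z. 1 / (- z - b) ^ Suc n)) z = deriv (\<lambda>z. fact (n + m) / fact n / (- z - b) ^ Suc (n + m)) z"
      by (rule deriv_cong_ev) simp
    also have "\<dots> = fact (n + Suc m) / fact n / (- z - b) ^ Suc (n + Suc m)"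
    proof (rule DERIV_imp_deriv)
      have d: "((\<lambda>z. - z - b) has_field_derivative -1) (at z)"
        by (rule derivative_eq_intros refl | simp)+
      have "((\<lambda>z. inverse ((- z - b) ^ Suc (n + m))) has_field_derivative
           - (inverse ((- z - b) ^ Suc (n + m)) * (of_nat (Suc (n + m)) * (- z - b) ^ (n + m) * (-1)) * inverse ((- z - b) ^ Suc (n + m)))) (at z)"
        using DERIV_inverse'[OF DERIV_power[OF d, of "Suc (n + m)"]] Suc.prems by (simp add: mult_ac del: power_Suc of_nat_Suc)
      then have "((\<lambda>z. fact (n + m) / fact n * inverse ((- z - b) ^ Suc (n + m))) has_field_derivative
         fact (n + m) / fact n * - (inverse ((- z - b) ^ Suc (n + m)) * (of_nat (Suc (n + m)) * (- z - b) ^ (n +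
             m) * (-1)) * inverse ((- z - b) ^ Suc (n + m)))) (at z)"
        by (rule DERIV_cmult)
      also have "fact (n + m) / fact n * - (inverse ((- z - b) ^ Suc (n + m)) * (of_nat (Suc (n + m)) * (- z - b) ^ (n +
          m) * (-1)) * inverse ((- z - b) ^ Suc (n + m)))
         = fact (n + Suc m) / fact n / (- z - b) ^ Suc (n + Suc m)"
        using field[OF Suc.prems, of "n + m" "fact n"] by simp
      finally show "((\<lambda>z. fact (n + m) / fact n / (- z - b) ^ Suc (n + m)) has_field_derivative
          fact (n + Suc m) / fact n / (- z - b) ^ Suc (n + Suc m)) (at z)" by (simp add: divide_inverse)
    qed
    finally show ?case by simp
  qed simp
  from this[OF assms] show ?thesis by (simp add: taylor_coeff_def binomial_fact mult.commute)
qed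

lemma exp_monom_add:
  "exp_monom a m (t + u) = (\<Sum>j\<le>m. exp_monom a (m - j) t * exp_monom a j u)"
proof -
  have "(of_real (t + u) ^ m :: complex) = (\<Sum>j\<le>m. of_nat (m choose j) * of_real u ^ j * of_real t ^ (m - j))"
    unfolding add.commute[of t u] of_real_add by (rule binomial_ring)
  also have "\<dots> / fact m = (\<Sum>j\<le>m. of_real t ^ (m - j) / fact (m - j) * (of_real u ^ j / fact j))"
    unfolding sum_divide_distrib
    by (intro sum.cong refl) (simp add: binomial_fact mult_ac)
  finally have "exp_monom a m (t + u) = \<dots> * exp (a * of_real (t + u))" by (simp add: exp_monom_def)
  also have "\<dots> = (\<Sum>j\<le>m. exp_monom a (m - j) t * exp_monom a j u)"
    unfolding sum_distrib_right
    by (intro sum.cong refl) (simp add: exp_monom_def exp_add[symmetric] algebra_simps)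
  finally show ?thesis .
qed

lemma exp_monom_mult:
  "exp_monom a j u * exp_monom b n u = of_nat (n + j choose j) * exp_monom (a + b) (n + j) u"
  by (simp add: exp_monom_def binomial_fact exp_add power_add algebra_simps)

lemma continuous_exp_monom [continuous_intros]: "continuous_on X (exp_monom a m)"
  unfolding exp_monom_def by (intro continuous_intros) auto

lemma measurable_exp_monom [measurable]: "exp_monom a m \<in> borel_measurable borel"
  by (intro borel_measurable_continuous_onI continuous_intros)

lemma norm_exp_monom: "t \<ge> 0 \<Longrightarrow> norm (exp_monom a m t) = t ^ m / fact m * exp (Re a * t)"
  by (simp add: exp_monom_def norm_mult norm_divide norm_power)

lemma exp_monom_tendsto_0:
  assumes "Re a < 0"
  shows "(exp_monom a m \<longlongrightarrow> 0) at_top"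
proof (rule tendsto_norm_zero_cancel)
  have "((\<lambda>t. (- Re a * t) ^ m / exp (- Re a * t)) \<longlongrightarrow> 0) at_top"
    by (rule filterlim_compose[OF tendsto_power_div_exp_0 filterlim_tendsto_pos_mult_at_top[OF tendsto_const _ filterlim_ident]])
       (use assms in simp)
  then have "((\<lambda>t. 1 / ((- Re a) ^ m * fact m) * ((- Re a * t) ^ m / exp (- Re a * t)))
      \<longlongrightarrow> 1 / ((- Re a) ^ m * fact m) * 0) at_top"
    by (intro tendsto_intros)
  moreover have "eventually (\<lambda>t. 1 / ((- Re a) ^ m * fact m) * ((- Re a * t) ^ m / exp (- Re a * t)) = norm (exp_monom a m t)) at_top"
    using eventually_ge_at_top[of 0]
  proof eventually_elim
    case (elim t)
    have "1 / exp (- Re a * t) = exp (Re a * t)" by (simp add: exp_minus field_simps)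
    then have "(- Re a * t) ^ m / exp (- Re a * t) = (- Re a) ^ m * t ^ m * exp (Re a * t)"
      unfolding power_mult_distrib[symmetric] by (simp add: exp_minus divide_inverse)
    moreover have "(- Re a) ^ m \<noteq> 0" using assms by simp
    ultimately show ?case using elim by (simp only: norm_exp_monom) (simp add: divide_simps)
  qed
  ultimately show "((\<lambda>t. norm (exp_monom a m t)) \<longlongrightarrow> 0) at_top"
    by (simp add: tendsto_cong)
qed

lemma exp_monom_integrable:
  assumes "Re a < 0"
  shows "set_integrable lborel {0<..} (exp_monom a m)"
proof -
  define l where "l = - Re a"
  have l: "l > 0" using assms by (simp add: l_def)
  have "integrable lborel (erlang_density m l)"
  proof (rule integrableI_nonneg)
    have "(\<integral>\<^sup>+ x. ennreal (erlang_density m l x * x ^ 0) \<partial>lborel) = fact (m + 0) / (fact m * l ^ 0)"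
      by (rule nn_integral_erlang_ith_moment[OF l])
    then show "(\<integral>\<^sup>+ x. ennreal (erlang_density m l x) \<partial>lborel) < \<infinity>" by simp
  qed (use l in auto)
  then have "integrable lborel (\<lambda>x. 1 / l ^ Suc m * erlang_density m l x)" by simp
  then show ?thesis unfolding set_integrable_def
  proof (rule Bochner_Integration.integrable_bound)
    have "norm (indicator {0<..} x *\<^sub>R exp_monom a m x) \<le> norm (1 / l ^ Suc m * erlang_density m l x)" for x
    proof (cases "x > 0")
      case True
      then have "1 / l ^ Suc m * erlang_density m l x = norm (exp_monom a m x)"
        using l by (simp add: norm_exp_monom erlang_density_def flip: l_def) (simp add: l_def)
      then show ?thesis using True by simp
    qed simp
    then show "AE x in lborel. norm (indicator {0<..} x *\<^sub>R exp_monom a m x) \<le> norm (1 / l ^ Suc m * erlang_density m l x)" by simp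
  qed simp
qed

lemma exp_monom_has_derivative:
  "(exp_monom b n has_vector_derivative (if n = 0 then 0 else exp_monom b (n - 1) t) + b * exp_monom b n t) (at t)"
proof (cases n)
  case 0
  then show ?thesis unfolding exp_monom_def
    by (auto intro!: derivative_eq_intros has_vector_derivative_real_field simp: mult.commute)
next
  case (Suc k)
  have "((\<lambda>z. z ^ Suc k / fact (Suc k) * exp (b * z)) has_field_derivative
     z ^ k / fact k * exp (b * z) + b * (z ^ Suc k / fact (Suc k) * exp (b * z))) (at z)" for z
  proof -
    have "((\<lambda>z. z ^ Suc k / fact (Suc k)) has_field_derivative of_nat (Suc k) * z ^ k / fact (Suc k)) (at z)"
      by (intro DERIV_cdivide) (rule derivative_eq_intros refl | simp)+
    also have "of_nat (Suc k) * z ^ k / fact (Suc k) = z ^ k / fact k" by (simp add: divide_simps del: of_nat_Suc)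
    finally have "((\<lambda>z. z ^ Suc k / fact (Suc k) * exp (b * z)) has_field_derivative
       z ^ k / fact k * exp (b * z) + (exp (b * z) * b) * (z ^ Suc k / fact (Suc k))) (at z)"
      by (rule DERIV_mult) (auto intro!: derivative_eq_intros)
    then show ?thesis by (simp add: mult_ac)
  qed
  from has_vector_derivative_real_field[OF this[of "of_real t"]]
  show ?thesis using Suc by (simp add: exp_monom_def[abs_def])
qed

lemma exp_monom_integral_deriv:
  assumes "Re b < 0"
  shows "(LINT u:{0<..}|lborel. (if n = 0 then 0 else exp_monom b (n - 1) u) + b * exp_monom b n u) = - exp_monom b n 0"
proof -
  have ei: "einterval 0 \<infinity> = {0<..}" by (auto simp: einterval_def zero_ereal_def)
  have "(LBINT x=0..\<infinity>. (if n = 0 then 0 else exp_monom b (n - 1) x) + b * exp_monom b n x) = 0 - exp_monom b n 0"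
  proof (rule interval_integral_FTC_integrable)
    show "set_integrable lborel (einterval 0 \<infinity>) (\<lambda>x. (if n = 0 then 0 else exp_monom b (n - 1) x) + b * exp_monom b n x)"
      unfolding ei using exp_monom_integrable[OF assms] by (cases n) (auto intro!: set_integral_add)
    have "isCont (exp_monom b k) x" for x k
      using continuous_exp_monom[of UNIV] by (simp add: continuous_on_eq_continuous_at)
    then show "isCont (\<lambda>x. (if n = 0 then 0 else exp_monom b (n - 1) x) + b * exp_monom b n x) x" for x
      by (cases n) (auto intro!: continuous_intros)
    show "((exp_monom b n \<circ> real_of_ereal) \<longlongrightarrow> 0) (at_left \<infinity>)"
      using exp_monom_tendsto_0[OF assms] by (simp add: ereal_tendsto_simps1)
    have "(exp_monom b n \<longlongrightarrow> exp_monom b n 0) (at_right 0)"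
      using continuous_exp_monom[of UNIV b n] by (auto simp: continuous_on_def intro: tendsto_within_subset)
    then show "((exp_monom b n \<circ> real_of_ereal) \<longlongrightarrow> exp_monom b n 0) (at_right 0)"
      unfolding zero_ereal_def by (simp add: ereal_tendsto_simps1)
  qed (use exp_monom_has_derivative in auto)
  then show ?thesis by (simp add: interval_lebesgue_integral_def ei)
qed

lemma exp_monom_integral:
  assumes "Re b < 0"
  shows "(LINT u:{0<..}|lborel. exp_monom b n u) = 1 / (- b) ^ Suc n"
proof (induction n)
  have b0: "b \<noteq> 0" using assms by auto
  {
    case 0
    then show ?case using exp_monom_integral_deriv[OF assms, of 0] b0 by (simp add: exp_monom_def field_simps)
  next
    case (Suc n)
    have "(LINT u:{0<..}|lborel. exp_monom b n u + b * exp_monom b (Suc n) u) = 0"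
      using exp_monom_integral_deriv[OF assms, of "Suc n"] by (simp add: exp_monom_def)
    then have "1 / (- b) ^ Suc n + b * (LINT u:{0<..}|lborel. exp_monom b (Suc n) u) = 0"
      using exp_monom_integrable[OF assms] Suc by (subst (asm) set_integral_add) auto
    then have "(LINT u:{0<..}|lborel. exp_monom b (Suc n) u) = (1 / (- b) ^ Suc n) / (- b)"
      using b0 by (simp add: field_simps eq_neg_iff_add_eq_0 del: power_Suc)
    then show ?case by simp
  }
qed

lemma exp_monom_shift_integral:
  assumes "Re a < 0" "Re b < 0"
  shows "set_integrable lborel {0<..} (\<lambda>u. exp_monom a m (t + u) * exp_monom b n u)"
    and "(LINT u:{0<..}|lborel. exp_monom a m (t + u) * exp_monom b n u) =
           taylor_coeff (\<lambda>z. exp (of_real t * z) * (1 / (- z - b) ^ Suc n)) a m"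
proof -
  have ab: "Re (a + b) < 0" using assms by simp
  have eq: "exp_monom a m (t + u) * exp_monom b n u =
     (\<Sum>j\<le>m. exp_monom a (m - j) t * of_nat (n + j choose j) * exp_monom (a + b) (n + j) u)" for u
    unfolding exp_monom_add sum_distrib_right mult.assoc exp_monom_mult ..
  show "set_integrable lborel {0<..} (\<lambda>u. exp_monom a m (t + u) * exp_monom b n u)"
    unfolding eq set_integrable_def scaleR_sum_right mult_scaleR_right[symmetric]
    using exp_monom_integrable[OF ab, unfolded set_integrable_def]
    by (intro Bochner_Integration.integrable_sum integrable_mult_right)
  have "(LINT u:{0<..}|lborel. exp_monom a m (t + u) * exp_monom b n u) =
    (\<Sum>j\<le>m. exp_monom a (m - j) t * of_nat (n + j choose j) * (LINT u:{0<..}|lborel. exp_monom (a + b) (n + j) u))"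
    unfolding eq set_lebesgue_integral_def scaleR_sum_right mult_scaleR_right[symmetric]
    using exp_monom_integrable[OF ab, unfolded set_integrable_def]
    by (subst Bochner_Integration.integral_sum) (simp_all del: mult_scaleR_right)
  also have "\<dots> = (\<Sum>j\<le>m. exp_monom a (m - j) t * (of_nat (n + j choose j) * (1 / (- a - b) ^ Suc (n + j))))"
    unfolding exp_monom_integral[OF ab] by (simp add: mult.assoc)
  also have "\<dots> = (\<Sum>j\<le>m. taylor_coeff (\<lambda>z. exp (of_real t * z)) a (m - j) *
      taylor_coeff (\<lambda>z. 1 / (- z - b) ^ Suc n) a j)"
  proof -
    have "- a - b \<noteq> 0" using ab by (metis add_cancel_left_right diff_conv_add_uminus minus_add_distrib neg_equal_0_iff_equal order_less_irrefl
        zero_complex.sel(1))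
    then show ?thesis by (simp add: taylor_coeff_exp taylor_coeff_inverse_power del: power_Suc)
  qed
  also have "\<dots> = taylor_coeff (\<lambda>z. exp (of_real t * z) * (1 / (- z - b) ^ Suc n)) a m"
  proof (rule taylor_coeff_mult[symmetric])
    show "open {z. Re z < 0}" by (rule open_halfspace_Re_lt)
    have "- z - b \<noteq> 0" if "Re z < 0" for z
    proof
      assume "- z - b = 0"
      then have "Re (- z - b) = 0" by simp
      then show False using that assms by simp
    qed
    then show "(\<lambda>z. 1 / (- z - b) ^ Suc n) holomorphic_on {z. Re z < 0}"
      by (intro holomorphic_intros) auto
    show "(\<lambda>z. exp (of_real t * z)) holomorphic_on {z. Re z < 0}" by (intro holomorphic_intros)
  qed (use assms in simp)
  finally show "(LINT u:{0<..}|lborel. exp_monom a m (t + u) * exp_monom b n u) =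
           taylor_coeff (\<lambda>z. exp (of_real t * z) * (1 / (- z - b) ^ Suc n)) a m" .
qed

section \<open>Partial fractions\<close>

lemma eventually_notin_finite_at_infinity:
  fixes X :: "complex set"
  assumes "finite X"
  shows "eventually (\<lambda>z. z \<notin> X) at_infinity"
proof -
  obtain b where b: "\<And>z. z \<in> X \<Longrightarrow> norm z \<le> b"
    using finite_imp_bounded[OF assms] unfolding bounded_iff by blast
  have "z \<notin> X" if "norm z \<ge> b + 1" for z using b[of z] that by auto
  then show ?thesis unfolding eventually_at_infinity by blast
qed

lemma poly_divide_decay_degree:
  fixes N D :: "complex poly"
  assumes "D \<noteq> 0" "((\<lambda>z. poly N z / poly D z) \<longlongrightarrow> 0) at_infinity"
  shows "N = 0 \<or> degree N < degree D"
proof (rule ccontr)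
  assume "\<not> ?thesis"
  then have N: "N \<noteq> 0" and deg: "degree D \<le> degree N" by auto
  define k where "k = degree N - degree D"
  have "((\<lambda>z. (poly N z / poly D z) * (poly D z / z ^ degree D) * inverse (z ^ k)) \<longlongrightarrow> 0 * lead_coeff D * (if k =
      0 then 1 else 0)) at_infinity"
  proof (intro tendsto_mult assms(2) poly_divide_tendsto_aux)
    show "((\<lambda>z. inverse (z ^ k :: complex)) \<longlongrightarrow> (if k = 0 then 1 else 0)) at_infinity"
    proof (cases "k = 0")
      case False
      then show ?thesis
        by (auto intro!: filterlim_compose[OF tendsto_inverse_0] filterlim_power_at_infinity filterlim_ident)
    qed simp
  qed
  moreover have "eventually (\<lambda>z. (poly N z / poly D z) * (poly D z / z ^ degree D) * inverse (z ^ k) = poly N z / z ^ degree N) at_infinity"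
  proof (rule eventually_mono[OF eventually_notin_finite_at_infinity[of "insert 0 {z. poly D z = 0}"]])
    fix z assume "z \<notin> insert 0 {z. poly D z = 0}"
    moreover have "z ^ degree N = z ^ degree D * z ^ k" using deg by (simp add: k_def flip: power_add)
    ultimately show "(poly N z / poly D z) * (poly D z / z ^ degree D) * inverse (z ^ k) = poly N z / z ^ degree N"
      by (simp add: field_simps)
  qed (use poly_roots_finite[OF assms(1)] in simp)
  ultimately have "((\<lambda>z. poly N z / z ^ degree N) \<longlongrightarrow> 0) at_infinity"
    by (simp add: tendsto_cong)
  then have "lead_coeff N = 0"
    using tendsto_unique[OF trivial_limit_at_infinity poly_divide_tendsto_aux[of N]] by simp
  then show False using N by simp
qed

lemma partial_fractions:
  fixes N D :: "complex poly"
  assumes "D \<noteq> 0" "N = 0 \<or> degree N < degree D"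
  shows "\<exists>c. \<forall>z. poly D z \<noteq> 0 \<longrightarrow>
     poly N z / poly D z = (\<Sum>a | poly D a = 0. \<Sum>m<degree D. c a m / (z - a) ^ Suc m)"
  using assms
proof (induction "degree D" arbitrary: N D)
  case 0
  then show ?case by (intro exI[of _ "\<lambda>_ _. 0"]) auto
next
  case (Suc n)
  have "\<not> constant (poly D)" using Suc.hyps(2) by (simp add: Fundamental_Theorem_Algebra.constant_degree)
  then obtain a where a: "poly D a = 0" using Fundamental_Theorem_Algebra.fundamental_theorem_of_algebra by blast
  define k where "k = order a D"
  obtain D2 where D2: "D = [:- a, 1:] ^ k * D2" "\<not> [:- a, 1:] dvd D2"
    using order_decomp[OF Suc.prems(1), of a] unfolding k_def by metis
  have "k \<noteq> 0" using a Suc.prems(1) by (simp add: k_def order_root)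
  then obtain k' where k': "k = Suc k'" by (cases k) auto
  have D2a: "poly D2 a \<noteq> 0" using D2(2) by (simp add: poly_eq_0_iff_dvd)
  define c0 where "c0 = poly N a / poly D2 a"
  have "poly (N - smult c0 D2) a = 0" using D2a by (simp add: c0_def)
  then obtain N' where N': "N - smult c0 D2 = [:- a, 1:] * N'" unfolding poly_eq_0_iff_dvd by (rule dvdE)
  define D' where "D' = [:- a, 1:] ^ k' * D2"
  have DD': "D = [:- a, 1:] * D'" using D2(1) by (simp add: D'_def k' mult_ac)
  have D'0: "D' \<noteq> 0" using DD' Suc.prems(1) by auto
  have degD: "degree D = Suc (degree D')" unfolding DD' using D'0 by (subst degree_mult_eq) auto
  have D20: "D2 \<noteq> 0" using D2a by auto
  have degD2: "degree D2 \<le> degree D'" unfolding D'_def using D20 by (subst degree_mult_eq) auto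
  have N'deg: "N' = 0 \<or> degree N' < degree D'"
  proof (rule ccontr)
    assume "\<not> ?thesis"
    then have N'0: "N' \<noteq> 0" "degree D' \<le> degree N'" by auto
    have "degree (N - smult c0 D2) = Suc (degree N')" unfolding N' using N'0 by (subst degree_mult_eq) auto
    moreover have "degree (N - smult c0 D2) \<le> degree D'"
      using Suc.prems(2) degD degD2 by (intro degree_diff_le order.trans[OF degree_smult_le]) auto
    ultimately show False using N'0 by simp
  qed
  obtain c where c: "\<And>z. poly D' z \<noteq> 0 \<Longrightarrow>
     poly N' z / poly D' z = (\<Sum>a | poly D' a = 0. \<Sum>m<degree D'. c a m / (z - a) ^ Suc m)"
    using Suc.hyps(1)[of D' N'] Suc.hyps(2) degD D'0 N'deg by auto
  define C where "C b m = (if poly D' b = 0 \<and> m < degree D' then c b m else 0) + (if b = a \<and> m = k' then c0 else 0)" for b m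
  have fin: "finite {b. poly D b = 0}" using Suc.prems(1) by (rule poly_roots_finite)
  have "degree D = k + degree D2" unfolding D2(1) using D20 by (subst degree_mult_eq) (auto simp: degree_power_eq)
  then have k'_less: "k' < degree D" using k' by simp
  show ?case
  proof (intro exI[of _ C] allI impI)
    fix z assume z: "poly D z \<noteq> 0"
    then have za: "z \<noteq> a" and zD': "poly D' z \<noteq> 0" using a by (auto simp: DD')
    have zD2: "poly D2 z \<noteq> 0" using zD' by (auto simp: D'_def)
    have "(\<Sum>b | poly D b = 0. \<Sum>m<degree D. C b m / (z - b) ^ Suc m) =
      (\<Sum>b | poly D b = 0. \<Sum>m<degree D. (if poly D' b = 0 \<and> m < degree D' then c b m / (z - b) ^ Suc m else 0)) +
      (\<Sum>b | poly D b = 0. \<Sum>m<degree D. (if b = a \<and> m = k' then c0 / (z - b) ^ Suc m else 0))"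
      unfolding sum.distrib[symmetric] by (intro sum.cong refl) (auto simp: C_def add_divide_distrib)
    also have "(\<Sum>b | poly D b = 0. \<Sum>m<degree D. (if b = a \<and> m = k' then c0 / (z - b) ^ Suc m else 0)) =
      (\<Sum>b | poly D b = 0. if b = a then c0 / (z - b) ^ Suc k' else 0)"
      using k'_less by (intro sum.cong refl) (auto simp: sum.delta')
    also have "\<dots> = c0 / (z - a) ^ k" using fin a by (simp add: k')
    also have "(\<Sum>b | poly D b = 0. \<Sum>m<degree D. (if poly D' b = 0 \<and> m < degree D' then c b m / (z - b) ^ Suc m else 0))
      = (\<Sum>b | poly D' b = 0. \<Sum>m<degree D'. c b m / (z - b) ^ Suc m)"
    proof (rule sum.mono_neutral_cong_right[OF fin])
      show "{b. poly D' b = 0} \<subseteq> {b. poly D b = 0}" using DD' by auto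
      show "(\<Sum>m<degree D. if poly D' b = 0 \<and> m < degree D' then c b m / (z - b) ^ Suc m else 0) =
          (\<Sum>m<degree D'. c b m / (z - b) ^ Suc m)"
        if "b \<in> {b. poly D' b = 0}" for b
        using that degD by (intro sum.mono_neutral_cong_right) auto
    qed auto
    also have "\<dots> = poly N' z / poly D' z" by (rule c[OF zD', symmetric])
    also have "poly N' z / poly D' z + c0 / (z - a) ^ k = poly N z / poly D z"
    proof -
      have "poly N z = c0 * poly D2 z + (z - a) * poly N' z"
        using arg_cong[OF N', of "\<lambda>p. poly p z"] by (simp add: algebra_simps)
      moreover have "poly D z = (z - a) * ((z - a) ^ k' * poly D2 z)" by (simp add: D2(1) k' left_diff_distrib)
      moreover have "poly D' z = (z - a) ^ k' * poly D2 z" by (simp add: D'_def)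
      moreover define X where "X = (z - a) ^ k'"
      moreover have "X \<noteq> 0" using za by (simp add: X_def)
      ultimately show ?thesis using za zD2 by (simp add: k' add_divide_distrib)
    qed
    finally show "poly N z / poly D z = (\<Sum>b | poly D b = 0. \<Sum>m<degree D. C b m / (z - b) ^ Suc m)" by simp
  qed
qed

text \<open>The sum over \<open>a \<in> Z\<close> of the residues at \<open>a\<close> of \<open>f(z) (\<Sum>m<K. c a m / (z - a)^(m + 1))\<close>.\<close>

abbreviation pairing :: "complex set \<Rightarrow> nat \<Rightarrow> (complex \<Rightarrow> nat \<Rightarrow> complex)
    \<Rightarrow> (complex \<Rightarrow> complex) \<Rightarrow> complex"
  where "pairing Z K c f \<equiv> \<Sum>a\<in>Z. \<Sum>m<K. c a m * taylor_coeff f a m"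

lemma has_contour_integral_partial_fractions:
  assumes "convex S" "open S" "h holomorphic_on S" "valid_path g" "pathfinish g = pathstart g"
    "path_image g \<subseteq> S - Z" "finite Z" "\<And>a. a \<in> Z \<inter> S \<Longrightarrow> winding_number g a = 1"
  shows "((\<lambda>z. h z * (\<Sum>a\<in>Z. \<Sum>m<K. c a m / (z - a) ^ Suc m)) has_contour_integral
     2 * pi * \<i> * (pairing (Z \<inter> S) K c h)) g"
proof -
  have 1: "((\<lambda>z. c a m * (h z / (z - a) ^ Suc m)) has_contour_integral
     (if a \<in> S then 2 * pi * \<i> * (c a m * taylor_coeff h a m) else 0)) g" if "a \<in> Z" for a m
  proof (cases "a \<in> S")
    case True
    have "((\<lambda>z. c a m * (h z / (z - a) ^ Suc m)) has_contour_integral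
     c a m * (2 * pi * \<i> * winding_number g a * ((deriv ^^ m) h a / fact m))) g"
      using assms True that by (intro has_contour_integral_lmul holomorphic_pole_contour_integral[of S]) auto
    then show ?thesis using True that assms(8) by (simp add: taylor_coeff_def mult_ac)
  next
    case False
    then have "(\<lambda>z. c a m * (h z / (z - a) ^ Suc m)) holomorphic_on S"
      by (intro holomorphic_intros assms) auto
    then have "((\<lambda>z. c a m * (h z / (z - a) ^ Suc m)) has_contour_integral 0) g"
      using assms by (intro Cauchy_theorem_convex_simple[where S=S]) auto
    then show ?thesis using False by simp
  qed
  have "((\<lambda>z. \<Sum>a\<in>Z. \<Sum>m<K. c a m * (h z / (z - a) ^ Suc m)) has_contour_integral
      (\<Sum>a\<in>Z. \<Sum>m<K. (if a \<in> S then 2 * pi * \<i> * (c a m * taylor_coeff h a m) else 0))) g"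
    by (intro has_contour_integral_sum assms 1) auto
  also have "(\<Sum>a\<in>Z. \<Sum>m<K. (if a \<in> S then 2 * pi * \<i> * (c a m * taylor_coeff h a m) else 0)) =
     (\<Sum>a\<in>Z. if a \<in> S then \<Sum>m<K. 2 * pi * \<i> * (c a m * taylor_coeff h a m) else 0)"
    by (intro sum.cong) auto
  also have "\<dots> = (\<Sum>a\<in>Z \<inter> S. \<Sum>m<K. 2 * pi * \<i> * (c a m * taylor_coeff h a m))"
    by (simp only: sum.inter_restrict[OF assms(7)])
  also have "\<dots> = 2 * pi * \<i> * (pairing (Z \<inter> S) K c h)"
    by (simp add: sum_distrib_left)
  finally show ?thesis by (simp add: sum_distrib_left mult_ac)
qed

lemma contour_integral_uminus_path:
  assumes "valid_path g"
  shows "contour_integral (\<lambda>t. - g t) f = - contour_integral g (\<lambda>z. f (- z))"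
proof -
  obtain T where T: "finite T" "g C1_differentiable_on ({0..1} - T)"
    using assms unfolding valid_path_def piecewise_C1_differentiable_on_def by blast
  have "contour_integral (\<lambda>t. - g t) f = integral {0..1} (\<lambda>t. f (- g t) * vector_derivative (\<lambda>t. - g t) (at t))"
    by (simp add: contour_integral_integral)
  also have "\<dots> = integral {0..1} (\<lambda>t. - (f (- g t) * vector_derivative g (at t)))"
  proof (rule integral_spike[of T])
    show "negligible T" using T by (intro negligible_finite)
    fix t assume "t \<in> {0..1} - T"
    then have "(g has_vector_derivative vector_derivative g (at t)) (at t)"
      using T(2) by (metis C1_differentiable_on_eq vector_derivative_works)
    then have "vector_derivative (\<lambda>t. - g t) (at t) = - vector_derivative g (at t)"
      by (intro vector_derivative_at has_vector_derivative_minus)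
    then show "- (f (- g t) * vector_derivative g (at t)) = f (- g t) * vector_derivative (\<lambda>t. - g t) (at t)" by simp
  qed
  also have "\<dots> = - contour_integral g (\<lambda>z. f (- z))"
    by (simp add: contour_integral_integral)
  finally show ?thesis .
qed

lemma valid_path_uminus:
  fixes g :: "real \<Rightarrow> complex"
  assumes "valid_path g" shows "valid_path (\<lambda>t. - g t)"
  using linear_image_valid_path[OF assms, of uminus] by (simp add: o_def linear_uminus)

lemma winding_number_uminus_path:
  assumes "valid_path g" "- z \<notin> path_image g"
  shows "winding_number (\<lambda>t. - g t) z = winding_number g (- z)"
proof -
  have "z \<notin> path_image (\<lambda>t. - g t)" using assms(2) by (auto simp: path_image_def)
  then have "winding_number (\<lambda>t. - g t) z = 1 / (2 * pi * \<i>) * contour_integral (\<lambda>t. - g t) (\<lambda>w. 1 / (w - z))"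
    using assms(1) by (intro winding_number_valid_path valid_path_uminus)
  also have "\<dots> = 1 / (2 * pi * \<i>) * - contour_integral g (\<lambda>w. - (1 / (w - - z)))"
  proof -
    have "1 / (- w - z) = - (1 / (w - - z))" for w :: complex
      by (metis diff_minus_eq_add minus_add_distrib minus_divide_right uminus_add_conv_diff add.commute)
    then show ?thesis by (simp add: contour_integral_uminus_path[OF assms(1)])
  qed
  also have "\<dots> = 1 / (2 * pi * \<i>) * contour_integral g (\<lambda>w. 1 / (w - - z))"
    using contour_integral_neg[of g "\<lambda>w. 1 / (w - - z)"] by simp
  also have "\<dots> = winding_number g (- z)"
    using assms by (intro winding_number_valid_path[symmetric])
  finally show ?thesis .
qed

section \<open>Fourier inversion of a pole and vanishing moments\<close>

lemma contour_integral_linepath_same_Im: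
  assumes "a < b"
  shows "contour_integral (linepath (Complex a c) (Complex b c)) f = integral {a..b} (\<lambda>x. f (Complex x c))"
proof -
  have shift: "linepath (Complex a c) (Complex b c) x = linepath (of_real a) (of_real b) x + \<i> * of_real c" for x
    by (simp add: linepath_def complex_eq_iff algebra_simps)
  have "contour_integral (linepath (Complex a c) (Complex b c)) f =
     contour_integral (linepath (of_real a) (of_real b)) (\<lambda>z. f (z + \<i> * of_real c))"
  proof -
    have "contour_integral (linepath (Complex a c) (Complex b c)) f =
       integral {0..1} (\<lambda>x. f (linepath (Complex a c) (Complex b c) x)) * (Complex b c - Complex a c)"
      by (simp add: contour_integral_integral)
    also have "Complex b c - Complex a c = of_real b - of_real a" by (simp add: complex_eq_iff)
    finally show ?thesis unfolding shift by (simp add: contour_integral_integral)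
  qed
  also have "\<dots> = integral {a..b} (\<lambda>x. f (of_real x + \<i> * of_real c))"
    using assms by (subst contour_integral_linepath_Reals_eq) auto
  finally show ?thesis by (simp add: Complex_eq)
qed

lemma exp_kernel_limit:
  assumes t: "t > 0" and a: "Re a < 0"
  shows "((\<lambda>T. integral {-T..T} (\<lambda>x. exp (\<i> * of_real t * of_real x) / (\<i> * of_real x - a) ^ Suc m))
           \<longlongrightarrow> 2 * pi * exp_monom a m t) at_top"
proof -
  define f where "f z = exp (of_real t * z) / (z - a) ^ Suc m" for z
  define I where "I T = integral {-T..T} (\<lambda>x. exp (\<i> * of_real t * of_real x) / (\<i> * of_real x - a) ^ Suc m)" for T :: real
  have bound: "norm (I T - 2 * pi * exp_monom a m t) \<le> 4 / (t * (T - norm a))" if T: "T \<ge> norm a + 1" for T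
  proof -
    have T0: "T > 0" using T norm_ge_zero[of a] by linarith
    have aT: "\<bar>Re a\<bar> < T" "\<bar>Im a\<bar> < T" using T abs_Re_le_cmod[of a] abs_Im_le_cmod[of a] by auto
    define p1 p2 p3 p4 where "p1 = Complex (-T) (-T)" and "p2 = Complex 0 (-T)" and "p3 = Complex 0 T" and "p4 = Complex (-T) T"
    have rp: "rectpath p1 p3 = linepath p1 p2 +++ linepath p2 p3 +++ linepath p3 p4 +++ linepath p4 p1"
      by (simp add: rectpath_def p1_def p2_def p3_def p4_def Let_def)
    have abox: "a \<in> box p1 p3" using aT a by (auto simp: in_box_complex_iff p1_def p3_def)
    have im: "path_image (rectpath p1 p3) \<subseteq> UNIV - {a}"
      using path_image_rectpath_inter_box[of p1 p3] abox T0 by (auto simp: p1_def p3_def)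
    have "(f has_contour_integral 2 * pi * \<i> * exp_monom a m t) (rectpath p1 p3)"
    proof -
      have "(f has_contour_integral 2 * pi * \<i> * winding_number (rectpath p1 p3) a * taylor_coeff (\<lambda>z. exp (of_real t *
          z)) a m) (rectpath p1 p3)"
        unfolding f_def taylor_coeff_def using im by (intro holomorphic_pole_contour_integral[of UNIV]) (auto intro!: holomorphic_intros)
      then show ?thesis
        using winding_number_rectpath[OF abox] by (simp add: taylor_coeff_exp)
    qed
    moreover have fint: "f contour_integrable_on linepath u v" if "a \<notin> closed_segment u v" for u v
      unfolding f_def using that
      by (intro contour_integrable_continuous_linepath continuous_intros) auto
    have dist: "T - norm a \<le> norm (z - a)" if "T \<le> norm z" for z
      using that norm_triangle_ineq2[of z a] by linarith
    have pos: "T - norm a \<ge> 1" using T by simp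
    have pw: "1 / norm ((z - a) ^ Suc m) \<le> 1 / (T - norm a)" if "T \<le> norm z" for z
    proof -
      have "T - norm a \<le> norm (z - a) ^ Suc 0" using dist[OF that] by simp
      also have "\<dots> \<le> norm (z - a) ^ Suc m" using dist[OF that] pos by (intro power_increasing) auto
      finally show ?thesis using pos by (simp add: norm_power frac_le del: power_Suc)
    qed
    have fb: "norm (f z) \<le> exp (t * Re z) / (T - norm a)" if "T \<le> norm z" for z
    proof -
      have "norm (f z) = exp (t * Re z) * (1 / norm ((z - a) ^ Suc m))" by (simp add: f_def norm_divide del: power_Suc)
      also have "\<dots> \<le> exp (t * Re z) * (1 / (T - norm a))" by (intro mult_left_mono pw that) auto
      finally show ?thesis by simp
    qed
    have big: "T \<le> norm z" if "\<bar>Re z\<bar> = T \<or> \<bar>Im z\<bar> = T" for z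
      using that abs_Re_le_cmod[of z] abs_Im_le_cmod[of z] by auto
    have seg: "z \<in> closed_segment p1 p2 \<Longrightarrow> \<bar>Im z\<bar> =
        T" "z \<in> closed_segment p3 p4 \<Longrightarrow> \<bar>Im z\<bar> = T"
      "z \<in> closed_segment p4 p1 \<Longrightarrow> \<bar>Re z\<bar> = T \<and> Re z = -T" "z \<in> closed_segment p2 p3 \<Longrightarrow> Re z =
          0" for z
      using T0 by (auto simp: p1_def p2_def p3_def p4_def closed_segment_same_Im closed_segment_same_Re)
    have na: "a \<notin> closed_segment p1 p2" "a \<notin> closed_segment p2 p3" "a \<notin> closed_segment p3 p4" "a \<notin> closed_segment p4 p1"
      using seg[of a] aT a by auto
    have "contour_integral (rectpath p1 p3) f = contour_integral (linepath p1 p2) f + (contour_integral (linepath p2 p3) f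
        + (contour_integral (linepath p3 p4) f + contour_integral (linepath p4 p1) f))"
      unfolding rp using fint na by simp
    moreover have "contour_integral (linepath p2 p3) f = \<i> * I T"
      using T0 unfolding I_def f_def
      by (subst contour_integral_linepath_same_Re[where c=0 and a="-T" and b=T])
         (simp_all add: p2_def p3_def Complex_eq mult_ac del: power_Suc)
    ultimately have eq: "\<i> * (I T - 2 * pi * exp_monom a m t) =
      - (contour_integral (linepath p1 p2) f + (contour_integral (linepath p3 p4) f + contour_integral (linepath p4 p1) f))"
      by (simp add: contour_integral_unique algebra_simps)
    have expint: "integral {-T..0} (\<lambda>x. exp (t * x) / (T - norm a)) \<le> 1 / (t * (T - norm a))"
         "(\<lambda>x. exp (t * x) / (T - norm a)) integrable_on {-T..0}"
    proof -
      have "((\<lambda>x. exp (t * x) / (T - norm a)) has_integral exp (t * 0) / t / (T - norm a) - exp (t * (-T)) / t / (T - norm a)) {-T..0}"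
        using T0 t pos by (intro fundamental_theorem_of_calculus)
           (auto intro!: derivative_eq_intros simp: has_real_derivative_iff_has_vector_derivative[symmetric])
      moreover have "exp (t * 0) / t / (T - norm a) - exp (t * (-T)) / t / (T - norm a) \<le> 1 / (t * (T - norm a))"
        using t pos by simp
      ultimately show "(\<lambda>x. exp (t * x) / (T - norm a)) integrable_on {-T..0}"
        "integral {-T..0} (\<lambda>x. exp (t * x) / (T - norm a)) \<le> 1 / (t * (T - norm a))"
        by (blast, simp only: integral_unique)
    qed
    have hor: "norm (integral {-T..0} (\<lambda>x. f (Complex x c))) \<le> 1 / (t * (T - norm a))" if c: "\<bar>c\<bar> = T" for c
    proof -
      have "continuous_on {-T..0} (\<lambda>x. f (Complex x c))"
      proof -
        have "Complex x c \<noteq> a" for x using c aT by auto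
        then show ?thesis unfolding f_def Complex_eq by (intro continuous_intros) auto
      qed
      then have "(\<lambda>x. f (Complex x c)) integrable_on {-T..0}" by (intro integrable_continuous_real)
      then have "norm (integral {-T..0} (\<lambda>x. f (Complex x c))) \<le> integral {-T..0} (\<lambda>x. exp (t * x) / (T - norm a))"
      proof (rule integral_norm_bound_integral[OF _ expint(2)])
        fix x show "norm (f (Complex x c)) \<le> exp (t * x) / (T - norm a)"
          using fb[OF big, of "Complex x c"] c by simp
      qed
      then show ?thesis using expint(1) by linarith
    qed
    have b1: "norm (contour_integral (linepath p1 p2) f) \<le> 1 / (t * (T - norm a))"
      using hor[of "-T"] T0 unfolding p1_def p2_def by (subst contour_integral_linepath_same_Im) simp_all
    have b3: "norm (contour_integral (linepath p3 p4) f) \<le> 1 / (t * (T - norm a))"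
    proof -
      have "contour_integral (linepath p3 p4) f = - contour_integral (linepath p4 p3) f"
        using fint[OF na(3)] by (metis contour_integral_reversepath reversepath_linepath valid_path_linepath)
      then show ?thesis
        using hor[of T] T0 contour_integral_linepath_same_Im[where c=T and a="-T" and b=0 and f=f]
        by (simp add: p3_def p4_def)
    qed
    have b4: "norm (contour_integral (linepath p4 p1) f) \<le> 2 / (t * (T - norm a))"
    proof -
      have "norm (contour_integral (linepath p4 p1) f) \<le> exp (t * (-T)) / (T - norm a) * norm (p1 - p4)"
        using fint[OF na(4)] pos seg(3) big fb
        by (intro contour_integral_bound_linepath) (fastforce)+
      also have "norm (p1 - p4) = 2 * T" using T0 by (simp add: p1_def p4_def cmod_def real_sqrt_mult)
      also have "exp (t * (-T)) / (T - norm a) * (2 * T) \<le> 2 / (t * (T - norm a))"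
      proof -
        have "t * T \<le> exp (t * T)" using exp_ge_add_one_self[of "t * T"] by linarith
        then have "exp (t * (-T)) * T \<le> 1 / t" using t by (simp add: exp_minus field_simps)
        then have "2 * (exp (t * (-T)) * T) / (T - norm a) \<le> 2 * (1 / t) / (T - norm a)"
          using pos by (intro divide_right_mono mult_left_mono) auto
        then show ?thesis by (simp add: mult_ac)
      qed
      finally show ?thesis .
    qed
    have "norm (I T - 2 * pi * exp_monom a m t) = norm (\<i> * (I T - 2 * pi * exp_monom a m t))" by (simp add: norm_mult)
    also have "\<dots> \<le> 1 / (t * (T - norm a)) + (1 / (t * (T - norm a)) + 2 / (t * (T - norm a)))"
      unfolding eq norm_minus_cancel by (intro order.trans[OF norm_triangle_ineq] add_mono b1 b3 b4)
    also have "\<dots> = 4 / (t * (T - norm a))" by (simp add: add_divide_distrib[symmetric])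
    finally show ?thesis .
  qed
  have "((\<lambda>T. I T - 2 * pi * exp_monom a m t) \<longlongrightarrow> 0) at_top"
  proof (rule Lim_null_comparison)
    show "\<forall>\<^sub>F T in at_top. norm (I T - 2 * pi * exp_monom a m t) \<le> 4 / (t * (T - norm a))"
      using eventually_ge_at_top[of "norm a + 1"] by eventually_elim (rule bound)
    have "filterlim (\<lambda>T. t * (T - norm a)) at_top at_top"
      by (rule filterlim_tendsto_pos_mult_at_top[OF tendsto_const t])
         (simp add: filterlim_tendsto_add_at_top[of "\<lambda>_. - norm a", OF tendsto_const filterlim_ident, simplified add.commute]
             diff_conv_add_uminus del: add_uminus_conv_diff)
    then show "((\<lambda>T. 4 / (t * (T - norm a))) \<longlongrightarrow> 0) at_top"
      by (intro tendsto_divide_0[OF tendsto_const] filterlim_at_top_imp_at_infinity)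
  qed
  then show ?thesis unfolding I_def by (simp add: LIM_zero_iff)
qed

lemma taylor_sum_moments_vanish:
  assumes "finite Z" "((\<lambda>z. z ^ Suc k * (\<Sum>a\<in>Z. \<Sum>m<K. c a m / (z - a) ^ Suc m)) \<longlongrightarrow> 0) at_infinity"
  shows "(pairing Z K c (\<lambda>z. z ^ k)) = 0" (is "?s = 0")
proof -
  define R where "R z = (\<Sum>a\<in>Z. \<Sum>m<K. c a m / (z - a) ^ Suc m)" for z
  obtain B where B: "B > 0" "\<And>a. a \<in> Z \<Longrightarrow> norm a < B"
  proof -
    obtain B where "\<forall>a\<in>Z. norm a \<le> B" using finite_imp_bounded[OF assms(1)] by (auto simp: bounded_iff)
    then show thesis by (intro that[of "\<bar>B\<bar> + 1"]) force+
  qed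
  have "norm ?s \<le> e" if e: "e > 0" for e
  proof -
    obtain b where b: "\<And>z. norm z \<ge> b \<Longrightarrow> norm (z ^ Suc k * R z) < e"
      using tendstoD[OF assms(2) e] by (auto simp: eventually_at_infinity R_def)
    define r where "r = max B b"
    have r: "r > 0" "r \<ge> b" "\<And>a. a \<in> Z \<Longrightarrow> norm a < r" using B by (auto simp: r_def intro: less_max_iff_disj[THEN iffD2])
    have "((\<lambda>z. z ^ k * R z) has_contour_integral
     2 * pi * \<i> * ?s) (circlepath 0 r)"
      unfolding R_def
    proof (rule has_contour_integral_partial_fractions[where S=UNIV, unfolded Int_UNIV_right])
      show "path_image (circlepath 0 r) \<subseteq> UNIV - Z" using r by force
      show "winding_number (circlepath 0 r) a = 1" if "a \<in> Z" for a
        using that r by (intro winding_number_circlepath) auto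
    qed (use assms in \<open>auto intro!: holomorphic_intros\<close>)
    then have *: "norm (2 * pi * \<i> * ?s) \<le> (e / r) * (2 * pi * r)"
    proof (rule has_contour_integral_bound_circlepath)
      show "0 \<le> e / r" "0 < r" using e r by auto
      fix z :: complex assume z: "norm (z - 0) = r"
      then have "norm (z ^ Suc k * R z) \<le> e" using b[of z] r by simp
      moreover have "norm (z ^ Suc k * R z) = r * norm (z ^ k * R z)" using z by (simp add: norm_mult)
      ultimately show "norm (z ^ k * R z) \<le> e / r" using r by (simp add: field_simps)
    qed
    then show ?thesis using r by (simp add: norm_mult)
  qed
  then have "norm ?s \<le> 0 + e" if "e > 0" for e
    unfolding add_0 using that .
  then have "norm ?s \<le> 0" by (rule field_le_epsilon)
  then show ?thesis by (rule norm_le_zero_iff[THEN iffD1])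
qed

section \<open>The generating function of the coefficients\<close>

definition phi :: "real \<Rightarrow> complex \<Rightarrow> complex"
  where "phi \<omega> z = 1 / (1 - exp (z + \<i> * \<omega>))"

lemma exp_neq_1_of_Re: "Re z \<noteq> 0 \<Longrightarrow> exp (z + \<i> * of_real \<omega>) \<noteq> 1"
proof
  assume "Re z \<noteq> 0" "exp (z + \<i> * of_real \<omega>) = 1"
  then show False using norm_exp_eq_Re[of "z + \<i> * of_real \<omega>"] by simp
qed

lemma exp_neq_1_of_norm:
  assumes "\<omega> \<in> {-pi<..<pi}" "norm z < \<bar>\<omega>\<bar>"
  shows "exp (z + \<i> * of_real \<omega>) \<noteq> 1"
proof
  assume "exp (z + \<i> * of_real \<omega>) = 1"
  then obtain n :: int where n: "Re (z + \<i> * of_real \<omega>) = 0" "Im (z + \<i> * of_real \<omega>) = of_int (2 * n) * pi"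
    unfolding exp_eq_1 by auto
  have "\<bar>2 * of_int n * pi - \<omega>\<bar> \<le> norm z" using abs_Im_le_cmod[of z] n by simp
  then have less: "\<bar>2 * of_int n * pi - \<omega>\<bar> < \<bar>\<omega>\<bar>" using assms by simp
  have "n \<noteq> 0" using less by auto
  then have "1 \<le> \<bar>real_of_int n\<bar>" by linarith
  then have "2 * 1 * pi \<le> 2 * \<bar>real_of_int n\<bar> * pi" by (intro mult_right_mono) auto
  also have "\<dots> = \<bar>2 * of_int n * pi\<bar>" by (simp add: abs_mult)
  finally have "2 * pi \<le> \<bar>2 * of_int n * pi\<bar>" by simp
  then show False using less assms by auto
qed

lemma phi_holomorphic:
  "(\<And>z. z \<in> S \<Longrightarrow> exp (z + \<i> * of_real \<omega>) \<noteq> 1) \<Longrightarrow> phi \<omega> holomorphic_on S"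
  unfolding phi_def[abs_def] by (intro holomorphic_intros) auto

lemma power_series_unique:
  fixes c d :: "nat \<Rightarrow> complex"
  assumes "r > 0" "\<And>z. norm z < r \<Longrightarrow> (\<lambda>k. c k * z ^ k)
      sums f z" "\<And>z. norm z < r \<Longrightarrow> (\<lambda>k. d k * z ^ k) sums f z"
  shows "c = d"
proof -
  have cr: "conv_radius e \<ge> r" if "\<And>z. norm z < r \<Longrightarrow> (\<lambda>k. e k * z ^ k) sums f z" for e
    by (rule conv_radius_geI_ex') (use that in \<open>auto simp: sums_iff\<close>)
  have "Abs_fps c = Abs_fps d"
  proof (rule eval_fps_eqD)
    show "0 < fps_conv_radius (Abs_fps c)" "0 < fps_conv_radius (Abs_fps d)"
      using cr[OF assms(2)] cr[OF assms(3)] assms(1) by (auto simp: fps_conv_radius_def intro: less_le_trans[of 0 "ereal r"])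
    show "eventually (\<lambda>z. eval_fps (Abs_fps c) z = eval_fps (Abs_fps d) z) (nhds 0)"
    proof -
      have "eventually (\<lambda>z. z \<in> ball 0 r) (nhds (0::complex))" using assms(1) by (intro eventually_nhds_in_open) auto
      then show ?thesis
        by eventually_elim (use assms(2,3) in \<open>auto simp: eval_fps_def sums_iff\<close>)
    qed
  qed
  then show ?thesis by (metis fps_nth_Abs_fps ext)
qed

lemma c_tilde_sums:
  assumes "\<omega> \<in> {-pi<..<pi}" "\<omega> \<noteq> 0" "norm z < \<bar>\<omega>\<bar>"
  shows "(\<lambda>k. c_tilde \<omega> k * z ^ k) sums phi \<omega> z"
proof -
  let ?P = "\<lambda>c. \<forall>z. cmod z < \<bar>\<omega>\<bar> \<longrightarrow> (\<lambda>k. c k * z ^ k)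
      sums (1 / (1 - exp (z + \<i> * \<omega>)))"
  have hol: "phi \<omega> holomorphic_on ball 0 \<bar>\<omega>\<bar>"
    by (rule phi_holomorphic, rule exp_neq_1_of_norm[OF assms(1)]) simp
  have P: "?P (\<lambda>k. (deriv ^^ k) (phi \<omega>) 0 / fact k)"
  proof (intro allI impI)
    fix z :: complex assume "norm z < \<bar>\<omega>\<bar>"
    then show "(\<lambda>k. (deriv ^^ k) (phi \<omega>) 0 / fact k * z ^ k) sums (1 / (1 - exp (z + \<i> * \<omega>)))"
      using holomorphic_power_series[OF hol, of z] unfolding phi_def[of _ z] diff_zero by simp
  qed
  have "c = (\<lambda>k. (deriv ^^ k) (phi \<omega>) 0 / fact k)" if "?P c" for c
    by (rule power_series_unique[of "\<bar>\<omega>\<bar>" c "\<lambda>z. 1 / (1 - exp (z + \<i> * \<omega>))"])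
       (use P that assms(2) in simp_all)
  then have "?P (THE c. ?P c)" using theI[of ?P, OF P] by blast
  then show ?thesis using assms(3) by (simp add: c_tilde_def phi_def)
qed

lemma taylor_coeff_geometric:
  assumes "r > 0" "w holomorphic_on ball a r" "\<And>z. z \<in> ball a r \<Longrightarrow> norm (w z) \<le> q" "q < 1"
  shows "summable (\<lambda>k. norm (taylor_coeff (\<lambda>z. w z ^ k) a m))"
    and "(\<lambda>k. taylor_coeff (\<lambda>z. w z ^ k) a m) sums taylor_coeff (\<lambda>z. 1 / (1 - w z)) a m"
proof -
  have q0: "0 \<le> q" using assms(3)[of a] assms(1) norm_ge_zero order_trans by (metis centre_in_ball)
  have sq: "summable (\<lambda>k. q ^ k)" using q0 assms(4) by (intro summable_geometric) auto
  have ul: "uniform_limit (ball a r) (\<lambda>n z. \<Sum>k<n. w z ^ k) (\<lambda>z. \<Sum>k. w z ^ k) sequentially"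
    by (rule Weierstrass_m_test[OF _ sq]) (use assms in \<open>auto simp: norm_power intro!: power_mono\<close>)
  have "uniform_limit (ball a r) (\<lambda>n z. \<Sum>k<n. w z ^ k) (\<lambda>z. 1 / (1 - w z)) sequentially"
    by (rule uniform_limit_cong'[THEN iffD1, OF _ _ ul])
       (use assms(3,4) in \<open>auto intro!: suminf_geometric le_less_trans[OF _ assms(4)]\<close>)
  then show "(\<lambda>k. taylor_coeff (\<lambda>z. w z ^ k) a m) sums taylor_coeff (\<lambda>z. 1 / (1 - w z)) a m"
    by (rule taylor_coeff_sums) (use assms in \<open>auto intro!: holomorphic_intros\<close>)
  have "norm (taylor_coeff (\<lambda>z. w z ^ k) a m) \<le> q ^ k * (1 / (r/2) ^ m) * 1" for k
  proof (cases "m = 0")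
    case True
    then show ?thesis using assms by (simp add: taylor_coeff_def norm_power power_mono)
  next
    case False
    have hol: "(\<lambda>z. w z ^ k) holomorphic_on ball a r" using assms(2) by (intro holomorphic_intros)
    have "norm ((deriv ^^ m) (\<lambda>z. w z ^ k) a) \<le> fact m * (q ^ k) / (r/2) ^ m"
    proof (rule Cauchy_inequality)
      show "(\<lambda>z. w z ^ k) holomorphic_on ball a (r/2)"
        by (rule holomorphic_on_subset[OF hol]) (use assms(1) in auto)
      show "continuous_on (cball a (r/2)) (\<lambda>z. w z ^ k)"
        by (rule continuous_on_subset[OF holomorphic_on_imp_continuous_on[OF hol]]) (use assms(1) in auto)
      show "norm (w z ^ k) \<le> q ^ k" if "norm (a - z) = r / 2" for z
        using assms(3)[of z] that assms(1) by (auto simp: norm_power dist_norm intro!: power_mono)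
    qed (use assms(1) in auto)
    then have "norm ((deriv ^^ m) (\<lambda>z. w z ^ k) a) / fact m \<le> q ^ k / (r/2) ^ m" by (simp add: field_simps)
    then show ?thesis by (simp add: taylor_coeff_def norm_divide)
  qed
  then have A: "norm (taylor_coeff (\<lambda>z. w z ^ k) a m) \<le> q ^ k * (1 / (r/2) ^ m)" for k by simp
  have B: "summable (\<lambda>k. q ^ k * (1 / (r/2) ^ m))" by (rule summable_mult2[OF sq])
  show "summable (\<lambda>k. norm (taylor_coeff (\<lambda>z. w z ^ k) a m))"
    by (rule summable_comparison_test'[OF B, where N=0]) (unfold real_norm_def abs_norm_cancel, rule A)
qed

lemma taylor_coeff_exp_geometric:
  assumes u: "norm u = 1" and s: "s * Re a < 0"
  shows "summable (\<lambda>k. norm (taylor_coeff (\<lambda>z. (u * exp (of_real s * z)) ^ k) a m))"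
    and "(\<lambda>k. taylor_coeff (\<lambda>z. (u * exp (of_real s * z)) ^ k) a m) sums
           taylor_coeff (\<lambda>z. 1 / (1 - u * exp (of_real s * z))) a m"
proof -
  define r where "r = \<bar>Re a\<bar> / 2"
  have r: "r > 0" using s by (auto simp: r_def)
  have bd: "norm (u * exp (of_real s * z)) \<le> exp (s * Re a / 2)" if "z \<in> ball a r" for z
  proof -
    have "\<bar>Re z - Re a\<bar> \<le> r"
      using that abs_Re_le_cmod[of "z - a"] by (simp add: dist_norm norm_minus_commute)
    then have "\<bar>s\<bar> * \<bar>Re z - Re a\<bar> \<le> \<bar>s\<bar> * r" by (rule mult_left_mono) simp
    moreover have "\<bar>s\<bar> * r = - (s * Re a / 2)" using s by (simp add: r_def abs_mult[symmetric])
    moreover have "s * (Re z - Re a) \<le> \<bar>s\<bar> * \<bar>Re z - Re a\<bar>" by (simp add: abs_mult[symmetric])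
    ultimately show ?thesis by (simp add: norm_mult u right_diff_distrib)
  qed
  have hol: "(\<lambda>z. u * exp (of_real s * z)) holomorphic_on ball a r" by (intro holomorphic_intros)
  have "exp (s * Re a / 2) < 1" using s by simp
  then show "summable (\<lambda>k. norm (taylor_coeff (\<lambda>z. (u * exp (of_real s * z)) ^ k) a m))"
    "(\<lambda>k. taylor_coeff (\<lambda>z. (u * exp (of_real s * z)) ^ k) a m) sums
       taylor_coeff (\<lambda>z. 1 / (1 - u * exp (of_real s * z))) a m"
    using taylor_coeff_geometric[OF r hol bd] by auto
qed

definition phi_transform :: "complex set \<Rightarrow> nat \<Rightarrow> (complex \<Rightarrow> nat \<Rightarrow> complex)
    \<Rightarrow> real \<Rightarrow> complex \<Rightarrow> complex"
  where "phi_transform Z K c \<omega> x = pairing Z K c (\<lambda>z. phi \<omega> (- x * z))"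

definition moment :: "complex set \<Rightarrow> nat \<Rightarrow> (complex \<Rightarrow> nat \<Rightarrow> complex)
    \<Rightarrow> nat \<Rightarrow> complex"
  where "moment Z K c k = pairing Z K c (\<lambda>z. z ^ k)"

lemma phi_transform_sums:
  assumes "finite Z" "\<omega> \<in> {-pi<..<pi}" "\<omega> \<noteq> 0" "\<And>a. a \<in> Z \<Longrightarrow> norm x * norm a < \<bar>\<omega>\<bar>"
  shows "(\<lambda>k. (- x) ^ k * c_tilde \<omega> k * moment Z K c k) sums phi_transform Z K c \<omega> x"
proof -
  have conv: "conv_radius (c_tilde \<omega>) \<ge> ereal \<bar>\<omega>\<bar>"
    by (rule conv_radius_geI_ex') (use c_tilde_sums[OF assms(2,3)] in \<open>auto simp: sums_iff\<close>)
  have 1: "(\<lambda>k. (- x) ^ k * c_tilde \<omega> k * taylor_coeff (\<lambda>z. z ^ k) a m)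
      sums taylor_coeff (\<lambda>z. phi \<omega> (- x * z)) a m" if aZ: "a \<in> Z" for a m
  proof -
    obtain R where R: "norm (- x * a) < R" "R < \<bar>\<omega>\<bar>"
      using dense[OF assms(4)[OF aZ]] by (auto simp: norm_mult)
    define A where "A = (\<lambda>z. - x * z) -` ball 0 R"
    have A: "open A" "a \<in> A" using R by (auto simp: A_def intro!: open_vimage continuous_intros)
    have "R < conv_radius (c_tilde \<omega>)" using R(2) conv by (metis less_ereal.simps(1) order_less_le_trans)
    from powser_uniform_limit[OF this, of 0]
    have "uniform_limit (cball 0 R) (\<lambda>n w. \<Sum>k<n. c_tilde \<omega> k * w ^ k) (\<lambda>w. \<Sum>k. c_tilde \<omega> k *
        w ^ k) sequentially" by simp
    then have "uniform_limit (cball 0 R) (\<lambda>n w. \<Sum>k<n. c_tilde \<omega> k * w ^ k) (phi \<omega>) sequentially"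
      by (rule uniform_limit_cong'[THEN iffD1, rotated -1])
         (use c_tilde_sums[OF assms(2,3)] R(2) in \<open>auto simp: sums_iff\<close>)
    then have "uniform_limit A (\<lambda>n z. \<Sum>k<n. c_tilde \<omega> k * (- x * z) ^ k) (\<lambda>z. phi \<omega> (- x * z)) sequentially"
      by (rule uniform_limit_compose') (auto simp: A_def)
    then have "(\<lambda>k. taylor_coeff (\<lambda>z. c_tilde \<omega> k * (- x * z) ^ k) a m)
        sums taylor_coeff (\<lambda>z. phi \<omega> (- x * z)) a m"
      by (rule taylor_coeff_sums) (use A in \<open>auto intro!: holomorphic_intros\<close>)
    moreover have "taylor_coeff (\<lambda>z. c_tilde \<omega> k * (- x * z) ^ k) a m =
        (- x) ^ k * c_tilde \<omega> k * taylor_coeff (\<lambda>z. z ^ k) a m" for k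
      using taylor_coeff_cmult[of "\<lambda>z. z ^ k" UNIV a "(- x) ^ k * c_tilde \<omega> k" m]
      by (simp only: power_mult_distrib mult_ac open_UNIV UNIV_I holomorphic_on_power holomorphic_on_ident)
    ultimately show ?thesis by simp
  qed
  have "(\<lambda>k. \<Sum>a\<in>Z. \<Sum>m<K. c a m * ((- x) ^ k * c_tilde \<omega> k * taylor_coeff (\<lambda>z. z ^ k) a m))
      sums phi_transform Z K c \<omega> x"
    unfolding phi_transform_def by (intro sums_sum sums_mult 1)
  then show ?thesis by (simp add: moment_def sum_distrib_left mult_ac)
qed

lemma phi_transform_holomorphic:
  assumes "finite Z"
  shows "phi_transform Z K c \<omega> holomorphic_on {x. \<forall>a\<in>Z. Re (x * a) \<noteq> 0}"
proof -
  let ?U = "{x. \<forall>a\<in>Z. Re (x * a) \<noteq> 0}" and ?T = "{z. Re z \<noteq> 0}"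
  have oT: "open ?T" by (intro open_Collect_neq continuous_intros)
  have hol: "phi \<omega> holomorphic_on ?T" by (intro phi_holomorphic exp_neq_1_of_Re) auto
  have "phi_transform Z K c \<omega> x = (\<Sum>a\<in>Z. \<Sum>m<K. c a m * ((- x) ^ m * ((deriv ^^ m) (phi \<omega>) (- x * a) / fact m)))"
      if "x \<in> ?U" for x
    unfolding phi_transform_def
  proof (intro sum.cong refl)
    fix a m assume "a \<in> Z"
    then have "- x * a \<in> ?T" using that by auto
    from taylor_coeff_scale[OF hol oT this]
    show "c a m * taylor_coeff (\<lambda>z. phi \<omega> (- x * z)) a m = c a m * ((- x) ^ m * ((deriv ^^ m) (phi \<omega>) (- x * a) / fact m))"
      by (simp add: taylor_coeff_def)
  qed
  moreover have "(\<lambda>x. \<Sum>a\<in>Z. \<Sum>m<K. c a m * ((- x) ^ m * ((deriv ^^ m) (phi \<omega>) (- x * a) / fact m))) holomorphic_on ?U"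
  proof (intro holomorphic_intros)
    fix a m assume "a \<in> Z"
    then have "(\<lambda>x. - x * a) ` ?U \<subseteq> ?T" by auto
    moreover have "(deriv ^^ m) (phi \<omega>) holomorphic_on ?T" by (rule holomorphic_higher_deriv[OF hol oT])
    ultimately have "((deriv ^^ m) (phi \<omega>) \<circ> (\<lambda>x. - x * a)) holomorphic_on ?U"
      by (intro holomorphic_on_compose_gen) (auto intro!: holomorphic_intros)
    then show "(\<lambda>x. (deriv ^^ m) (phi \<omega>) (- x * a)) holomorphic_on ?U" by (simp add: o_def)
  qed auto
  ultimately show ?thesis by (subst holomorphic_cong[OF refl]) auto
qed

section \<open>Analytic continuation and the two-sided sum\<close>

text \<open>The series converges to the transform for small \<open>\<Delta>\<close> only. For the remaining \<open>\<Delta>\<close>, the transform is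
  continued along the convex cone of all \<open>x\<close> for which no \<open>x a\<close> has crossed the imaginary axis, up
  to the boundary point \<open>\<Delta>\<close> of the disc of convergence, where Abel's theorem applies.\<close>

lemma phi_transform_eq_suminf:
  assumes Z: "finite Z" "\<And>a. a \<in> Z \<Longrightarrow> Re a \<noteq> 0" and \<omega>: "\<omega> \<in> {-pi<..<pi}" "\<omega> \<noteq> 0" and
      D: "\<Delta> > 0"
    and sm: "summable (\<lambda>k. (- of_real \<Delta>) ^ k * c_tilde \<omega> k * moment Z K c k)"
  shows "(\<Sum>k. (- of_real \<Delta>) ^ k * c_tilde \<omega> k * moment Z K c k) = phi_transform Z K c \<omega> (of_real \<Delta>)"
proof -
  define b where "b k = (- of_real \<Delta>) ^ k * c_tilde \<omega> k * moment Z K c k" for k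
  have smb: "summable b" by (rule sm[folded b_def])
  define U where "U = {x. \<forall>a\<in>Z. 0 < Re (x * a) * Re a}"
  define H where "H x = phi_transform Z K c \<omega> (x * of_real \<Delta>)" for x
  define G where "G x = (\<Sum>k. b k * x ^ k)" for x
  have U_eq: "U = (\<Inter>a\<in>Z. {x. 0 < (cnj a * of_real (Re a)) \<bullet> x})"
    by (auto simp: U_def inner_complex_def algebra_simps)
  have convU: "convex U" unfolding U_eq by (intro convex_INT convex_halfspace_gt)
  have openU: "open U" unfolding U_eq using Z(1) by (intro open_INT ballI open_halfspace_gt)
  have posU: "of_real x \<in> U" if "x > 0" for x
  proof -
    have "0 < Re (of_real x * a) * Re a" if "a \<in> Z" for a
    proof -
      have "0 < Re a * Re a" using Z(2)[OF that] by (auto simp: zero_less_mult_iff linorder_neq_iff)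
      then have "0 < x * (Re a * Re a)" using \<open>x > 0\<close> by (rule mult_pos_pos[rotated])
      then show ?thesis by (simp add: mult.assoc)
    qed
    then show ?thesis by (simp add: U_def)
  qed
  have holH: "H holomorphic_on U"
  proof -
    have "(phi_transform Z K c \<omega> \<circ> (\<lambda>x. x * of_real \<Delta>)) holomorphic_on U"
    proof (rule holomorphic_on_compose_gen[OF _ phi_transform_holomorphic[OF Z(1)]])
      show "(\<lambda>x. x * of_real \<Delta>) ` U \<subseteq> {x. \<forall>a\<in>Z. Re (x * a) \<noteq> 0}"
      proof safe
        fix x a assume "x \<in> U" "a \<in> Z" "Re (x * of_real \<Delta> * a) = 0"
        moreover have "Re (x * of_real \<Delta> * a) = \<Delta> * Re (x * a)" by (simp add: algebra_simps)
        ultimately show False using D by (auto simp: U_def)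
      qed
    qed (intro holomorphic_intros)
    then show ?thesis by (simp add: o_def H_def[abs_def])
  qed
  have cr: "conv_radius b \<ge> 1" using conv_radius_geI[of b 1] smb by (simp add: one_ereal_def)
  have "G holomorphic_on ball 0 1"
  proof (rule power_series_holomorphic[where a=b])
    fix w :: complex assume "w \<in> ball 0 1"
    then have "ereal (norm w) < conv_radius b" using order_less_le_trans[of "ereal (norm w)" "ereal 1"] cr by (simp add: one_ereal_def)
    then have "summable (\<lambda>n. b n * w ^ n)" by (rule summable_in_conv_radius)
    then show "(\<lambda>n. b n * (w - 0) ^ n) sums G w" by (simp add: G_def summable_sums)
  qed
  define V where "V = U \<inter> ball 0 1"
  have near: "\<exists>e>0. \<forall>x. norm x < e \<longrightarrow> G x = H x"
  proof -
    obtain B where B: "\<And>a. a \<in> Z \<Longrightarrow> norm a \<le> B" "B > 0"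
    proof -
      obtain B where "\<forall>a\<in>Z. norm a \<le> B" using finite_imp_bounded[OF Z(1)] by (auto simp: bounded_iff)
      then show thesis by (intro that[of "\<bar>B\<bar> + 1"]) force+
    qed
    show ?thesis
    proof (intro exI conjI allI impI)
      show "\<bar>\<omega>\<bar> / (\<Delta> * B) > 0" using \<omega> D B by simp
      fix x :: complex assume x: "norm x < \<bar>\<omega>\<bar> / (\<Delta> * B)"
      have "norm (x * of_real \<Delta>) * norm a < \<bar>\<omega>\<bar>" if "a \<in> Z" for a
      proof -
        have "norm (x * of_real \<Delta>) * norm a \<le> norm (x * of_real \<Delta>) * B"
          using B that by (intro mult_left_mono) auto
        also have "\<dots> = norm x * (\<Delta> * B)" using D by (simp add: norm_mult)
        also have "\<dots> < \<bar>\<omega>\<bar>" using x D B by (simp add: pos_less_divide_eq)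
        finally show ?thesis .
      qed
      from phi_transform_sums[OF Z(1) \<omega> this]
      have "(\<lambda>k. (- (x * of_real \<Delta>)) ^ k * c_tilde \<omega> k * moment Z K c k) sums H x" by (simp add: H_def)
      also have "(\<lambda>k. (- (x * of_real \<Delta>)) ^ k * c_tilde \<omega> k * moment Z K c k) = (\<lambda>k. b k * x ^ k)"
        unfolding b_def mult_minus_right[symmetric] power_mult_distrib by (simp add: mult_ac)
      finally show "G x = H x" by (simp add: G_def sums_iff)
    qed
  qed
  then obtain e where e: "e > 0" "\<And>x. norm x < e \<Longrightarrow> G x = H x" by blast
  have GH: "G x = H x" if "x \<in> V" for x
  proof (rule analytic_continuation_open[where f=G and g=H and s="V \<inter> ball 0 e" and s'=V])
    show "open (V \<inter> ball 0 e)" "open V" using openU by (auto simp: V_def)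
    show "connected V" unfolding V_def by (intro convex_connected convex_Int convU convex_ball)
    define x0 where "x0 = min (e/2) (1/2)"
    have "0 < x0" "x0 < e" "x0 < 1" using e(1) by (auto simp: x0_def)
    then have "of_real x0 \<in> V \<inter> ball 0 e" using posU[of x0] by (simp add: V_def)
    then show "V \<inter> ball 0 e \<noteq> {}" by blast
    show "G holomorphic_on V" "H holomorphic_on V"
      using \<open>G holomorphic_on ball 0 1\<close> holH by (auto simp: V_def intro: holomorphic_on_subset)
    show "G x = H x" if "x \<in> V \<inter> ball 0 e" for x using e(2)[of x] that by simp
  qed (use that in auto)
  have l1: "((\<lambda>x. G (of_real x)) \<longlongrightarrow> suminf b) (at_left (1::real))"
    unfolding G_def by (rule Abel_limit[OF smb])
  have l2: "((\<lambda>x. H (of_real x)) \<longlongrightarrow> H (of_real 1)) (at_left (1::real))"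
  proof -
    have "isCont H (of_real 1)"
      using holomorphic_on_imp_continuous_on[OF holH] openU posU[of 1] by (simp add: continuous_on_eq_continuous_at)
    then show ?thesis by (rule isCont_tendsto_compose) (intro tendsto_of_real tendsto_ident_at)
  qed
  have ev: "\<forall>\<^sub>F x in at_left (1::real). G (of_real x) = H (of_real x)"
  proof -
    have "\<forall>\<^sub>F x in at_left (1::real). x \<in> {0<..<1}"
      by (rule eventually_at_left_field[THEN iffD2]) (auto intro!: exI[of _ 0])
    then show ?thesis
      by eventually_elim (use posU in \<open>auto intro!: GH simp: V_def\<close>)
  qed
  have "suminf b = H (of_real 1)"
    by (rule tendsto_unique[OF trivial_limit_at_left_real Lim_transform_eventually[OF l1 ev] l2])
  then show ?thesis unfolding b_def[symmetric] H_def by simp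
qed

lemma has_sum_int_split:
  fixes f :: "int \<Rightarrow> 'a :: banach"
  assumes "summable (\<lambda>n. norm (f (int n)))" "(\<lambda>n. f (int n)) sums s"
    "summable (\<lambda>n. norm (f (- int (Suc n))))" "(\<lambda>n. f (- int (Suc n))) sums t"
  shows "(f has_sum (s + t)) UNIV"
proof -
  have "(f has_sum (s + t)) (range int \<union> range (\<lambda>n. - int (Suc n)))"
  proof (rule has_sum_Un_disjoint)
    show "(f has_sum s) (range int)"
      by (subst has_sum_reindex) (use norm_summable_imp_has_sum[OF assms(1,2)] in \<open>auto simp: o_def\<close>)
    show "(f has_sum t) (range (\<lambda>n. - int (Suc n)))"
      by (subst has_sum_reindex) (use norm_summable_imp_has_sum[OF assms(3,4)] in \<open>auto simp: o_def inj_on_def\<close>)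
  qed auto
  also have "range int \<union> range (\<lambda>n. - int (Suc n)) = UNIV"
  proof -
    have "k \<in> range int \<union> range (\<lambda>n. - int (Suc n))" for k
      by (cases k rule: int_cases) auto
    then show ?thesis by blast
  qed
  finally show ?thesis .
qed

lemma sum_half_planes:
  assumes "finite Z" "\<And>a. a \<in> Z \<Longrightarrow> Re a \<noteq> 0"
  shows "(\<Sum>a\<in>Z \<inter> {z. Re z < 0}. f a) + (\<Sum>a\<in>Z \<inter> {z. Re z > 0}. f a) = (\<Sum>a\<in>Z. f a)"
  using assms by (subst sum.union_disjoint[symmetric]) (auto intro!: sum.cong simp: linorder_neq_iff)

lemma bilateral_sum:
  fixes g :: "int \<Rightarrow> complex"
  assumes Z: "finite Z" "\<And>a. a \<in> Z \<Longrightarrow> Re a \<noteq> 0" and D: "\<Delta> > 0"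
    and g1: "\<And>k. g (int k) = pairing (Z \<inter> {z. Re z < 0}) K c (\<lambda>z. exp (of_real (real k * \<Delta>) * z))"
    and g2: "\<And>k. g (- int (Suc k)) = - pairing (Z \<inter> {z. Re z > 0}) K c (\<lambda>z. exp (- of_real (real (Suc k) * \<Delta>) * z))"
    and m0: "moment Z K c 0 = 0"
  shows "((\<lambda>k. exp (- \<i> * of_int k * of_real \<omega>) * g k) has_sum - phi_transform Z K c \<omega> (of_real \<Delta>)) UNIV"
proof -
  define wl where "wl z = exp (- \<i> * of_real \<omega>) * exp (of_real \<Delta> * z)" for z
  define wr where "wr z = exp (\<i> * of_real \<omega>) * exp (- of_real \<Delta> * z)" for z
  have left: "summable (\<lambda>k. norm (taylor_coeff (\<lambda>z. wl z ^ k) a m))"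
      "(\<lambda>k. taylor_coeff (\<lambda>z. wl z ^ k) a m) sums taylor_coeff (\<lambda>z. 1 / (1 - wl z)) a m"
    if "Re a < 0" for a m
    using taylor_coeff_exp_geometric[of "exp (- \<i> * of_real \<omega>)" \<Delta> a m] that D
    by (auto simp: wl_def mult_pos_neg)
  have right: "summable (\<lambda>k. norm (taylor_coeff (\<lambda>z. wr z ^ k) a m))"
      "(\<lambda>k. taylor_coeff (\<lambda>z. wr z ^ k) a m) sums taylor_coeff (\<lambda>z. 1 / (1 - wr z)) a m"
    if "Re a > 0" for a m
    using taylor_coeff_exp_geometric[of "exp (\<i> * of_real \<omega>)" "- \<Delta>" a m] that D
    by (auto simp: wr_def)
  have rightS: "summable (\<lambda>k. norm (taylor_coeff (\<lambda>z. wr z ^ Suc k) a m))" if "Re a > 0" for a m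
    using right(1)[OF that, of m] by (subst summable_Suc_iff[of "\<lambda>k. norm (taylor_coeff (\<lambda>z. wr z ^ k) a m)"])
  have f1: "exp (- \<i> * of_int (int k) * of_real \<omega>) * g (int k) = pairing (Z \<inter> {z. Re z < 0}) K c (\<lambda>z. wl z ^ k)" for k
  proof -
    have "taylor_coeff (\<lambda>z. wl z ^ k) a m =
        exp (- \<i> * of_int (int k) * of_real \<omega>) * taylor_coeff (\<lambda>z. exp (of_real (real k * \<Delta>) * z)) a m" for a m
    proof -
      have "wl z ^ k = exp (- \<i> * of_int (int k) * of_real \<omega>) * exp (of_real (real k * \<Delta>) * z)" for z
        by (simp add: wl_def power_mult_distrib exp_of_nat_mult[symmetric] mult_ac)
      then show ?thesis by (simp only:) (rule taylor_coeff_cmult[of _ UNIV], auto intro!: holomorphic_intros)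
    qed
    then show ?thesis unfolding g1 by (simp add: sum_distrib_left mult_ac)
  qed
  have f2: "exp (- \<i> * of_int (- int (Suc k)) * of_real \<omega>) * g (- int (Suc k)) =
      - pairing (Z \<inter> {z. Re z > 0}) K c (\<lambda>z. wr z ^ Suc k)" for k
  proof -
    have "taylor_coeff (\<lambda>z. wr z ^ Suc k) a m =
        exp (- \<i> * of_int (- int (Suc k)) * of_real \<omega>) * taylor_coeff (\<lambda>z. exp (- of_real (real (Suc k) * \<Delta>) *
            z)) a m" for a m
    proof -
      have "wr z ^ Suc k = exp (- \<i> * of_int (- int (Suc k)) * of_real \<omega>) * exp (- of_real (real (Suc k) * \<Delta>) * z)" for z
        unfolding wr_def power_mult_distrib exp_of_nat_mult[symmetric] by (simp add: algebra_simps)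
      then show ?thesis by (simp only:) (rule taylor_coeff_cmult[of _ UNIV], auto intro!: holomorphic_intros)
    qed
    then show ?thesis unfolding g2 by (simp add: sum_distrib_left mult_ac sum_negf)
  qed
  define sl where "sl = pairing (Z \<inter> {z. Re z < 0}) K c (\<lambda>z. 1 / (1 - wl z))"
  define sr where "sr = - (\<Sum>a\<in>Z \<inter> {z. Re z > 0}. \<Sum>m<K. c a m *
      (taylor_coeff (\<lambda>z. 1 / (1 - wr z)) a m - taylor_coeff (\<lambda>z. wr z ^ 0) a m))"
  have "((\<lambda>k. exp (- \<i> * of_int k * of_real \<omega>) * g k) has_sum (sl + sr)) UNIV"
  proof (rule has_sum_int_split)
    show "(\<lambda>n. exp (- \<i> * of_int (int n) * of_real \<omega>) * g (int n)) sums sl"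
      unfolding f1 sl_def by (intro sums_sum sums_mult left) auto
    show "(\<lambda>n. exp (- \<i> * of_int (- int (Suc n)) * of_real \<omega>) * g (- int (Suc n))) sums sr"
      unfolding f2 sr_def by (intro sums_minus sums_sum sums_mult sums_Suc_iff[THEN iffD2] right) (use right in auto)
    show "summable (\<lambda>n. norm (exp (- \<i> * of_int (int n) * of_real \<omega>) * g (int n)))"
      unfolding f1
      by (rule summable_comparison_test'[where g="\<lambda>n. \<Sum>a\<in>Z \<inter> {z. Re z < 0}. \<Sum>m<K. norm (c a m) *
          norm (taylor_coeff (\<lambda>z. wl z ^ n) a m)" and N=0])
         (auto simp: norm_mult[symmetric] intro!: sum_norm_le summable_sum summable_mult left norm_sum, auto simp: norm_mult intro!: summable_mult
             left)
    show "summable (\<lambda>n. norm (exp (- \<i> * of_int (- int (Suc n)) * of_real \<omega>) * g (- int (Suc n))))"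
      unfolding f2 norm_minus_cancel
      by (rule summable_comparison_test'[where g="\<lambda>n. \<Sum>a\<in>Z \<inter> {z. Re z > 0}. \<Sum>m<K. norm (c a m) *
          norm (taylor_coeff (\<lambda>z. wr z ^ Suc n) a m)" and N=0])
         (auto simp: norm_mult[symmetric] simp del: power_Suc intro!: sum_norm_le norm_sum, auto simp: norm_mult simp del: power_Suc intro!:
             summable_sum summable_mult rightS)
  qed
  moreover have "sl + sr = - phi_transform Z K c \<omega> (of_real \<Delta>)"
  proof -
    let ?p = "\<lambda>a m. taylor_coeff (\<lambda>z. phi \<omega> (- of_real \<Delta> * z)) a m"
    let ?o = "\<lambda>a m. taylor_coeff (\<lambda>z. z ^ 0) a m"
    have wphi: "exp (\<i> * of_real \<omega> - of_real \<Delta> * z) \<noteq> 1" if "Re z \<noteq> 0" for z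
      using exp_neq_1_of_Re[of "- of_real \<Delta> * z" \<omega>] that D by (simp add: algebra_simps)
    have wrphi: "1 / (1 - wr z) = phi \<omega> (- of_real \<Delta> * z)" for z
      unfolding phi_def wr_def exp_add by (simp only: mult.commute)
    have wlphi: "1 / (1 - wl z) = 1 + (-1) * phi \<omega> (- of_real \<Delta> * z)" if "Re z \<noteq> 0" for z
    proof -
      define e where "e = exp (- of_real \<Delta> * z + \<i> * of_real \<omega>)"
      have e: "e \<noteq> 1" "e \<noteq> 0" using exp_neq_1_of_Re[of "- of_real \<Delta> * z" \<omega>] that D by (auto simp: e_def)
      have "wl z = exp (- (- of_real \<Delta> * z + \<i> * of_real \<omega>))" by (simp add: wl_def exp_add[symmetric])
      then have "wl z = inverse e" unfolding exp_minus by (simp only: e_def)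
      moreover have "1 / (1 - inverse e) = 1 + (-1) * (1 / (1 - e))" using e by (simp add: divide_simps) (simp add: algebra_simps)?
      ultimately show ?thesis unfolding phi_def e_def[symmetric] by (simp only:)
    qed
    have hphi: "(\<lambda>z. phi \<omega> (- of_real \<Delta> * z)) holomorphic_on {z. Re z < 0}"
    proof -
      have "(phi \<omega> \<circ> (\<lambda>z. - of_real \<Delta> * z)) holomorphic_on {z. Re z < 0}"
        by (rule holomorphic_on_compose_gen[of _ _ _ "{z. Re z \<noteq> 0}"])
           (use D in \<open>auto intro!: holomorphic_intros phi_holomorphic exp_neq_1_of_Re\<close>)
      then show ?thesis by (simp add: o_def)
    qed
    have tl: "taylor_coeff (\<lambda>z. 1 / (1 - wl z)) a m = ?o a m - ?p a m" if "Re a < 0" for a m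
    proof -
      have "taylor_coeff (\<lambda>z. 1 / (1 - wl z)) a m = taylor_coeff (\<lambda>z. z ^ 0 + (-1) * phi \<omega> (- of_real \<Delta> * z)) a m"
        by (rule taylor_coeff_transform[symmetric, where S="{z. Re z < 0}"])
           (use that wlphi hphi in \<open>auto intro!: holomorphic_intros open_halfspace_Re_lt\<close>)
      also have "\<dots> = ?o a m + taylor_coeff (\<lambda>z. (-1) * phi \<omega> (- of_real \<Delta> * z)) a m"
        by (rule taylor_coeff_add[where S="{z. Re z < 0}"])
           (use that hphi in \<open>auto intro!: holomorphic_intros open_halfspace_Re_lt\<close>)
      also have "taylor_coeff (\<lambda>z. (-1) * phi \<omega> (- of_real \<Delta> * z)) a m = (-1) * ?p a m"
        by (rule taylor_coeff_cmult[OF hphi open_halfspace_Re_lt]) (use that in auto)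
      finally show ?thesis by simp
    qed
    have "sl = (\<Sum>a\<in>Z \<inter> {z. Re z < 0}. \<Sum>m<K. c a m * (?o a m - ?p a m))"
      unfolding sl_def by (intro sum.cong refl) (auto simp: tl)
    moreover have "sr = (\<Sum>a\<in>Z \<inter> {z. Re z > 0}. \<Sum>m<K. c a m * (?o a m - ?p a m))"
      unfolding sr_def wrphi by (simp add: sum_negf[symmetric] algebra_simps)
    ultimately have "sl + sr = (\<Sum>a\<in>Z. \<Sum>m<K. c a m * (?o a m - ?p a m))"
      by (simp only: sum_half_planes[OF Z])
    also have "\<dots> = moment Z K c 0 - phi_transform Z K c \<omega> (of_real \<Delta>)"
      unfolding moment_def phi_transform_def by (simp add: right_diff_distrib sum_subtractf)
    finally show ?thesis using m0 by simp
  qed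
  ultimately show ?thesis by simp
qed

section \<open>The transfer function\<close>

lemma cscale_nth [simp]: "cscale z X $ i $ j = z * X $ i $ j"
  by (simp add: cscale_def map_matrix_def)

lemma cmat_nth [simp]: "cmat X $ i $ j = of_real (X $ i $ j)"
  by (simp add: map_matrix_def)

lemma sum_vec_nth2: "(\<Sum>k\<in>K. f k) $ i $ j = (\<Sum>k\<in>K. f k $ i $ j)"
  by (simp add: sum_component)

lemma ar_poly_nth:
  "ar_poly p A z $ i $ j = z ^ p * (if i = j then 1 else 0) + (\<Sum>k=1..p. z ^ (p - k) * of_real (A k $ i $ j))"
  by (simp add: ar_poly_def sum_vec_nth2 mat_def)

lemma ma_poly_nth: "ma_poly q B z $ i $ j = (\<Sum>k=0..q. z ^ (q - k) * of_real (B k $ i $ j))"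
  by (simp add: ma_poly_def sum_vec_nth2)

lemma det_polynomial:
  fixes X :: "complex \<Rightarrow> complex^'d^'d"
  assumes "\<And>i j. \<exists>p. \<forall>z. X z $ i $ j = poly p z"
  shows "\<exists>p. \<forall>z. det (X z) = poly p z"
proof -
  obtain P where P: "\<And>i j z. X z $ i $ j = poly (P i j) z" using assms by metis
  have "det (X z) = poly (\<Sum>\<pi> | \<pi> permutes UNIV. smult (of_int (sign \<pi>)) (\<Prod>i\<in>UNIV. P i (\<pi> i))) z" for z
    unfolding det_def by (simp add: poly_sum poly_prod P)
  then show ?thesis by blast
qed

lemma tendsto_det:
  fixes X :: "'x \<Rightarrow> complex^'d^'d"
  assumes "\<And>i j. ((\<lambda>z. X z $ i $ j) \<longlongrightarrow> Y $ i $ j) F"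
  shows "((\<lambda>z. det (X z)) \<longlongrightarrow> det Y) F"
  unfolding det_def by (intro tendsto_intros assms)

lemma det_cnj:
  fixes X :: "complex^'d^'d"
  shows "cnj (det X) = det (\<chi> i j. cnj (X $ i $ j))"
  unfolding det_def by (simp add: cnj_sum cnj_prod)

definition transfer :: "nat \<Rightarrow> nat \<Rightarrow> (nat \<Rightarrow> real^'d^'d) \<Rightarrow> (nat \<Rightarrow> real^'d^'d)
    \<Rightarrow> complex \<Rightarrow> complex^'d^'d"
  where "transfer p q A B z = matrix_inv (ar_poly p A z) ** ma_poly q B z"

lemma transfer_solves:
  assumes "det (ar_poly p A z) \<noteq> 0"
  shows "ar_poly p A z ** transfer p q A B z = ma_poly q B z"
proof -
  have "invertible (ar_poly p A z)" using assms by (simp add: invertible_det_nz)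
  then show ?thesis unfolding transfer_def matrix_mul_assoc matrix_inv_def invertible_def
    by (rule someI2_ex) simp
qed

lemma cramer_entry:
  fixes X F Y :: "complex^'d^'d"
  assumes "det X \<noteq> 0" "X ** F = Y"
  shows "F $ k $ j = det (\<chi> i l. if l = k then Y $ i $ j else X $ i $ l) / det X"
proof -
  have "X *v column j F = column j Y"
    using assms(2) by (auto simp: vec_eq_iff matrix_vector_mult_def column_def matrix_matrix_mult_def)
  then have "column j F = (\<chi> k. det (\<chi> i l. if l = k then column j Y $ i else X $ i $ l) / det X)"
    using cramer[OF assms(1)] by blast
  then have "column j F $ k = det (\<chi> i l. if l = k then column j Y $ i else X $ i $ l) / det X" by simp
  moreover have "column j Z $ i = Z $ i $ j" for Z :: "complex^'d^'d" and i by (simp add: column_def)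
  ultimately show ?thesis by (simp only:)
qed

lemma ar_poly_polynomial: "\<exists>P. \<forall>z. ar_poly p A z $ i $ j = poly P z"
proof
  show "\<forall>z. ar_poly p A z $ i $ j = poly (monom (if i = j then 1 else 0) p + (\<Sum>k=1..p. monom (of_real (A k $ i $ j)) (p - k))) z"
    by (simp add: ar_poly_nth poly_monom poly_sum mult.commute)
qed

lemma ma_poly_polynomial: "\<exists>P. \<forall>z. ma_poly q B z $ i $ j = poly P z"
proof
  show "\<forall>z. ma_poly q B z $ i $ j = poly (\<Sum>k=0..q. monom (of_real (B k $ i $ j)) (q - k)) z"
    by (simp add: ma_poly_nth poly_monom poly_sum mult.commute)
qed

lemma det_ar_poly_polynomial: "\<exists>D. \<forall>z. det (ar_poly p A z) = poly D z"
  by (rule det_polynomial) (rule ar_poly_polynomial)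

lemma transfer_rational:
  "\<exists>N. \<forall>z. det (ar_poly p A z) \<noteq> 0 \<longrightarrow> transfer p q A B z $ k $ j = poly N z / det (ar_poly p A z)"
proof -
  have "\<exists>N. \<forall>z. det (\<chi> i l. if l = k then ma_poly q B z $ i $ j else ar_poly p A z $ i $ l) = poly N z"
  proof (rule det_polynomial)
    fix i l
    show "\<exists>N. \<forall>z. (\<chi> i l. if l = k then ma_poly q B z $ i $ j else ar_poly p A z $ i $ l) $ i $ l = poly N z"
      using ar_poly_polynomial[of p A i l] ma_poly_polynomial[of q B i j] by (cases "l = k") auto
  qed
  then obtain N where N: "\<And>z. det (\<chi> i l. if l = k then ma_poly q B z $ i $ j else ar_poly p A z $ i $ l) = poly N z" by blast
  show ?thesis
  proof (intro exI[of _ N] allI impI)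
    fix z assume "det (ar_poly p A z) \<noteq> 0"
    from cramer_entry[OF this transfer_solves[OF this]]
    show "transfer p q A B z $ k $ j = poly N z / det (ar_poly p A z)" by (simp only: N)
  qed
qed

lemma transfer_cnj:
  assumes "det (ar_poly p A z) \<noteq> 0"
  shows "cnj (transfer p q A B z $ k $ j) = transfer p q A B (cnj z) $ k $ j"
proof -
  have a: "cnj (ar_poly p A z $ i $ l) = ar_poly p A (cnj z) $ i $ l" for i l
    unfolding ar_poly_nth by simp
  have b: "cnj (ma_poly q B z $ i $ l) = ma_poly q B (cnj z) $ i $ l" for i l
    unfolding ma_poly_nth by simp
  have d: "cnj (det (ar_poly p A z)) = det (ar_poly p A (cnj z))"
    unfolding det_cnj a by (simp add: vec_lambda_eta)
  have n: "cnj (det (\<chi> i l. if l = k then ma_poly q B z $ i $ j else ar_poly p A z $ i $ l)) =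
      det (\<chi> i l. if l = k then ma_poly q B (cnj z) $ i $ j else ar_poly p A (cnj z) $ i $ l)"
    unfolding det_cnj by (intro arg_cong[where f=det]) (simp add: vec_eq_iff a b)
  have "det (ar_poly p A (cnj z)) \<noteq> 0" using assms d by (metis complex_cnj_zero_iff)
  from cramer_entry[OF this transfer_solves[OF this]] cramer_entry[OF assms transfer_solves[OF assms]]
  show ?thesis by (simp add: n d)
qed

lemma power_quotient_tendsto:
  assumes "k \<le> n"
  shows "((\<lambda>z::complex. z ^ (n - k) / z ^ n) \<longlongrightarrow> (if k = 0 then 1 else 0)) at_infinity"
proof -
  have ev: "eventually (\<lambda>z::complex. z \<noteq> 0) at_infinity"
    unfolding eventually_at_infinity by (intro exI[of _ 1]) auto
  have "((\<lambda>z::complex. inverse (z ^ k)) \<longlongrightarrow> (if k = 0 then 1 else 0)) at_infinity"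
    by (cases "k = 0") (auto intro!: filterlim_compose[OF tendsto_inverse_0] filterlim_power_at_infinity filterlim_ident)
  moreover have "eventually (\<lambda>z::complex. inverse (z ^ k) = z ^ (n - k) / z ^ n) at_infinity"
    using ev
  proof eventually_elim
    case (elim z)
    have "z ^ n = z ^ (n - k) * z ^ k" using assms by (simp flip: power_add)
    then show ?case using elim by (simp add: divide_simps)
  qed
  ultimately show ?thesis by (rule Lim_transform_eventually)
qed

lemma ar_poly_scaled_tendsto:
  "((\<lambda>z. ar_poly p A z $ i $ j / z ^ p) \<longlongrightarrow> (mat 1 :: complex^'d^'d) $ i $ j) at_infinity"
  for A :: "nat \<Rightarrow> real^'d^'d"
proof -
  have "((\<lambda>z. z ^ (p - 0) / z ^ p * (if i = j then 1 else 0) + (\<Sum>k=1..p. z ^ (p - k) / z ^ p * complex_of_real (A k $ i $ j)))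
     \<longlongrightarrow> (if (0::nat) = 0 then 1 else 0) * (if i = j then 1 else 0) + (\<Sum>k=1..p. (if k =
         0 then 1 else 0) * complex_of_real (A k $ i $ j))) at_infinity"
    by (intro tendsto_intros power_quotient_tendsto) auto
  also have "(if (0::nat) = 0 then 1 else 0) * (if i = j then 1 else 0) + (\<Sum>k=1..p. (if k =
      0 then 1 else 0) * complex_of_real (A k $ i $ j)) = (mat 1 :: complex^'d^'d) $ i $ j"
    by (simp add: mat_def)
  finally show ?thesis unfolding ar_poly_nth add_divide_distrib sum_divide_distrib times_divide_eq_left diff_zero .
qed

lemma ma_poly_scaled_tendsto:
  "((\<lambda>z. ma_poly q B z $ i $ j / z ^ q) \<longlongrightarrow> of_real (B 0 $ i $ j)) at_infinity"
proof -
  have "((\<lambda>z. \<Sum>k=0..q. z ^ (q - k) / z ^ q * complex_of_real (B k $ i $ j))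
     \<longlongrightarrow> (\<Sum>k=0..q. (if k = 0 then 1 else 0) * complex_of_real (B k $ i $ j))) at_infinity"
    by (intro tendsto_intros power_quotient_tendsto) auto
  also have "(\<Sum>k=0..q. (if k = 0 then 1 else 0) * complex_of_real (B k $ i $ j)) = of_real (B 0 $ i $ j)"
    by (simp add: if_distrib[of "\<lambda>x. x * _"] cong: if_cong)
  finally show ?thesis unfolding ma_poly_nth sum_divide_distrib times_divide_eq_left .
qed

text \<open>Cramer's rule for the rescaled system \<open>(P / z^p) (z^(p - q) F) = Q / z^q\<close> yields the decay
  rate of \<open>F = P^-1 Q\<close> without any degree count of the numerators.\<close>

lemma transfer_scaled_tendsto:
  assumes "q \<le> p" and ev: "eventually (\<lambda>z. det (ar_poly p A z) \<noteq> 0) at_infinity"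
  shows "\<exists>l. ((\<lambda>z. z ^ (p - q) * transfer p q A B z $ k $ j) \<longlongrightarrow> l) at_infinity"
proof -
  define X where "X z = (\<chi> i l. ar_poly p A z $ i $ l / z ^ p)" for z
  define Y where "Y z = (\<chi> i l. ma_poly q B z $ i $ l / z ^ q)" for z
  have X: "((\<lambda>z. det (X z)) \<longlongrightarrow> det (mat 1 :: complex^'a^'a)) at_infinity"
    by (rule tendsto_det) (simp add: X_def ar_poly_scaled_tendsto)
  have evX: "eventually (\<lambda>z. det (X z) \<noteq> 0) at_infinity"
    using tendsto_imp_eventually_ne[OF X] by (simp add: det_I)
  have ev0: "eventually (\<lambda>z::complex. z \<noteq> 0) at_infinity"
    unfolding eventually_at_infinity by (intro exI[of _ 1]) auto
  have "((\<lambda>z. det (\<chi> i l. if l = k then Y z $ i $ j else X z $ i $ l)) \<longlongrightarrow>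
      det (\<chi> i l. if l = k then of_real (B 0 $ i $ j) else (mat 1 :: complex^'a^'a) $ i $ l)) at_infinity"
    by (rule tendsto_det) (simp add: X_def Y_def ar_poly_scaled_tendsto ma_poly_scaled_tendsto)
  then have "((\<lambda>z. det (\<chi> i l. if l = k then Y z $ i $ j else X z $ i $ l) / det (X z)) \<longlongrightarrow>
      det (\<chi> i l. if l = k then of_real (B 0 $ i $ j) else (mat 1 :: complex^'a^'a) $ i $ l) / det (mat 1 :: complex^'a^'a)) at_infinity"
    by (intro tendsto_divide X) (auto simp: det_I)
  moreover have "eventually (\<lambda>z. det (\<chi> i l. if l = k then Y z $ i $ j else X z $ i $ l) / det (X z) =
      z ^ (p - q) * transfer p q A B z $ k $ j) at_infinity"
    using ev evX ev0
  proof eventually_elim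
    case (elim z)
    have "X z ** (\<chi> l j. z ^ (p - q) * transfer p q A B z $ l $ j) = Y z"
    proof -
      have "(\<Sum>l\<in>UNIV. ar_poly p A z $ i $ l / z ^ p * (z ^ (p - q) * transfer p q A B z $ l $ j)) = ma_poly q B z $ i $ j / z ^ q" for i j
      proof -
        have "z ^ p = z ^ (p - q) * z ^ q" using assms(1) by (simp flip: power_add)
        then have "(\<Sum>l\<in>UNIV. ar_poly p A z $ i $ l / z ^ p * (z ^ (p - q) * transfer p q A B z $ l $ j)) =
          (\<Sum>l\<in>UNIV. ar_poly p A z $ i $ l * transfer p q A B z $ l $ j) / z ^ q"
          unfolding sum_divide_distrib using elim by (intro sum.cong refl) (simp add: divide_simps)
        also have "(\<Sum>l\<in>UNIV. ar_poly p A z $ i $ l * transfer p q A B z $ l $ j) = (ar_poly p A z ** transfer p q A B z) $ i $ j"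
          by (simp add: matrix_matrix_mult_def)
        finally show ?thesis unfolding transfer_solves[OF elim(1)] .
      qed
      then show ?thesis by (simp add: vec_eq_iff matrix_matrix_mult_def X_def Y_def)
    qed
    from cramer_entry[OF elim(2) this, of k j]
    show ?case by simp
  qed
  ultimately show ?thesis by (blast intro: Lim_transform_eventually)
qed

lemma R_fun_nth:
  "R_fun p q A B S z $ i $ j = (\<Sum>k\<in>UNIV. \<Sum>l\<in>UNIV. of_real (S $ k $ l) * (transfer p q A B z $ i $ k *
      transfer p q A B (- z) $ j $ l))"
proof -
  have "R_fun p q A B S z = transfer p q A B z ** cmat S ** transpose (transfer p q A B (- z))"
    by (simp add: R_fun_def transfer_def matrix_transpose_mul matrix_mul_assoc)
  then have "R_fun p q A B S z $ i $ j = (\<Sum>l\<in>UNIV. (\<Sum>k\<in>UNIV. transfer p q A B z $ i $ k * of_real (S $ k $ l)) *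
      transfer p q A B (- z) $ j $ l)"
    by (simp add: matrix_matrix_mult_def transpose_def)
  also have "\<dots> = (\<Sum>l\<in>UNIV. \<Sum>k\<in>UNIV. of_real (S $ k $ l) * (transfer p q A B z $ i $ k * transfer p q A B (- z) $ j $ l))"
    unfolding sum_distrib_right by (simp only: mult_ac)
  also have "\<dots> = (\<Sum>k\<in>UNIV. \<Sum>l\<in>UNIV. of_real (S $ k $ l) * (transfer p q A B z $ i $ k * transfer p q A B (- z) $ j $ l))"
    by (rule sum.swap)
  finally show ?thesis .
qed

lemma R_fun_scaled_tendsto:
  assumes "q \<le> p" and ev: "eventually (\<lambda>z. det (ar_poly p A z) \<noteq> 0) at_infinity"
  shows "\<exists>l. ((\<lambda>z. z ^ (2 * (p - q)) * R_fun p q A B S z $ i $ j) \<longlongrightarrow> l) at_infinity"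
proof -
  obtain l where l: "\<And>k j. ((\<lambda>z. z ^ (p - q) * transfer p q A B z $ k $ j) \<longlongrightarrow> l k j) at_infinity"
    using transfer_scaled_tendsto[OF assms] by metis
  have l': "((\<lambda>z. (- z) ^ (p - q) * transfer p q A B (- z) $ k $ j) \<longlongrightarrow> l k j) at_infinity" for k j
    using filterlim_at_infinity_imp_norm_at_top[OF filterlim_ident]
    by (intro filterlim_compose[OF l]) (simp add: filterlim_at_infinity_conv_norm_at_top)
  have "((\<lambda>z. (-1) ^ (p - q) * (\<Sum>k\<in>UNIV. \<Sum>l\<in>UNIV. of_real (S $ k $ l) * ((z ^ (p - q) * transfer p q A B z $ i $ k) *
      ((- z) ^ (p - q) * transfer p q A B (- z) $ j $ l))))
      \<longlongrightarrow> (-1) ^ (p - q) * (\<Sum>k\<in>UNIV. \<Sum>m\<in>UNIV. of_real (S $ k $ m) * (l i k * l j m))) at_infinity"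
    by (intro tendsto_intros l l')
  moreover have "(-1) ^ (p - q) * (\<Sum>k\<in>UNIV. \<Sum>l\<in>UNIV. of_real (S $ k $ l) * ((z ^ (p - q) * transfer p q A B z $ i $ k) *
      ((- z) ^ (p - q) * transfer p q A B (- z) $ j $ l)))
     = z ^ (2 * (p - q)) * R_fun p q A B S z $ i $ j" for z
  proof -
    have sgn: "(-1) ^ (p - q) * (- z) ^ (p - q) = z ^ (p - q)" by (simp flip: power_mult_distrib)
    have ac: "c * (s * ((w * x) * (v * y))) = (w * (c * v)) * (s * (x * y))" for c s w x v y :: complex
      by (simp only: mult_ac)
    have "(-1) ^ (p - q) * (of_real (S $ k $ l) * ((z ^ (p - q) * transfer p q A B z $ i $ k) * ((- z) ^ (p - q) * transfer p q A B (- z) $ j $ l)))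
      = z ^ (2 * (p - q)) * (of_real (S $ k $ l) * (transfer p q A B z $ i $ k * transfer p q A B (- z) $ j $ l))" for k l
      unfolding ac sgn mult_2 power_add ..
    then show ?thesis unfolding R_fun_nth by (simp only: sum_distrib_left)
  qed
  ultimately show ?thesis by (auto simp only:)
qed

section \<open>The kernel and its correlations\<close>

definition pf_sum :: "complex set \<Rightarrow> nat \<Rightarrow> (complex \<Rightarrow> nat \<Rightarrow> complex)
    \<Rightarrow> complex \<Rightarrow> complex"
  where "pf_sum Z K c z = (\<Sum>a\<in>Z. \<Sum>m<K. c a m / (z - a) ^ Suc m)"

definition ar_zeros :: "nat \<Rightarrow> (nat \<Rightarrow> real^'d^'d) \<Rightarrow> complex set"
  where "ar_zeros p A = {z. det (ar_poly p A z) = 0}"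

lemma det_ar_poly_nonzero_polynomial:
  assumes "\<And>z. z \<in> ar_zeros p A \<Longrightarrow> Re z < 0"
  obtains D where "D \<noteq> 0" "\<And>z. det (ar_poly p A z) = poly D z"
proof -
  obtain D where D: "\<And>z. det (ar_poly p A z) = poly D z" using det_ar_poly_polynomial by metis
  have "poly D 0 \<noteq> 0" using assms[of 0] D by (auto simp: ar_zeros_def)
  then have "D \<noteq> 0" by auto
  then show thesis using D that by blast
qed

lemma finite_ar_zeros:
  assumes "\<And>z. z \<in> ar_zeros p A \<Longrightarrow> Re z < 0"
  shows "finite (ar_zeros p A)"
proof -
  obtain D where "D \<noteq> 0" "\<And>z. det (ar_poly p A z) = poly D z"
    using det_ar_poly_nonzero_polynomial[OF assms] by blast
  then show ?thesis using poly_roots_finite[of D] by (simp add: ar_zeros_def)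
qed

lemma eventually_ar_nonzero:
  assumes "\<And>z. z \<in> ar_zeros p A \<Longrightarrow> Re z < 0"
  shows "eventually (\<lambda>z. det (ar_poly p A z) \<noteq> 0) at_infinity"
  using eventually_notin_finite_at_infinity[OF finite_ar_zeros[OF assms]] by (simp add: ar_zeros_def)

lemma decay_of_scaled_tendsto:
  fixes f :: "complex \<Rightarrow> complex"
  assumes "((\<lambda>z. z ^ n * f z) \<longlongrightarrow> l) at_infinity" "k < n"
  shows "((\<lambda>z. z ^ k * f z) \<longlongrightarrow> 0) at_infinity"
proof -
  have "((\<lambda>z. inverse (z ^ (n - k)) * (z ^ n * f z)) \<longlongrightarrow> 0 * l) at_infinity"
    by (intro tendsto_mult assms(1) filterlim_compose[OF tendsto_inverse_0] filterlim_power_at_infinity filterlim_ident)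
       (use assms(2) in auto)
  moreover have "eventually (\<lambda>z::complex. z \<notin> {0}) at_infinity"
    by (intro eventually_notin_finite_at_infinity) simp
  then have "eventually (\<lambda>z. inverse (z ^ (n - k)) * (z ^ n * f z) = z ^ k * f z) at_infinity"
  proof eventually_elim
    case (elim z)
    have "z ^ n = z ^ (n - k) * z ^ k" using assms(2) by (simp flip: power_add)
    then show ?case using elim by simp
  qed
  ultimately show ?thesis by (simp add: tendsto_cong)
qed

lemma rational_pf_sum:
  fixes N D :: "complex poly"
  assumes "D \<noteq> 0" "((\<lambda>z. f z) \<longlongrightarrow> 0) at_infinity" "\<And>z. poly D z \<noteq> 0 \<Longrightarrow> f z =
      poly N z / poly D z"
  shows "\<exists>c. \<forall>z. poly D z \<noteq> 0 \<longrightarrow> f z = pf_sum {a. poly D a = 0} (degree D) c z"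
proof -
  have "eventually (\<lambda>z. f z = poly N z / poly D z) at_infinity"
    by (rule eventually_mono[OF eventually_notin_finite_at_infinity[OF poly_roots_finite[OF assms(1)]]])
       (simp add: assms(3))
  with assms(2) have "((\<lambda>z. poly N z / poly D z) \<longlongrightarrow> 0) at_infinity" by (rule Lim_transform_eventually)
  from partial_fractions[OF assms(1) poly_divide_decay_degree[OF assms(1) this]]
  obtain c where "\<And>z. poly D z \<noteq> 0 \<Longrightarrow> poly N z / poly D z = pf_sum {a. poly D a = 0} (degree D) c z"
    unfolding pf_sum_def by blast
  then show ?thesis by (intro exI[of _ c]) (simp add: assms(3))
qed

lemma transfer_pf:
  assumes qp: "q < p" and st: "\<And>z. z \<in> ar_zeros p A \<Longrightarrow> Re z < 0"
  shows "\<exists>K c. \<forall>z i j. z \<notin> ar_zeros p A \<longrightarrow> transfer p q A B z $ i $ j = pf_sum (ar_zeros p A) K (c i j) z"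
proof -
  obtain D where D: "D \<noteq> 0" "\<And>z. det (ar_poly p A z) = poly D z"
    using det_ar_poly_nonzero_polynomial[OF st] by blast
  have Z: "{a. poly D a = 0} = ar_zeros p A" by (simp add: ar_zeros_def D)
  have "\<exists>c. \<forall>z. poly D z \<noteq> 0 \<longrightarrow> transfer p q A B z $ i $ j = pf_sum {a. poly D a = 0} (degree D) c z" for i j
  proof -
    obtain N where N: "\<And>z. det (ar_poly p A z) \<noteq> 0 \<Longrightarrow> transfer p q A B z $ i $ j = poly N z / det (ar_poly p A z)"
      using transfer_rational by blast
    obtain l where "((\<lambda>z. z ^ (p - q) * transfer p q A B z $ i $ j) \<longlongrightarrow> l) at_infinity"
      using transfer_scaled_tendsto[OF less_imp_le[OF qp] eventually_ar_nonzero[OF st]] by blast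
    from decay_of_scaled_tendsto[OF this, of 0] qp
    have "((\<lambda>z. transfer p q A B z $ i $ j) \<longlongrightarrow> 0) at_infinity" by simp
    from rational_pf_sum[OF D(1) this] N show ?thesis unfolding D(2) by blast
  qed
  then have "\<forall>i j. \<exists>c. \<forall>z. poly D z \<noteq> 0 \<longrightarrow> transfer p q A B z $ i $ j = pf_sum {a. poly D a =
      0} (degree D) c z" by blast
  then obtain c where "\<forall>i j z. poly D z \<noteq> 0 \<longrightarrow> transfer p q A B z $ i $ j = pf_sum {a. poly D a =
      0} (degree D) (c i j) z"
    unfolding choice_iff by blast
  then show ?thesis unfolding Z[symmetric] by (intro exI[of _ "degree D"] exI[of _ c]) blast
qed

lemma R_fun_pf:
  assumes qp: "q < p" and st: "\<And>z. z \<in> ar_zeros p A \<Longrightarrow> Re z < 0"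
  shows "\<exists>K r. \<forall>z i j. z \<notin> ar_zeros p A \<union> uminus ` ar_zeros p A \<longrightarrow>
     R_fun p q A B S z $ i $ j = pf_sum (ar_zeros p A \<union> uminus ` ar_zeros p A) K (r i j) z"
proof -
  obtain D where D: "D \<noteq> 0" "\<And>z. det (ar_poly p A z) = poly D z"
    using det_ar_poly_nonzero_polynomial[OF st] by blast
  define D' where "D' = D * pcompose D [:0, -1:]"
  have D': "poly D' z = poly D z * poly D (- z)" for z by (simp add: D'_def poly_pcompose)
  have "poly D' 0 \<noteq> 0" using D st[of 0] by (auto simp: D' ar_zeros_def)
  then have D'0: "D' \<noteq> 0" by auto
  have Z: "{a. poly D' a = 0} = ar_zeros p A \<union> uminus ` ar_zeros p A"
    by (force simp: ar_zeros_def D D' image_iff)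
  have "\<exists>c. \<forall>z. poly D' z \<noteq> 0 \<longrightarrow> R_fun p q A B S z $ i $ j = pf_sum {a. poly D' a = 0} (degree D') c z" for i j
  proof -
    obtain N where N: "\<And>i j z. poly D z \<noteq> 0 \<Longrightarrow> transfer p q A B z $ i $ j = poly (N i j) z / poly D z"
      using transfer_rational[of p A q B] unfolding D(2) by metis
    obtain l where "((\<lambda>z. z ^ (2 * (p - q)) * R_fun p q A B S z $ i $ j) \<longlongrightarrow> l) at_infinity"
      using R_fun_scaled_tendsto[OF less_imp_le[OF qp] eventually_ar_nonzero[OF st]] by blast
    from decay_of_scaled_tendsto[OF this, of 0] qp
    have lim: "((\<lambda>z. R_fun p q A B S z $ i $ j) \<longlongrightarrow> 0) at_infinity" by simp
    define M where "M = (\<Sum>k\<in>UNIV. \<Sum>l\<in>UNIV. smult (of_real (S $ k $ l)) (N i k * pcompose (N j l) [:0, -1:]))"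
    show ?thesis
    proof (rule rational_pf_sum[OF D'0 lim])
      fix z assume "poly D' z \<noteq> 0"
      then have z: "poly D z \<noteq> 0" "poly D (- z) \<noteq> 0" by (auto simp: D')
      show "R_fun p q A B S z $ i $ j = poly M z / poly D' z"
        unfolding R_fun_nth N[OF z(1)] N[OF z(2)] D' M_def poly_sum sum_divide_distrib
        by (simp add: poly_pcompose)
    qed
  qed
  then have "\<forall>i j. \<exists>c. \<forall>z. poly D' z \<noteq> 0 \<longrightarrow> R_fun p q A B S z $ i $ j = pf_sum {a. poly D' a =
      0} (degree D') c z" by blast
  then obtain c where "\<forall>i j z. poly D' z \<noteq> 0 \<longrightarrow> R_fun p q A B S z $ i $ j = pf_sum {a. poly D' a =
      0} (degree D') (c i j) z"
    unfolding choice_iff by blast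
  then show ?thesis unfolding Z[symmetric] by (intro exI[of _ "degree D'"] exI[of _ c]) blast
qed

locale carma =
  fixes p q :: nat and A B :: "nat \<Rightarrow> real^'d^'d" and K :: nat and c :: "'d \<Rightarrow> 'd \<Rightarrow> complex \<Rightarrow> nat
      \<Rightarrow> complex"
  assumes st: "\<And>z. z \<in> ar_zeros p A \<Longrightarrow> Re z < 0"
    and pf: "\<And>z i j. z \<notin> ar_zeros p A \<Longrightarrow> transfer p q A B z $ i $ j = pf_sum (ar_zeros p A) K (c i j) z"
begin

abbreviation "Z \<equiv> ar_zeros p A"

lemma finite_Z: "finite Z" by (rule finite_ar_zeros[OF st])

definition kern :: "'d \<Rightarrow> 'd \<Rightarrow> real \<Rightarrow> complex"
  where "kern i j t = (\<Sum>a\<in>Z. \<Sum>m<K. c i j a m * exp_monom a m t)"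

lemma kern_measurable [measurable]: "kern i j \<in> borel_measurable borel"
  unfolding kern_def[abs_def] by measurable

lemma mcarma_kernel_eq:
  assumes t: "t > 0"
  shows "complex_of_real (mcarma_kernel p q A B t $ i $ j) = kern i j t" and "complex_of_real (Re (kern i j t)) = kern i j t"
proof -
  define f where "f x = exp (\<i> * of_real t * of_real x) * transfer p q A B (\<i> * of_real x) $ i $ j" for x :: real
  define I where "I T = integral {-T..T} f" for T
  have nz: "\<i> * of_real x \<notin> Z" for x using st[of "\<i> * of_real x"] by auto
  have na: "\<i> * of_real x - a \<noteq> 0" if "a \<in> Z" for a x using nz[of x] that by auto
  have f: "f x = (\<Sum>a\<in>Z. \<Sum>m<K. c i j a m * (exp (\<i> * of_real t * of_real x) / (\<i> * of_real x - a) ^ Suc m))" for x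
    unfolding f_def pf[OF nz] pf_sum_def sum_distrib_left by (simp only: times_divide_eq_right mult.commute)
  have int: "(\<lambda>x. c i j a m * (exp (\<i> * of_real t * of_real x) / (\<i> * of_real x - a) ^ Suc m)) integrable_on {-T..T}"
      if "a \<in> Z" for a m T
    by (intro integrable_continuous_real continuous_intros) (use na[OF that] in auto)
  have I: "I T = (\<Sum>a\<in>Z. \<Sum>m<K. c i j a m * integral {-T..T} (\<lambda>x. exp (\<i> * of_real t * of_real x) / (\<i> *
      of_real x - a) ^ Suc m))" for T
  proof -
    let ?g = "\<lambda>a m x. c i j a m * (exp (\<i> * of_real t * of_real x) / (\<i> * of_real x - a) ^ Suc m)"
    have "I T = (\<Sum>a\<in>Z. integral {-T..T} (\<lambda>x. \<Sum>m<K. ?g a m x))"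
      unfolding I_def f by (rule Henstock_Kurzweil_Integration.integral_sum[OF finite_Z Henstock_Kurzweil_Integration.integrable_sum[OF
          finite_lessThan int]])
    also have "\<dots> = (\<Sum>a\<in>Z. \<Sum>m<K. integral {-T..T} (?g a m))"
      by (intro sum.cong refl Henstock_Kurzweil_Integration.integral_sum[OF finite_lessThan int])
    also have "\<dots> = (\<Sum>a\<in>Z. \<Sum>m<K. c i j a m * integral {-T..T} (\<lambda>x. exp (\<i> * of_real t * of_real x) / (\<i> *
        of_real x - a) ^ Suc m))"
      by (simp only: Henstock_Kurzweil_Integration.integral_mult_right)
    finally show ?thesis .
  qed
  have "(I \<longlongrightarrow> (\<Sum>a\<in>Z. \<Sum>m<K. c i j a m * (2 * pi * exp_monom a m t))) at_top"
    unfolding I by (intro tendsto_sum tendsto_mult tendsto_const exp_kernel_limit t st)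
  also have "(\<Sum>a\<in>Z. \<Sum>m<K. c i j a m * (2 * pi * exp_monom a m t)) = 2 * pi * kern i j t"
    by (simp add: kern_def sum_distrib_left mult_ac)
  finally have lim: "(I \<longlongrightarrow> 2 * pi * kern i j t) at_top" .
  have "cnj (I T) = I T" for T
  proof -
    have "cnj (f x) = f (- x)" for x
    proof -
      have "det (ar_poly p A (\<i> * of_real x)) \<noteq> 0" using nz[of x] by (simp add: ar_zeros_def)
      from transfer_cnj[OF this] show ?thesis by (simp add: f_def exp_cnj)
    qed
    then have "cnj (I T) = integral {-T..T} (\<lambda>x. f (- x))" by (simp add: I_def integral_cnj)
    also have "\<dots> = I T" unfolding I_def using Henstock_Kurzweil_Integration.integral_reflect_real[of T "- T" f] by simp
    finally show ?thesis .
  qed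
  then have l1: "((\<lambda>T. cnj (I T)) \<longlongrightarrow> 2 * pi * kern i j t) at_top" using lim by simp
  have l2: "((\<lambda>T. cnj (I T)) \<longlongrightarrow> cnj (2 * pi * kern i j t)) at_top" by (intro tendsto_cnj lim)
  have "cnj (2 * pi * kern i j t) = 2 * pi * kern i j t"
    by (rule tendsto_unique[OF trivial_limit_at_top_linorder l2 l1])
  then have "cnj (kern i j t) = kern i j t" by simp
  then show re: "complex_of_real (Re (kern i j t)) = kern i j t" by (simp add: complex_eq_iff)
  have "Lim at_top I = 2 * pi * kern i j t" by (rule tendsto_Lim[OF _ lim]) simp
  then have "mcarma_kernel p q A B t $ i $ j = Re (kern i j t)"
    by (simp add: mcarma_kernel_def I_def[abs_def] f_def[abs_def] transfer_def)
  then show "complex_of_real (mcarma_kernel p q A B t $ i $ j) = kern i j t" using re by simp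
qed

lemma pf_holomorphic: "(\<lambda>z. pf_sum Z K (c i j) (- z)) holomorphic_on {z. Re z < 0}"
proof -
  have "- z - a \<noteq> 0" if "Re z < 0" "a \<in> Z" for z a
  proof
    assume "- z - a = 0"
    then have "Re (- z - a) = 0" by simp
    then show False using that st[of a] by simp
  qed
  then show ?thesis unfolding pf_sum_def by (intro holomorphic_intros) auto
qed

abbreviation cross :: "(complex \<Rightarrow> complex) \<Rightarrow> 'd \<Rightarrow> 'd \<Rightarrow> 'd \<Rightarrow> 'd \<Rightarrow> complex"
  where "cross f i k j l \<equiv> pairing Z K (c i k) (\<lambda>z. f z * pf_sum Z K (c j l) (- z))"

lemma kern_correlation:
  assumes t: "t \<ge> 0"
  shows "complex_of_real (\<integral>v. indicator {0<..} v * (Re (kern i k (t + v)) * Re (kern j l v)) \<partial>lborel) =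
     cross (\<lambda>z. exp (of_real t * z)) i k j l"
proof -
  let ?e = "\<lambda>a m b n v. indicator {0<..} v *\<^sub>R (exp_monom a m (t + v) * exp_monom b n v)"
  let ?T = "\<lambda>a m b n. taylor_coeff (\<lambda>z. exp (of_real t * z) * (1 / (- z - b) ^ Suc n)) a m"
  have e: "has_bochner_integral lborel (?e a m b n) (?T a m b n)" if "a \<in> Z" "b \<in> Z" for a m b n
    using exp_monom_shift_integral[OF st[OF that(1)] st[OF that(2)], of m t n]
    unfolding has_bochner_integral_iff set_integrable_def set_lebesgue_integral_def by blast
  have "has_bochner_integral lborel (\<lambda>v. \<Sum>a\<in>Z. \<Sum>m<K. \<Sum>b\<in>Z. \<Sum>n<K. (c i k a m * c j l b n) * ?e a m b n v)
     (\<Sum>a\<in>Z. \<Sum>m<K. \<Sum>b\<in>Z. \<Sum>n<K. (c i k a m * c j l b n) * ?T a m b n)"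
    by (intro has_bochner_integral_sum has_bochner_integral_mult_right e)
  moreover have "(\<Sum>a\<in>Z. \<Sum>m<K. \<Sum>b\<in>Z. \<Sum>n<K. (c i k a m * c j l b n) * ?e a m b n v)
      = complex_of_real (indicator {0<..} v * (Re (kern i k (t + v)) * Re (kern j l v)))" for v
  proof (cases "v > 0")
    case True
    have "(\<Sum>a\<in>Z. \<Sum>m<K. \<Sum>b\<in>Z. \<Sum>n<K. (c i k a m * c j l b n) * (exp_monom a m (t + v) * exp_monom b n v)) =
        kern i k (t + v) * kern j l v"
      unfolding kern_def sum_distrib_right unfolding sum_distrib_left by (simp only: mult_ac)
    also have "\<dots> = complex_of_real (Re (kern i k (t + v))) * complex_of_real (Re (kern j l v))"
      using mcarma_kernel_eq(2) True t by simp
    finally show ?thesis using True by simp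
  qed simp
  ultimately have 1: "has_bochner_integral lborel (\<lambda>v. complex_of_real (indicator {0<..} v * (Re (kern i k (t + v)) * Re (kern j l v))))
     (\<Sum>a\<in>Z. \<Sum>m<K. \<Sum>b\<in>Z. \<Sum>n<K. (c i k a m * c j l b n) * ?T a m b n)" by simp
  have nz: "- z - b \<noteq> 0" if "Re z < 0" "b \<in> Z" for z b
  proof
    assume "- z - b = 0"
    then have "Re (- z - b) = 0" by simp
    then show False using that st[of b] by simp
  qed
  have 2: "(\<Sum>b\<in>Z. \<Sum>n<K. c j l b n * ?T a m b n) =
      taylor_coeff (\<lambda>z. exp (of_real t * z) * pf_sum Z K (c j l) (- z)) a m" if "a \<in> Z" for a m
  proof -
    have a: "a \<in> {z. Re z < 0}" and op: "open {z. Re z < 0}" using st[OF that] open_halfspace_Re_lt by auto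
    have hol: "(\<lambda>z. exp (of_real t * z) * (1 / (- z - b) ^ Suc n)) holomorphic_on {z. Re z < 0}" if "b \<in> Z" for b n
      by (intro holomorphic_intros) (use nz that in auto)
    have "taylor_coeff (\<lambda>z. exp (of_real t * z) * pf_sum Z K (c j l) (- z)) a m =
       taylor_coeff (\<lambda>z. \<Sum>b\<in>Z. \<Sum>n<K. c j l b n * (exp (of_real t * z) * (1 / (- z - b) ^ Suc n))) a m"
      unfolding pf_sum_def sum_distrib_left by (simp add: mult_ac del: power_Suc)
    also have "\<dots> = (\<Sum>b\<in>Z. taylor_coeff (\<lambda>z. \<Sum>n<K. c j l b n * (exp (of_real t * z) * (1 / (- z - b) ^ Suc n))) a m)"
      by (rule taylor_coeff_sum[OF _ op a]) (intro holomorphic_on_sum holomorphic_on_mult holomorphic_on_const hol)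
    also have "\<dots> = (\<Sum>b\<in>Z. \<Sum>n<K. taylor_coeff (\<lambda>z. c j l b n * (exp (of_real t * z) * (1 / (- z - b) ^ Suc n))) a m)"
      by (intro sum.cong refl taylor_coeff_sum[OF _ op a] holomorphic_on_mult holomorphic_on_const hol)
    also have "\<dots> = (\<Sum>b\<in>Z. \<Sum>n<K. c j l b n * ?T a m b n)"
      by (intro sum.cong refl taylor_coeff_cmult[OF hol op a])
    finally show ?thesis by (rule sym)
  qed
  have "complex_of_real (\<integral>v. indicator {0<..} v * (Re (kern i k (t + v)) * Re (kern j l v)) \<partial>lborel)
     = (\<integral>v. complex_of_real (indicator {0<..} v * (Re (kern i k (t + v)) * Re (kern j l v))) \<partial>lborel)"
    by (rule integral_complex_of_real[symmetric])
  also have "\<dots> = (\<Sum>a\<in>Z. \<Sum>m<K. \<Sum>b\<in>Z. \<Sum>n<K. (c i k a m * c j l b n) * ?T a m b n)"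
    by (rule has_bochner_integral_integral_eq[OF 1])
  also have "\<dots> = (\<Sum>a\<in>Z. \<Sum>m<K. c i k a m * (\<Sum>b\<in>Z. \<Sum>n<K. c j l b n * ?T a m b n))"
    unfolding sum_distrib_left by (simp only: mult.assoc)
  also have "\<dots> = cross (\<lambda>z. exp (of_real t * z)) i k j l"
    by (intro sum.cong refl arg_cong2[where f="(*)"] 2)
  finally show ?thesis .
qed

end

section \<open>Autocovariances as sums of residues\<close>

locale mcarma = levy_two_sided M L1 L2 L + carma p q A B K c
  for M :: "'w measure" and L1 L2 L :: "real \<Rightarrow> 'w \<Rightarrow> real^'d" and p q A B K and c :: "'d \<Rightarrow> 'd \<Rightarrow>
      complex \<Rightarrow> nat \<Rightarrow> complex" +
  fixes Y :: "real \<Rightarrow> 'w \<Rightarrow> real^'d"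
  assumes Y: "mcarma_process M L p q A B Y"
begin

abbreviation cov_sum :: "('d \<Rightarrow> 'd \<Rightarrow> complex) \<Rightarrow> complex"
  where "cov_sum f \<equiv> \<Sum>k\<in>UNIV. \<Sum>l\<in>UNIV. of_real (S $ k $ l) * f k l"

abbreviation "g \<equiv> mcarma_kernel p q A B"

abbreviation h :: "real \<Rightarrow> real \<Rightarrow> real^'d^'d"
  where "h t \<equiv> (\<lambda>s. if s \<le> t then g (t - s) else 0)"

lemma Y_integral: "is_L2_integral M L (h t) (Y t)"
  using Y by (simp add: mcarma_process_def)

lemma h_measurable: "(\<lambda>s. h t s $ i $ k) \<in> borel_measurable borel"
proof -
  have "h t \<in> borel_measurable borel" using Y_integral[of t] by (simp add: is_L2_integral_def)
  then show ?thesis by (intro borel_measurable_vec_nth)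
qed

lemma kernel_correlation:
  assumes "t \<ge> 0"
  shows "(\<integral>u. h t u $ i $ k * h 0 u $ j $ l \<partial>lborel) =
      (\<integral>v. indicator {0<..} v * (Re (kern i k (t + v)) * Re (kern j l v)) \<partial>lborel)"
    and "(\<integral>u. h (- t) u $ i $ k * h 0 u $ j $ l \<partial>lborel) =
        (\<integral>v. indicator {0<..} v * (Re (kern j l (t + v)) * Re (kern i k v)) \<partial>lborel)"
proof -
  have g: "g s $ i $ k = Re (kern i k s)" if "s > 0" for s i k
    using mcarma_kernel_eq(1)[OF that, of i k] by (metis Re_complex_of_real)
  have refl0: "(\<integral>u. F u \<partial>lborel) = (\<integral>v. F (- v) \<partial>lborel)" for F :: "real \<Rightarrow> real"
    using lborel_integral_real_affine[of "-1" F 0] by simp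
  have reflt: "(\<integral>u. F u \<partial>lborel) = (\<integral>v. F (- t - v) \<partial>lborel)" for F :: "real \<Rightarrow> real"
    using lborel_integral_real_affine[of "-1" F "- t"] by simp
  have "(\<integral>u. h t u $ i $ k * h 0 u $ j $ l \<partial>lborel) = (\<integral>v. h t (- v) $ i $ k * h 0 (- v) $ j $ l \<partial>lborel)"
    by (rule refl0[of "\<lambda>u. h t u $ i $ k * h 0 u $ j $ l"])
  also have "\<dots> = (\<integral>v. indicator {0<..} v * (Re (kern i k (t + v)) * Re (kern j l v)) \<partial>lborel)"
  proof (rule integral_cong_AE)
    have e: "h t (- v) $ i $ k * h 0 (- v) $ j $ l = indicator {0<..} v * (Re (kern i k (t + v)) * Re (kern j l v))" if "v \<noteq> 0" for v
      using that assms g[of "t + v" i k] g[of v j l] by (cases "v > 0") auto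
    show "AE v in lborel. h t (- v) $ i $ k * h 0 (- v) $ j $ l = indicator {0<..} v * (Re (kern i k (t + v)) * Re (kern j l v))"
      by (rule eventually_mono[OF AE_lborel_singleton[of 0]]) (rule e)
    show "(\<lambda>v. h t (- v) $ i $ k * h 0 (- v) $ j $ l) \<in> borel_measurable lborel"
      by (rule borel_measurable_times[OF measurable_compose[OF _ h_measurable] measurable_compose[OF _ h_measurable]]) measurable
  qed simp
  finally show "(\<integral>u. h t u $ i $ k * h 0 u $ j $ l \<partial>lborel) =
      (\<integral>v. indicator {0<..} v * (Re (kern i k (t + v)) * Re (kern j l v)) \<partial>lborel)" .
  have "(\<integral>u. h (- t) u $ i $ k * h 0 u $ j $ l \<partial>lborel) =
      (\<integral>v. h (- t) (- t - v) $ i $ k * h 0 (- t - v) $ j $ l \<partial>lborel)"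
    by (rule reflt[of "\<lambda>u. h (- t) u $ i $ k * h 0 u $ j $ l"])
  also have "\<dots> = (\<integral>v. indicator {0<..} v * (Re (kern j l (t + v)) * Re (kern i k v)) \<partial>lborel)"
  proof (rule integral_cong_AE)
    have e: "h (- t) (- t - v) $ i $ k * h 0 (- t - v) $ j $ l = indicator {0<..} v * (Re (kern j l (t + v)) * Re (kern i k v))"
        if "v \<noteq> 0" for v
      using that assms g[of "t + v" j l] g[of v i k] by (cases "v > 0") (auto simp: add.commute)
    show "AE v in lborel. h (- t) (- t - v) $ i $ k * h 0 (- t - v) $ j $ l = indicator {0<..} v * (Re (kern j l (t + v)) * Re (kern i k v))"
      by (rule eventually_mono[OF AE_lborel_singleton[of 0]]) (rule e)
    show "(\<lambda>v. h (- t) (- t - v) $ i $ k * h 0 (- t - v) $ j $ l) \<in> borel_measurable lborel"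
      by (rule borel_measurable_times[OF measurable_compose[OF _ h_measurable] measurable_compose[OF _ h_measurable]]) measurable
  qed simp
  finally show "(\<integral>u. h (- t) u $ i $ k * h 0 u $ j $ l \<partial>lborel) =
      (\<integral>v. indicator {0<..} v * (Re (kern j l (t + v)) * Re (kern i k v)) \<partial>lborel)" .
qed

lemma autocov_eq:
  assumes t: "t \<ge> 0"
  shows "complex_of_real (autocov M Y t $ i $ j) = cov_sum (\<lambda>k l. cross (\<lambda>z. exp (of_real t * z)) i k j l)"
    and "complex_of_real (autocov M Y (- t) $ i $ j) = cov_sum (\<lambda>k l. cross (\<lambda>z. exp (of_real t * z)) j l i k)"
proof -
  have A: "autocov M Y s $ i $ j = (\<Sum>k\<in>UNIV. \<Sum>l\<in>UNIV. S $ k $ l * (\<integral>u. h s u $ i $ k *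
      h 0 u $ j $ l \<partial>lborel))" for s
    unfolding autocov_def using L2_integral_cov[OF Y_integral Y_integral, of s i 0 j] by simp
  show "complex_of_real (autocov M Y t $ i $ j) = cov_sum (\<lambda>k l. cross (\<lambda>z. exp (of_real t * z)) i k j l)"
    unfolding A kernel_correlation(1)[OF t] of_real_sum of_real_mult kern_correlation[OF t, unfolded of_real_mult] ..
  show "complex_of_real (autocov M Y (- t) $ i $ j) = cov_sum (\<lambda>k l. cross (\<lambda>z. exp (of_real t * z)) j l i k)"
    unfolding A kernel_correlation(2)[OF t] of_real_sum of_real_mult kern_correlation[OF t, unfolded of_real_mult] ..
qed

end

locale mcarma_contour = mcarma M L1 L2 L p q A B K c Y
  for M :: "'w measure" and L1 L2 L :: "real \<Rightarrow> 'w \<Rightarrow> real^'d" and p q A B K and c :: "'d \<Rightarrow> 'd \<Rightarrow>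
      complex \<Rightarrow> nat \<Rightarrow> complex" and Y +
  fixes \<rho> :: "real \<Rightarrow> complex" and K' :: nat and r :: "'d \<Rightarrow> 'd \<Rightarrow> complex \<Rightarrow> nat \<Rightarrow>
      complex"
  assumes qp: "q < p"
    and \<rho>: "encircles_in_left_half_plane \<rho> (ar_zeros p A)"
    and R_pf: "\<And>z i j. z \<notin> ar_zeros p A \<union> uminus ` ar_zeros p A \<Longrightarrow>
       R_fun p q A B S z $ i $ j = pf_sum (ar_zeros p A \<union> uminus ` ar_zeros p A) K' (r i j) z"
begin

abbreviation "Z' \<equiv> Z \<union> uminus ` Z"
abbreviation "R \<equiv> R_fun p q A B S"
abbreviation "left_res i j \<equiv> pairing (Z' \<inter> {z. Re z < 0}) K' (r i j)"
abbreviation "right_res i j \<equiv> pairing (Z' \<inter> {z. Re z > 0}) K' (r i j)"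

lemma finite_Z': "finite Z'" using finite_Z by simp

lemma Z'_Re: "a \<in> Z' \<Longrightarrow> Re a \<noteq> 0"
  using st by force

lemma Z'_left: "Z' \<inter> {z. Re z < 0} = Z"
  using st by force

lemma path: "valid_path \<rho>" "pathfinish \<rho> =
    pathstart \<rho>" "path_image \<rho> \<subseteq> {z. Re z < 0} - Z" "\<And>a. a \<in> Z \<Longrightarrow> winding_number \<rho> a = 1"
  using \<rho> by (auto simp: encircles_in_left_half_plane_def)

lemma path_Z': "path_image \<rho> \<subseteq> {z. Re z < 0} - Z'"
  using path(3) st by force

lemma off_path: "z \<in> path_image \<rho> \<Longrightarrow> z \<notin> Z'" "z \<in> path_image \<rho> \<Longrightarrow> - z \<notin> Z'"
proof -
  show "z \<in> path_image \<rho> \<Longrightarrow> z \<notin> Z'" using path_Z' by blast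
  moreover have "- z \<in> Z' \<longleftrightarrow> z \<in> Z'" by force
  ultimately show "z \<in> path_image \<rho> \<Longrightarrow> - z \<notin> Z'" by blast
qed

lemma contour_left:
  assumes "f holomorphic_on {z. Re z < 0}"
  shows "((\<lambda>z. f z * R z $ i $ j) has_contour_integral 2 * pi * \<i> * left_res i j f) \<rho>"
proof (rule has_contour_integral_eq)
  show "((\<lambda>z. f z * pf_sum Z' K' (r i j) z) has_contour_integral 2 * pi * \<i> * left_res i j f) \<rho>"
    unfolding pf_sum_def
    by (rule has_contour_integral_partial_fractions[OF convex_halfspace_Re_lt open_halfspace_Re_lt assms path(1,2) path_Z' finite_Z'])
       (use path(4) Z'_left in blast)
  show "f z * pf_sum Z' K' (r i j) z = f z * R z $ i $ j" if "z \<in> path_image \<rho>" for z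
    using R_pf off_path(1)[OF that] by simp
qed

lemma contour_right:
  assumes "f holomorphic_on {z. Re z > 0}"
  shows "((\<lambda>z. f z * R z $ i $ j) has_contour_integral 2 * pi * \<i> * right_res i j f) (\<lambda>t. - \<rho> t)"
proof (rule has_contour_integral_eq)
  have im: "path_image (\<lambda>t. - \<rho> t) = uminus ` path_image \<rho>" by (auto simp: path_image_def)
  show "((\<lambda>z. f z * pf_sum Z' K' (r i j) z) has_contour_integral 2 * pi * \<i> * right_res i j f) (\<lambda>t. - \<rho> t)"
    unfolding pf_sum_def
  proof (rule has_contour_integral_partial_fractions[OF convex_halfspace_Re_gt open_halfspace_Re_gt assms valid_path_uminus[OF path(1)] _ _
      finite_Z'])
    show "pathfinish (\<lambda>t. - \<rho> t) = pathstart (\<lambda>t. - \<rho> t)" using path(2) by (simp add: pathfinish_def pathstart_def)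
    show "path_image (\<lambda>t. - \<rho> t) \<subseteq> {z. Re z > 0} - Z'"
      unfolding im using path_Z' off_path(2) by auto
    fix a assume "a \<in> Z' \<inter> {z. Re z > 0}"
    then have "- a \<in> Z" using st by force
    then show "winding_number (\<lambda>t. - \<rho> t) a = 1"
      using winding_number_uminus_path[OF path(1), of a] path(3) path(4)[of "- a"] by auto
  qed
  show "f z * pf_sum Z' K' (r i j) z = f z * R z $ i $ j" if "z \<in> path_image (\<lambda>t. - \<rho> t)" for z
  proof -
    obtain w where "w \<in> path_image \<rho>" "z = - w" using \<open>z \<in> path_image (\<lambda>t. - \<rho> t)\<close> unfolding im by blast
    then show ?thesis using R_pf off_path(2) by simp
  qed
qed

lemma Theta_eq: "Theta p q A B S \<rho> k $ i $ j = moment Z' K' (r i j) k"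
proof -
  have halves: "left_res i j (\<lambda>z. z ^ k) + right_res i j (\<lambda>z. z ^ k) =
      moment Z' K' (r i j) k"
    unfolding moment_def by (rule sum_half_planes[OF finite_Z' Z'_Re])
  have "Theta p q A B S \<rho> k $ i $ j = 1 / (2 * pi * \<i>) *
     (2 * pi * \<i> * left_res i j (\<lambda>z. z ^ k) +
      2 * pi * \<i> * right_res i j (\<lambda>z. z ^ k))"
    using contour_integral_unique[OF contour_left[of "\<lambda>z. z ^ k" i j]] contour_integral_unique[OF contour_right[of "\<lambda>z. z ^ k" i j]]
    by (simp add: Theta_def holomorphic_on_power holomorphic_on_ident)
  also have "\<dots> = moment Z' K' (r i j) k"
    unfolding distrib_left[symmetric] halves by simp
  finally show ?thesis .
qed

lemma moment_eq_0:
  assumes "Suc k < 2 * (p - q)"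
  shows "moment Z' K' (r i j) k = 0"
  unfolding moment_def
proof (rule taylor_sum_moments_vanish[OF finite_Z'])
  obtain l where "((\<lambda>z. z ^ (2 * (p - q)) * R z $ i $ j) \<longlongrightarrow> l) at_infinity"
    using R_fun_scaled_tendsto[OF less_imp_le[OF qp] eventually_ar_nonzero[OF st]] by blast
  from decay_of_scaled_tendsto[OF this assms]
  have lim: "((\<lambda>z. z ^ Suc k * R z $ i $ j) \<longlongrightarrow> 0) at_infinity" .
  have "eventually (\<lambda>z. z ^ Suc k * R z $ i $ j = z ^ Suc k * pf_sum Z' K' (r i j) z) at_infinity"
    by (rule eventually_mono[OF eventually_notin_finite_at_infinity[OF finite_Z']]) (rule arg_cong[OF R_pf])
  with lim show "((\<lambda>z. z ^ Suc k * (\<Sum>a\<in>Z'. \<Sum>m<K'. r i j a m / (z - a) ^ Suc m)) \<longlongrightarrow> 0) at_infinity"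
    unfolding pf_sum_def by (rule Lim_transform_eventually)
qed

lemma contour_transfer:
  assumes "f holomorphic_on {z. Re z < 0}"
  shows "((\<lambda>z. f z * R z $ i $ j) has_contour_integral
      2 * pi * \<i> * cov_sum (\<lambda>k l. cross f i k j l)) \<rho>" (is ?th1)
    and "((\<lambda>z. f z * R (- z) $ i $ j) has_contour_integral
      2 * pi * \<i> * cov_sum (\<lambda>k l. cross f j l i k)) \<rho>" (is ?th2)
proof -
  have Zl: "Z \<inter> {z. Re z < 0} = Z" using st by auto
  have main: "((\<lambda>z. (f z * pf_sum Z K (c j l) (- z)) * pf_sum Z K (c i k) z) has_contour_integral
      2 * pi * \<i> * cross f i k j l) \<rho>" for i j k l
  proof -
    have "(\<lambda>z. f z * pf_sum Z K (c j l) (- z)) holomorphic_on {z. Re z < 0}"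
      by (intro holomorphic_on_mult assms pf_holomorphic)
    from has_contour_integral_partial_fractions[OF convex_halfspace_Re_lt open_halfspace_Re_lt this path(1,2,3) finite_Z path(4), unfolded Zl]
    show ?thesis unfolding pf_sum_def[of _ _ "c i k"] by blast
  qed
  have R: "R z $ i $ j = cov_sum (\<lambda>k l. pf_sum Z K (c i k) z * pf_sum Z K (c j l) (- z))"
    "R (- z) $ i $ j = cov_sum (\<lambda>k l. pf_sum Z K (c i k) (- z) * pf_sum Z K (c j l) z)"
    if "z \<in> path_image \<rho>" for z
  proof -
    have "z \<notin> Z" "- z \<notin> Z" using off_path[OF that] by auto
    then show "R z $ i $ j = cov_sum (\<lambda>k l. pf_sum Z K (c i k) z * pf_sum Z K (c j l) (- z))"
      "R (- z) $ i $ j = cov_sum (\<lambda>k l. pf_sum Z K (c i k) (- z) * pf_sum Z K (c j l) z)"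
      unfolding R_fun_nth by (simp_all add: pf)
  qed
  have "((\<lambda>z. \<Sum>k\<in>UNIV. \<Sum>l\<in>UNIV. of_real (S $ k $ l) * ((f z * pf_sum Z K (c j l) (- z)) *
      pf_sum Z K (c i k) z)) has_contour_integral
    cov_sum (\<lambda>k l. 2 * pi * \<i> * cross f i k j l)) \<rho>"
    by (intro has_contour_integral_sum has_contour_integral_lmul main) auto
  then have "((\<lambda>z. f z * R z $ i $ j) has_contour_integral
    cov_sum (\<lambda>k l. 2 * pi * \<i> * cross f i k j l)) \<rho>"
    by (rule has_contour_integral_eq) (simp only: R sum_distrib_left mult_ac)
  then show ?th1 by (simp only: sum_distrib_left mult_ac)
  have "((\<lambda>z. \<Sum>k\<in>UNIV. \<Sum>l\<in>UNIV. of_real (S $ k $ l) * ((f z * pf_sum Z K (c i k) (- z)) *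
      pf_sum Z K (c j l) z)) has_contour_integral
    cov_sum (\<lambda>k l. 2 * pi * \<i> * cross f j l i k)) \<rho>"
    by (intro has_contour_integral_sum has_contour_integral_lmul main) auto
  then have "((\<lambda>z. f z * R (- z) $ i $ j) has_contour_integral
    cov_sum (\<lambda>k l. 2 * pi * \<i> * cross f j l i k)) \<rho>"
    by (rule has_contour_integral_eq) (simp only: R sum_distrib_left mult_ac)
  then show ?th2 by (simp only: sum_distrib_left mult_ac)
qed

lemma autocov_residues:
  assumes t: "t \<ge> 0"
  shows "complex_of_real (autocov M Y t $ i $ j) =
      left_res i j (\<lambda>z. exp (of_real t * z))"
    and "complex_of_real (autocov M Y (- t) $ i $ j) =
      - right_res i j (\<lambda>z. exp (- of_real t * z))"
proof -
  have hol: "(\<lambda>z. exp (of_real s * z)) holomorphic_on X" "(\<lambda>z. exp (- of_real s * z)) holomorphic_on X" for s :: real and X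
    by (intro holomorphic_intros)+
  have nz: "2 * pi * \<i> \<noteq> 0" by simp
  have "2 * pi * \<i> * complex_of_real (autocov M Y t $ i $ j) = 2 * pi * \<i> *
      left_res i j (\<lambda>z. exp (of_real t * z))"
    unfolding autocov_eq(1)[OF t]
    by (rule has_contour_integral_unique[OF contour_transfer(1)[OF hol(1)] contour_left[OF hol(1)]])
  then show "complex_of_real (autocov M Y t $ i $ j) =
      left_res i j (\<lambda>z. exp (of_real t * z))"
    by (rule mult_left_cancel[THEN iffD1, OF nz])
  have "2 * pi * \<i> * complex_of_real (autocov M Y (- t) $ i $ j) = contour_integral \<rho> (\<lambda>z. exp (of_real t * z) * R (- z) $ i $ j)"
    unfolding autocov_eq(2)[OF t] by (rule contour_integral_unique[OF contour_transfer(2)[OF hol(1)], symmetric])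
  also have "\<dots> = - contour_integral (\<lambda>t. - \<rho> t) (\<lambda>z. exp (- of_real t * z) * R z $ i $ j)"
    by (simp add: contour_integral_uminus_path[OF path(1)])
  also have "contour_integral (\<lambda>t. - \<rho> t) (\<lambda>z. exp (- of_real t * z) * R z $ i $ j) = 2 * pi * \<i> *
      right_res i j (\<lambda>z. exp (- of_real t * z))"
    by (rule contour_integral_unique[OF contour_right[OF hol(2)]])
  finally have "2 * pi * \<i> * complex_of_real (autocov M Y (- t) $ i $ j) = 2 * pi * \<i> *
      - right_res i j (\<lambda>z. exp (- of_real t * z))"
    by (simp only: mult_minus_right)
  then show "complex_of_real (autocov M Y (- t) $ i $ j) =
      - right_res i j (\<lambda>z. exp (- of_real t * z))"
    by (rule mult_left_cancel[THEN iffD1, OF nz])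
qed

end

section \<open>The sampled spectral density\<close>

lemma sums_matrix_iff:
  fixes f :: "nat \<Rightarrow> complex^'n^'m"
  shows "f sums s \<longleftrightarrow> (\<forall>i j. (\<lambda>n. f n $ i $ j) sums (s $ i $ j))"
proof
  assume "f sums s"
  then show "\<forall>i j. (\<lambda>n. f n $ i $ j) sums (s $ i $ j)"
    unfolding sums_def sum_vec_nth2[symmetric] by (intro allI tendsto_vec_nth)
next
  assume "\<forall>i j. (\<lambda>n. f n $ i $ j) sums (s $ i $ j)"
  then show "f sums s"
    unfolding sums_def sum_vec_nth2[symmetric] by (intro vec_tendstoI) blast
qed

lemma has_sum_matrix:
  fixes f :: "'k \<Rightarrow> complex^'n^'m"
  assumes "\<And>i j. ((\<lambda>k. f k $ i $ j) has_sum (s $ i $ j)) X"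
  shows "(f has_sum s) X"
  using assms unfolding has_sum_def sum_vec_nth2[symmetric] by (intro vec_tendstoI)

context mcarma_contour begin

lemma sampled_spectral_density_eq:
  assumes D: "\<Delta> > 0"
  shows "sampled_spectral_density M Y \<Delta> \<omega> $ i $ j = - (1 / (2 * pi)) * phi_transform Z' K' (r i j) \<omega> (of_real \<Delta>)"
proof -
  define F where "F = (\<chi> i j. - phi_transform Z' K' (r i j) \<omega> (of_real \<Delta>))"
  have "((\<lambda>k::int. cscale (exp (- \<i> * k * \<omega>)) (cmat (autocov M Y (real_of_int k * \<Delta>)))) has_sum F) UNIV"
  proof (rule has_sum_matrix)
    fix i j
    have "((\<lambda>k. exp (- \<i> * of_int k * of_real \<omega>) * complex_of_real (autocov M Y (real_of_int k * \<Delta>) $ i $ j)) has_sum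
       - phi_transform Z' K' (r i j) \<omega> (of_real \<Delta>)) UNIV"
    proof (rule bilateral_sum[OF finite_Z' Z'_Re D])
      fix k
      show "complex_of_real (autocov M Y (real_of_int (int k) * \<Delta>) $ i $ j) =
        (left_res i j (\<lambda>z. exp (of_real (real k * \<Delta>) * z)))"
        using autocov_residues(1)[of "real k * \<Delta>" i j] D by simp
      have "real_of_int (- int (Suc k)) * \<Delta> = - (real (Suc k) * \<Delta>)" by (simp add: algebra_simps)
      moreover have "0 \<le> real (Suc k) * \<Delta>" using D by simp
      ultimately show "complex_of_real (autocov M Y (real_of_int (- int (Suc k)) * \<Delta>) $ i $ j) =
        - (right_res i j (\<lambda>z. exp (- of_real (real (Suc k) * \<Delta>) * z)))"
        using autocov_residues(2)[of "real (Suc k) * \<Delta>" i j] by (simp only:)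
    next
      show "moment Z' K' (r i j) 0 = 0" using qp by (intro moment_eq_0) auto
    qed
    then show "((\<lambda>k. cscale (exp (- \<i> * complex_of_int k * complex_of_real \<omega>)) (cmat (autocov M Y (real_of_int k *
        \<Delta>))) $ i $ j) has_sum F $ i $ j) UNIV"
      by (simp add: F_def)
  qed
  then have "sampled_spectral_density M Y \<Delta> \<omega> = cscale (1 / (2 * pi)) F"
    unfolding sampled_spectral_density_def by (simp only: infsumI)
  then show ?thesis by (simp add: F_def)
qed

abbreviation "expansion \<Delta> \<omega> k \<equiv> expansion_term p q A B S \<rho> \<Delta> \<omega> k"

lemma expansion_nth: "expansion \<Delta> \<omega> k $ i $ j = (- of_real \<Delta>) ^ k * c_tilde \<omega> k * moment Z' K' (r i j) k"
  by (simp add: expansion_term_def Theta_eq)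

lemma expansion_sums_shift:
  "(\<lambda>n. expansion \<Delta> \<omega> (n + (2 * (p - q) - 1)) $ i $ j) sums s \<longleftrightarrow>
    (\<lambda>k. (- of_real \<Delta>) ^ k * c_tilde \<omega> k * moment Z' K' (r i j) k) sums s"
proof -
  have "(\<Sum>k<2 * (p - q) - 1. (- of_real \<Delta>) ^ k * c_tilde \<omega> k * moment Z' K' (r i j) k) = 0"
    by (intro sum.neutral ballI) (simp add: moment_eq_0)
  then show ?thesis
    using sums_iff_shift[of "\<lambda>k. (- of_real \<Delta>) ^ k * c_tilde \<omega> k * moment Z' K' (r i j) k" "2 * (p - q) - 1" s]
    by (simp add: expansion_nth)
qed

lemma expansion_summable:
  assumes \<omega>: "\<omega> \<in> {-pi<..<pi}" "\<omega> \<noteq> 0" and D: "\<Delta> > 0" and small: "\<And>z. z \<in> Z \<Longrightarrow>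
      \<Delta> * cmod z < \<bar>\<omega>\<bar>"
  shows "summable (\<lambda>n. expansion \<Delta> \<omega> (n + (2 * (p - q) - 1)))"
proof -
  define s where "s = (\<chi> i j. phi_transform Z' K' (r i j) \<omega> (of_real \<Delta>))"
  have "(\<lambda>n. expansion \<Delta> \<omega> (n + (2 * (p - q) - 1))) sums s"
    unfolding sums_matrix_iff expansion_sums_shift
  proof (intro allI)
    fix i j
    have "norm (complex_of_real \<Delta>) * norm a < \<bar>\<omega>\<bar>" if "a \<in> Z'" for a
      using that small D by auto
    from phi_transform_sums[OF finite_Z' \<omega> this]
    show "(\<lambda>k. (- of_real \<Delta>) ^ k * c_tilde \<omega> k * moment Z' K' (r i j) k) sums s $ i $ j"
      by (simp add: s_def)
  qed
  then show ?thesis by (rule sums_summable)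
qed

lemma density_expansion:
  assumes \<omega>: "\<omega> \<in> {-pi<..<pi}" "\<omega> \<noteq> 0" and D: "\<Delta> > 0"
    and sm: "summable (\<lambda>n. expansion \<Delta> \<omega> (n + (2 * (p - q) - 1)))"
  shows "sampled_spectral_density M Y \<Delta> \<omega> = - cscale (1 / (2 * pi)) (\<Sum>n. expansion \<Delta> \<omega> (n + (2 * (p - q) - 1)))"
proof -
  define s where "s = (\<Sum>n. expansion \<Delta> \<omega> (n + (2 * (p - q) - 1)))"
  have "(\<lambda>n. expansion \<Delta> \<omega> (n + (2 * (p - q) - 1))) sums s" unfolding s_def by (rule summable_sums[OF sm])
  then have sums: "(\<lambda>k. (- of_real \<Delta>) ^ k * c_tilde \<omega> k * moment Z' K' (r i j) k) sums s $ i $ j" for i j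
    unfolding sums_matrix_iff expansion_sums_shift by blast
  have "s $ i $ j = phi_transform Z' K' (r i j) \<omega> (of_real \<Delta>)" for i j
    using phi_transform_eq_suminf[OF finite_Z' Z'_Re \<omega> D sums_summable[OF sums]] sums_unique[OF sums] by simp
  then show ?thesis
    unfolding s_def[symmetric] by (simp add: vec_eq_iff sampled_spectral_density_eq[OF D])
qed

end

theorem proposition1:
  fixes M :: "'w measure"
    and L1 L2 L Y :: "real \<Rightarrow> 'w \<Rightarrow> real^'d"
    and A B :: "nat \<Rightarrow> real^'d^'d"
    and p q :: nat
    and \<rho> :: "real \<Rightarrow> complex"
    and \<Delta> \<omega> :: real
  assumes "q < p"
    and "two_sided_levy M L1 L2 L"
    and "integrable M (\<lambda>w. (norm (L1 1 w))\<^sup>2)"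
    and "(\<integral>w. L1 1 w \<partial>M) = 0"
    and "\<forall>z. det (ar_poly p A z) = 0 \<longrightarrow> Re z < 0"
    and "mcarma_process M L p q A B Y"
    and "encircles_in_left_half_plane \<rho> {z. det (ar_poly p A z) = 0}"
    and "\<Delta> > 0"
    and "\<omega> \<in> {-pi<..<pi}" and "\<omega> \<noteq> 0"
  shows "((\<forall>z. det (ar_poly p A z) = 0 \<longrightarrow> \<Delta> * cmod z < \<bar>\<omega>\<bar>) \<longrightarrow>
            summable (\<lambda>n. expansion_term p q A B (cov_matrix M (L1 1)) \<rho> \<Delta> \<omega> (n + (2 * (p - q) - 1)))) \<and>
         (summable (\<lambda>n. expansion_term p q A B (cov_matrix M (L1 1)) \<rho> \<Delta> \<omega> (n + (2 * (p - q) - 1))) \<longrightarrow>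
            sampled_spectral_density M Y \<Delta> \<omega> =
              - cscale (1 / (2 * pi))
                 (\<Sum>n. expansion_term p q A B (cov_matrix M (L1 1)) \<rho> \<Delta> \<omega> (n + (2 * (p - q) - 1))))"
proof -
  have st: "\<And>z. z \<in> ar_zeros p A \<Longrightarrow> Re z < 0" using assms(5) by (simp add: ar_zeros_def)
  obtain K c where pf: "\<And>z i j. z \<notin> ar_zeros p A \<Longrightarrow> transfer p q A B z $ i $ j = pf_sum (ar_zeros p A) K (c i j) z"
    using transfer_pf[OF assms(1) st] by blast
  obtain K' r where R_pf: "\<And>z i j. z \<notin> ar_zeros p A \<union> uminus ` ar_zeros p A \<Longrightarrow>
     R_fun p q A B (cov_matrix M (L1 1)) z $ i $ j = pf_sum (ar_zeros p A \<union> uminus ` ar_zeros p A) K' (r i j) z"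
    using R_fun_pf[OF assms(1) st] by blast
  interpret mcarma_contour M L1 L2 L p q A B K c Y \<rho> K' r
    using assms(1-4,6) st pf R_pf assms(7)[folded ar_zeros_def] by unfold_locales auto
  show ?thesis
    using expansion_summable[OF assms(9,10,8)] density_expansion[OF assms(9,10,8)] by (simp add: ar_zeros_def)
qed

end
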